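(* Let $1<r<2$ and let $\omega$ be the vertical component of the vorticity of a vector field $v$ on $\mathbb{R}^3$, with $\omega_{\frac r2}\in L^2(\mathbb{R}^3)$ and $\nabla\omega_{\frac r2}\in L^2(\mathbb{R}^3)$. Let $\alpha\in\,]0,1[$, $s\in\,]0,\alpha[$, and let $G:\mathbb{R}\to\mathbb{R}$ be Hölder continuous of order $\alpha$. Then $$\big\|G(\omega_{\frac r2})\big\|_{\dot B^s_{\frac2\alpha,1}}\lesssim\big\|\nabla\omega_{\frac r2}\big\|_{L^2}^{s}\,\big\|\omega_{\frac r2}\big\|_{L^2}^{\alpha-s}.$$ In particular, if $s\in\,]0,\frac2{r'}[$, where $\frac1r+\frac1{r'}=1$, then $$\big\|\omega_{r-1}\big\|_{\dot B^s_{r',1}}\lesssim\big\|\nabla\omega_{\frac r2}\big\|_{L^2}^{s}\,\big\|\omega_{\frac r2}\big\|_{L^2}^{\frac2{r'}-s}.$$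
   Context: For a real-valued function $a$ and $\sigma\in\,]0,1[$, $a_\sigma:=\frac{a}{|a|}|a|^\sigma$ (equal to $0$ where $a=0$). The vertical vorticity component is $\omega=\partial_1v^2-\partial_2v^1$. The notation $A\lesssim B$ means $A\le CB$ with $C$ independent of $\omega$ ($C$ may depend on $s,\alpha,r$ and on the Hölder seminorm $\|G\|_{C^\alpha}=\sup_{x\ne y}|G(x)-G(y)|/|x-y|^\alpha$). Homogeneous Besov norm: fix smooth radial functions $\chi,\varphi$ with values in $[0,1]$, $\chi$ supported in $\{|\xi|\le 4/3\}$, $\varphi$ supported in $\{3/4\le|\xi|\le 8/3\}$, and $\chi(\xi)+\sum_{j\ge0}\varphi(2^{-j}\xi)=1$ for all $\xi$. Set $\Delta_j u=\mathcal F^{-1}(\varphi(2^{-j}|\xi|)\hat u)$, $j\in\mathbb{Z}$, and $\|u\|_{\dot B^s_{p,q}}=\big\|(2^{js}\|\Delta_ju\|_{L^p(\mathbb{R}^3)})_{j}\big\|_{\ell^q(\mathbb{Z})}$. *)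

theory Defs
  imports "HOL-Analysis.Analysis"
begin

section \<open>Smooth functions, test functions and Schwartz functions\<close>

definition partial :: "'n \<Rightarrow> (real^'n::finite \<Rightarrow> 'b::real_normed_vector) \<Rightarrow> real^'n \<Rightarrow> 'b" where
  "partial i f x = frechet_derivative f (at x) (axis i 1)"

fun iter_partial :: "'n list \<Rightarrow> (real^'n::finite \<Rightarrow> 'b::real_normed_vector) \<Rightarrow> real^'n \<Rightarrow> 'b" where
  "iter_partial [] f = f"
| "iter_partial (i # is) f = partial i (iter_partial is f)"

text \<open>Smooth means that every iterated partial derivative is Frechet differentiable everywhere;
  in particular all of them are continuous.\<close>

definition smooth :: "(real^'n::finite \<Rightarrow> 'b::real_normed_vector) \<Rightarrow> bool" where
  "smooth f \<longleftrightarrow> (\<forall>is x. iter_partial is f differentiable (at x))"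

definition test_function :: "(real^'n::finite \<Rightarrow> real) \<Rightarrow> bool" where
  "test_function \<theta> \<longleftrightarrow> smooth \<theta> \<and> compact (closure {x. \<theta> x \<noteq> 0})"

definition schwartz :: "(real^3 \<Rightarrow> complex) set" where
  "schwartz = {\<theta>. smooth \<theta> \<and>
     (\<forall>k::nat. \<forall>is. bounded (range (\<lambda>x. norm x ^ k * norm (iter_partial is \<theta> x))))}"


section \<open>Lebesgue norms\<close>

text \<open>The power of an element of \<open>[0,\<infinity>]\<close> to a positive real exponent.\<close>

definition epow :: "ennreal \<Rightarrow> real \<Rightarrow> ennreal" where
  "epow a p = (if a = \<infinity> then \<infinity> else ennreal (enn2real a powr p))"

definition Lp_norm :: "real \<Rightarrow> (real^3 \<Rightarrow> 'b::real_normed_vector) \<Rightarrow> ennreal" where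
  "Lp_norm p f = epow (\<integral>\<^sup>+ x. ennreal (norm (f x) powr p) \<partial>lebesgue) (1 / p)"

definition in_Lp :: "real \<Rightarrow> (real^3 \<Rightarrow> 'b::real_normed_vector) \<Rightarrow> bool" where
  "in_Lp p f \<longleftrightarrow> f \<in> borel_measurable lebesgue \<and> Lp_norm p f < \<infinity>"

definition locally_integrable :: "(real^3 \<Rightarrow> 'b::euclidean_space) \<Rightarrow> bool" where
  "locally_integrable f \<longleftrightarrow> (\<forall>K. compact K \<longrightarrow> f absolutely_integrable_on K)"


section \<open>Weak derivatives\<close>

definition weak_gradient :: "(real^3 \<Rightarrow> real) \<Rightarrow> (real^3 \<Rightarrow> real^3) \<Rightarrow> bool" where
  "weak_gradient u W \<longleftrightarrow> locally_integrable u \<and> locally_integrable W \<and>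
     (\<forall>i \<theta>. test_function \<theta> \<longrightarrow>
        (LINT x|lebesgue. W x $ i * \<theta> x) = - (LINT x|lebesgue. u x * partial i \<theta> x))"

text \<open>\<open>\<omega> = \<partial>\<^sub>1 v\<^sup>2 - \<partial>\<^sub>2 v\<^sup>1\<close> in the sense of distributions.\<close>

definition vertical_vorticity :: "(real^3 \<Rightarrow> real^3) \<Rightarrow> (real^3 \<Rightarrow> real) \<Rightarrow> bool" where
  "vertical_vorticity v \<omega> \<longleftrightarrow> locally_integrable v \<and> locally_integrable \<omega> \<and>
     (\<forall>\<theta>. test_function \<theta> \<longrightarrow>
        (LINT x|lebesgue. \<omega> x * \<theta> x)
          = - (LINT x|lebesgue. v x $ 2 * partial 1 \<theta> x - v x $ 1 * partial 2 \<theta> x))"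


section \<open>Signed powers and Hoelder seminorm\<close>

text \<open>For \<open>a = 0\<close> the value is \<open>0\<close>, by the convention \<open>0 / 0 = 0\<close>.\<close>

definition signed_pow :: "real \<Rightarrow> real \<Rightarrow> real" where
  "signed_pow \<sigma> a = a / \<bar>a\<bar> * \<bar>a\<bar> powr \<sigma>"

definition holder_seminorm :: "real \<Rightarrow> (real \<Rightarrow> real) \<Rightarrow> ennreal" where
  "holder_seminorm \<alpha> G =
     (SUP (x, y) \<in> {(x, y). x \<noteq> y}. ennreal (\<bar>G x - G y\<bar> / \<bar>x - y\<bar> powr \<alpha>))"


section \<open>Fourier transform of functions and tempered distributions\<close>

definition fourier :: "(real^3 \<Rightarrow> complex) \<Rightarrow> real^3 \<Rightarrow> complex" where
  "fourier f \<xi> = (LINT x|lebesgue. exp (- \<i> * of_real (x \<bullet> \<xi>)) * f x)"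

definition inv_fourier :: "(real^3 \<Rightarrow> complex) \<Rightarrow> real^3 \<Rightarrow> complex" where
  "inv_fourier f x = (LINT \<xi>|lebesgue. exp (\<i> * of_real (x \<bullet> \<xi>)) * f \<xi>) / of_real ((2 * pi) ^ 3)"

text \<open>Tempered distributions are represented by their action on Schwartz functions; the values
  of the functional outside \<open>schwartz\<close> are irrelevant. The Fourier transform and
  multiplication by a smooth function are defined by duality.\<close>

type_synonym distr = "(real^3 \<Rightarrow> complex) \<Rightarrow> complex"

definition distr_fourier :: "distr \<Rightarrow> distr" where
  "distr_fourier T = (\<lambda>\<theta>. T (fourier \<theta>))"

definition distr_inv_fourier :: "distr \<Rightarrow> distr" where
  "distr_inv_fourier T = (\<lambda>\<theta>. T (inv_fourier \<theta>))"

definition distr_mult :: "(real^3 \<Rightarrow> real) \<Rightarrow> distr \<Rightarrow> distr" where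
  "distr_mult m T = (\<lambda>\<theta>. T (\<lambda>\<xi>. of_real (m \<xi>) * \<theta> \<xi>))"

text \<open>Integrability against every Schwartz function makes the functional \<open>distr_of f\<close>
  continuous on the Schwartz space (uniform boundedness), so \<open>f\<close> is a tempered distribution.\<close>

definition tempered :: "(real^3 \<Rightarrow> complex) \<Rightarrow> bool" where
  "tempered f \<longleftrightarrow> f \<in> borel_measurable lebesgue \<and>
     (\<forall>\<theta>\<in>schwartz. integrable lebesgue (\<lambda>x. f x * \<theta> x))"

definition distr_of :: "(real^3 \<Rightarrow> complex) \<Rightarrow> distr" where
  "distr_of f = (\<lambda>\<theta>. LINT x|lebesgue. f x * \<theta> x)"

text \<open>The norm is \<open>\<infinity>\<close> if the distribution is not given by a function; otherwise
  the infimum is over a single almost-everywhere class.\<close>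

definition distr_Lp_norm :: "real \<Rightarrow> distr \<Rightarrow> ennreal" where
  "distr_Lp_norm p T =
     (INF f \<in> {f. tempered f \<and> (\<forall>\<theta>\<in>schwartz. T \<theta> = distr_of f \<theta>)}. Lp_norm p f)"


section \<open>Homogeneous Besov norms\<close>

definition radial :: "(real^3 \<Rightarrow> real) \<Rightarrow> bool" where
  "radial f \<longleftrightarrow> (\<forall>x y. norm x = norm y \<longrightarrow> f x = f y)"

text \<open>The low-frequency cutoff is called \<open>\<psi>\<close>, since chi is reserved syntax for vectors.\<close>

definition littlewood_paley :: "(real^3 \<Rightarrow> real) \<Rightarrow> (real^3 \<Rightarrow> real) \<Rightarrow> bool" where
  "littlewood_paley \<psi> \<phi> \<longleftrightarrow>
     smooth \<psi> \<and> smooth \<phi> \<and> radial \<psi> \<and> radial \<phi> \<and>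
     range \<psi> \<subseteq> {0..1} \<and> range \<phi> \<subseteq> {0..1} \<and>
     closure {\<xi>. \<psi> \<xi> \<noteq> 0} \<subseteq> {\<xi>. norm \<xi> \<le> 4/3} \<and>
     closure {\<xi>. \<phi> \<xi> \<noteq> 0} \<subseteq> {\<xi>. 3/4 \<le> norm \<xi> \<and> norm \<xi> \<le> 8/3} \<and>
     (\<forall>\<xi>. (\<lambda>j::nat. \<phi> ((1 / 2 ^ j) *\<^sub>R \<xi>)) sums (1 - \<psi> \<xi>))"

definition dyadic_block :: "(real^3 \<Rightarrow> real) \<Rightarrow> int \<Rightarrow> distr \<Rightarrow> distr" where
  "dyadic_block \<phi> j T =
     distr_inv_fourier (distr_mult (\<lambda>\<xi>. \<phi> ((2 powi (- j)) *\<^sub>R \<xi>)) (distr_fourier T))"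

text \<open>Exponents \<open>p\<close> and \<open>q\<close> are finite. A function that is not a tempered distribution has
  infinite norm.\<close>

definition besov_norm ::
    "(real^3 \<Rightarrow> real) \<Rightarrow> real \<Rightarrow> real \<Rightarrow> real \<Rightarrow> (real^3 \<Rightarrow> real) \<Rightarrow> ennreal" where
  "besov_norm \<phi> s p q f =
     (if tempered (\<lambda>x. of_real (f x))
      then epow (\<integral>\<^sup>+ j. epow (ennreal (2 powr (of_int j * s)) *
               distr_Lp_norm p (dyadic_block \<phi> j (distr_of (\<lambda>x. of_real (f x))))) q
             \<partial>count_space (UNIV :: int set)) (1 / q)
      else \<infinity>)"

end

theory Submission
  imports Defs
begin

text \<open>
Write \<open>u\<close> for the signed power of the vorticity, \<open>W\<close> for its weak gradient, and let \<open>A\<close> and \<open>B\<close> be the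
\<open>L\<^sup>2\<close> norms of \<open>W\<close> and \<open>u\<close>. The exponent \<open>p = 2/\<alpha>\<close> is the one for which \<open>p \<alpha> = 2\<close>, and three facts are
combined.

First, a dyadic block of a function \<open>f\<close> is the convolution of \<open>f\<close> with the kernel \<open>h\<^sub>j\<close>, the inverse
Fourier transform of \<open>\<phi>(2\<^bsup>-j\<^esup> \<cdot>)\<close>, and this kernel has integral zero. So the block at \<open>x\<close> is the
average of \<open>f(x - z) - f(x)\<close> against \<open>h\<^sub>j(z)\<close> (lemmas \<open>distr_of_kernel_convolution\<close> and
\<open>integral_kernel_eq_0\<close>).

Secondly, for \<open>f = G \<circ> u\<close> with \<open>G\<close> Hoelder continuous, the \<open>p\<close>-th power of \<open>\<bar>f(x - z) - f(x)\<bar>\<close> is at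
most a constant times \<open>(u(x - z) - u(x))\<^sup>2\<close>. The integral of the latter in \<open>x\<close> is at most \<open>4 B\<^sup>2\<close>
trivially and at most \<open>(\<bar>z\<bar> A)\<^sup>2\<close> because \<open>u\<close> has a weak gradient in \<open>L\<^sup>2\<close> (lemma
\<open>translation_difference_le_weak_gradient\<close>). Jensen's inequality and the second moments of the
rescaled kernels bound the \<open>L\<^sup>p\<close> norm of the block by a constant times \<open>min (2\<^bsup>-j\<^esup> A) B\<close> to the
power \<open>\<alpha>\<close> (lemma \<open>kernel_convolution_holder_le\<close>).

Thirdly, after multiplication by \<open>2\<^bsup>js\<^esup>\<close> with \<open>0 < s < \<alpha>\<close> these bounds decay geometrically on both
sides of the scale \<open>2\<^sup>j \<approx> A/B\<close>, at which they have size \<open>A\<^sup>s B\<^bsup>\<alpha>-s\<^esup>\<close>; hence their sum is at most a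
constant times this size (lemma \<open>nn_integral_dyadic_interpolation\<close>).

The second assertion is the case \<open>\<alpha> = 2/r'\<close> in which \<open>G\<close> is itself the signed power of exponent \<open>\<alpha>\<close>.
\<close>

section \<open>Smooth functions\<close>

lemma partial_has_derivative:
  assumes "(f has_derivative f') (at x)"
  shows "partial i f x = f' (axis i 1)"
  using frechet_derivative_at[OF assms] by (simp add: partial_def)

lemma iter_partial_append: "iter_partial (is @ js) f = iter_partial is (iter_partial js f)"
  by (induction "is") simp_all

text \<open>Smoothness quantifies over all lists of indices at once, which gives no induction hypothesis for the
partial derivatives of a product: they are sums of products of other functions. Bounding the length
of the lists makes the closure properties provable by induction on the bound, for all functions
simultaneously.\<close>

definition differentiable_upto :: "nat \<Rightarrow> (real^'n::finite \<Rightarrow> 'b::real_normed_vector) \<Rightarrow> bool" where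
  "differentiable_upto n f \<longleftrightarrow> (\<forall>is x. length is \<le> n \<longrightarrow> iter_partial is f differentiable (at x))"

lemma smooth_iff_differentiable_upto: "smooth f \<longleftrightarrow> (\<forall>n. differentiable_upto n f)"
  unfolding smooth_def differentiable_upto_def by auto

lemma differentiable_upto_0: "differentiable_upto 0 f \<longleftrightarrow> (\<forall>x. f differentiable (at x))"
  by (simp add: differentiable_upto_def)

lemma differentiable_upto_Suc:
  fixes f :: "real^'n::finite \<Rightarrow> 'b::real_normed_vector"
  shows
  "differentiable_upto (Suc n) f \<longleftrightarrow>
     (\<forall>x. f differentiable (at x)) \<and> (\<forall>i. differentiable_upto n (partial i f))"
proof (intro iffI conjI allI)
  fix x assume D: "differentiable_upto (Suc n) f"
  from D[unfolded differentiable_upto_def, rule_format, of "[]"]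
  show "f differentiable (at x)" by simp
next
  fix i :: 'n assume D: "differentiable_upto (Suc n) f"
  show "differentiable_upto n (partial i f)"
    unfolding differentiable_upto_def
  proof (intro allI impI)
    fix "is" :: "'n list" and x assume "length is \<le> n"
    then have "iter_partial (is @ [i]) f differentiable (at x)"
      using D unfolding differentiable_upto_def by (metis Suc_le_mono length_append_singleton)
    then show "iter_partial is (partial i f) differentiable (at x)"
      by (simp add: iter_partial_append)
  qed
next
  assume D: "(\<forall>x. f differentiable (at x)) \<and> (\<forall>i. differentiable_upto n (partial i f))"
  show "differentiable_upto (Suc n) f"
    unfolding differentiable_upto_def
  proof (intro allI impI)
    fix "is" :: "'n list" and x assume len: "length is \<le> Suc n"
    show "iter_partial is f differentiable (at x)"
    proof (cases "is" rule: rev_cases)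
      case Nil
      then show ?thesis using D by simp
    next
      case (snoc js i)
      then show ?thesis
        using D len unfolding differentiable_upto_def by (auto simp: iter_partial_append)
    qed
  qed
qed

lemma differentiable_upto_differentiable: "differentiable_upto n f \<Longrightarrow> f differentiable (at x)"
  by (cases n) (auto simp: differentiable_upto_0 differentiable_upto_Suc)

lemma differentiable_upto_Suc_le: "differentiable_upto (Suc n) f \<Longrightarrow> differentiable_upto n f"
  unfolding differentiable_upto_def by auto

lemma differentiable_upto_const: "differentiable_upto n (\<lambda>_::real^'n::finite. c)"
proof (induction n arbitrary: c)
  case (Suc n)
  have "partial i (\<lambda>_. c) = (\<lambda>_. 0)" for i :: 'n
    by (rule ext, subst partial_has_derivative[where f' = "\<lambda>_. 0"]) auto
  then have "differentiable_upto n (partial i (\<lambda>_. c))" for i :: 'n using Suc by metis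
  then show ?case by (simp add: differentiable_upto_Suc)
qed (simp add: differentiable_upto_0)

lemma partial_add:
  assumes "f differentiable (at x)" "g differentiable (at x)"
  shows "partial i (\<lambda>x. f x + g x) x = partial i f x + partial i g x"
  using assms unfolding frechet_derivative_works
  by (subst partial_has_derivative) (auto intro!: derivative_eq_intros simp: partial_def)

lemma partial_mult:
  fixes f g :: "real^'n::finite \<Rightarrow> real"
  assumes "f differentiable (at x)" "g differentiable (at x)"
  shows "partial i (\<lambda>x. f x * g x) x = partial i f x * g x + f x * partial i g x"
  using assms unfolding frechet_derivative_works
  by (subst partial_has_derivative) (auto intro!: derivative_eq_intros simp: partial_def)

lemma differentiable_upto_add:
  "differentiable_upto n f \<Longrightarrow> differentiable_upto n g \<Longrightarrow> differentiable_upto n (\<lambda>x. f x + g x)"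
proof (induction n arbitrary: f g)
  case (Suc n)
  then have "partial i (\<lambda>x. f x + g x) = (\<lambda>x. partial i f x + partial i g x)" for i
    by (intro ext partial_add) (auto simp: differentiable_upto_Suc)
  with Suc show ?case by (auto simp: differentiable_upto_Suc)
qed (auto simp: differentiable_upto_0)

lemma differentiable_upto_mult:
  fixes f g :: "real^'n::finite \<Rightarrow> real"
  shows "differentiable_upto n f \<Longrightarrow> differentiable_upto n g \<Longrightarrow> differentiable_upto n (\<lambda>x. f x * g x)"
proof (induction n arbitrary: f g)
  case (Suc n)
  then have "partial i (\<lambda>x. f x * g x) = (\<lambda>x. partial i f x * g x + f x * partial i g x)" for i
    by (intro ext partial_mult) (auto simp: differentiable_upto_Suc)
  moreover have "differentiable_upto n f" "differentiable_upto n g"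
    using Suc.prems by (auto intro: differentiable_upto_Suc_le)
  ultimately show ?case using Suc
    by (auto simp: differentiable_upto_Suc intro!: differentiable_upto_add)
qed (auto simp: differentiable_upto_0)

lemma partial_affine:
  fixes f :: "real^'n::finite \<Rightarrow> real"
  assumes "\<And>x. f differentiable (at x)"
  shows "partial i (\<lambda>x. f (a + c *\<^sub>R x)) = (\<lambda>x. c * partial i f (a + c *\<^sub>R x))"
proof
  fix x
  have "((\<lambda>x. a + c *\<^sub>R x) has_derivative (\<lambda>y. c *\<^sub>R y)) (at x)"
    by (auto intro!: derivative_eq_intros)
  moreover have f: "(f has_derivative frechet_derivative f (at (a + c *\<^sub>R x))) (at (a + c *\<^sub>R x))"
    using assms frechet_derivative_works by blast
  ultimately have "((\<lambda>x. f (a + c *\<^sub>R x)) has_derivative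
      (\<lambda>y. frechet_derivative f (at (a + c *\<^sub>R x)) (c *\<^sub>R y))) (at x)"
    by (rule has_derivative_compose)
  then show "partial i (\<lambda>x. f (a + c *\<^sub>R x)) x = c * partial i f (a + c *\<^sub>R x)"
    using linear_scale[OF has_derivative_linear[OF f]]
    by (simp add: partial_has_derivative) (simp add: partial_def)
qed

lemma differentiable_upto_affine:
  fixes f :: "real^'n::finite \<Rightarrow> real"
  shows "differentiable_upto n f \<Longrightarrow> differentiable_upto n (\<lambda>x. f (a + c *\<^sub>R x))"
proof (induction n arbitrary: f)
  case 0
  then have "(\<lambda>x. f (a + c *\<^sub>R x)) differentiable (at x)" for x
    using differentiable_chain_at[of "\<lambda>x. a + c *\<^sub>R x" x f]
    by (simp add: differentiable_upto_0 o_def)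
  then show ?case by (simp add: differentiable_upto_0)
next
  case (Suc n)
  then have d: "\<And>x. f differentiable (at x)" by (simp add: differentiable_upto_Suc)
  then have "(\<lambda>x. f (a + c *\<^sub>R x)) differentiable (at x)" for x
    using differentiable_chain_at[of "\<lambda>x. a + c *\<^sub>R x" x f]
    by (simp add: o_def)
  then show ?case using Suc d
    by (auto simp: differentiable_upto_Suc partial_affine
        intro!: differentiable_upto_mult differentiable_upto_const)
qed

lemma smooth_affine:
  fixes f :: "real^'n::finite \<Rightarrow> real"
  shows "smooth f \<Longrightarrow> smooth (\<lambda>x. f (a + c *\<^sub>R x))"
  by (simp add: smooth_iff_differentiable_upto differentiable_upto_affine)

lemma smooth_mult:
  fixes f g :: "real^'n::finite \<Rightarrow> real"
  shows "smooth f \<Longrightarrow> smooth g \<Longrightarrow> smooth (\<lambda>x. f x * g x)"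
  by (simp add: smooth_iff_differentiable_upto differentiable_upto_mult)

lemma smooth_polynomial:
  fixes f :: "real^'n::finite \<Rightarrow> real"
  assumes "real_polynomial_function f"
  shows "smooth f"
  using assms
proof induction
  case (linear f)
  have d: "(f has_derivative f) (at x)" for x
    using linear by (rule bounded_linear_imp_has_derivative)
  have "partial i f = (\<lambda>_. f (axis i 1))" for i
    using d by (auto simp: partial_has_derivative)
  moreover have "f differentiable (at x)" for x
    using d differentiable_def by blast
  ultimately have "differentiable_upto n f" for n
    by (cases n) (auto simp: differentiable_upto_0 differentiable_upto_Suc differentiable_upto_const)
  then show ?case by (simp add: smooth_iff_differentiable_upto)
qed (simp_all add: smooth_iff_differentiable_upto differentiable_upto_const
    differentiable_upto_add differentiable_upto_mult)

lemma smooth_differentiable: "smooth f \<Longrightarrow> f differentiable (at x)"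
  using differentiable_upto_differentiable smooth_iff_differentiable_upto by blast

lemma smooth_continuous: "smooth f \<Longrightarrow> continuous_on S f"
  using smooth_differentiable differentiable_imp_continuous_within
  by (metis continuous_at_imp_continuous_on)

lemma smooth_partial: "smooth f \<Longrightarrow> smooth (partial i f)"
  using differentiable_upto_Suc smooth_iff_differentiable_upto by blast

lemma frechet_derivative_eq_sum_partial:
  assumes "f differentiable (at x)"
  shows "frechet_derivative f (at x) y = (\<Sum>i\<in>UNIV. y $ i *\<^sub>R partial i f x)"
proof -
  have lin: "linear (frechet_derivative f (at x))"
    using assms by (rule linear_frechet_derivative)
  have "frechet_derivative f (at x) y
      = frechet_derivative f (at x) (\<Sum>i\<in>UNIV. y $ i *\<^sub>R axis i 1)"
    using basis_expansion[of y] by (simp add: scalar_mult_eq_scaleR)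
  also have "\<dots> = (\<Sum>i\<in>UNIV. y $ i *\<^sub>R partial i f x)"
    by (simp add: linear_sum[OF lin] linear_scale[OF lin] partial_def)
  finally show ?thesis .
qed

section \<open>Test functions\<close>

lemma test_function_iff:
  "test_function \<theta> \<longleftrightarrow> smooth \<theta> \<and> (\<exists>R. \<forall>x. norm x > R \<longrightarrow> \<theta> x = 0)"
proof
  assume "test_function \<theta>"
  then have "smooth \<theta>" and "bounded {x. \<theta> x \<noteq> 0}"
    unfolding test_function_def using compact_imp_bounded bounded_subset closure_subset by blast+
  then show "smooth \<theta> \<and> (\<exists>R. \<forall>x. norm x > R \<longrightarrow> \<theta> x = 0)"
    unfolding bounded_iff by (metis (mono_tags, lifting) linorder_not_less mem_Collect_eq)
next
  assume "smooth \<theta> \<and> (\<exists>R. \<forall>x. norm x > R \<longrightarrow> \<theta> x = 0)"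
  then obtain R where "smooth \<theta>" and R: "\<And>x. norm x > R \<Longrightarrow> \<theta> x = 0" by blast
  moreover have "bounded {x. \<theta> x \<noteq> 0}"
    unfolding bounded_iff using R by (metis (mono_tags, lifting) linorder_not_less mem_Collect_eq)
  ultimately show "test_function \<theta>" by (simp add: test_function_def compact_closure)
qed

lemma test_function_smooth: "test_function \<theta> \<Longrightarrow> smooth \<theta>"
  by (simp add: test_function_def)

lemma test_function_support:
  assumes "test_function \<theta>"
  obtains R where "R > 0" "\<And>x. norm x > R \<Longrightarrow> \<theta> x = 0"
proof -
  obtain R where "\<And>x. norm x > R \<Longrightarrow> \<theta> x = 0"
    using assms unfolding test_function_iff by blast
  then show thesis using that[of "max R 1"] by simp
qed

lemma test_function_partial:
  assumes "test_function \<theta>"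
  shows "test_function (partial i \<theta>)"
proof -
  obtain R where R: "\<And>x. norm x > R \<Longrightarrow> \<theta> x = 0"
    using test_function_support[OF assms] by blast
  have "partial i \<theta> x = 0" if x: "norm x > R" for x
  proof -
    have "open {x. norm x > R}" by (intro open_Collect_less continuous_intros)
    then have "(\<theta> has_derivative (\<lambda>_. 0)) (at x)"
      by (rule has_derivative_transform_within_open[OF has_derivative_const[of 0]]) (use x R in auto)
    then show ?thesis by (simp add: partial_has_derivative)
  qed
  then show ?thesis using assms smooth_partial unfolding test_function_iff by blast
qed

lemma test_function_affine:
  assumes "test_function \<theta>" "c \<noteq> 0"
  shows "test_function (\<lambda>x. \<theta> (a + c *\<^sub>R x))"
proof -
  obtain R where R: "\<And>x. norm x > R \<Longrightarrow> \<theta> x = 0"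
    using test_function_support[OF assms(1)] by blast
  have "\<theta> (a + c *\<^sub>R x) = 0" if "norm x > (R + norm a) / \<bar>c\<bar>" for x
  proof (rule R)
    have "R + norm a < norm (c *\<^sub>R x)" using that assms(2) by (simp add: field_simps)
    moreover have "norm (c *\<^sub>R x) \<le> norm (a + c *\<^sub>R x) + norm a"
      using norm_triangle_ineq4[of "a + c *\<^sub>R x" a] by simp
    ultimately show "norm (a + c *\<^sub>R x) > R" by linarith
  qed
  then show ?thesis using smooth_affine assms unfolding test_function_iff by blast
qed

lemma test_function_mult:
  assumes "smooth p" "test_function \<theta>"
  shows "test_function (\<lambda>x. p x * \<theta> x)"
  using assms smooth_mult unfolding test_function_iff by (metis mult_zero_right)

lemma test_function_bounded:
  assumes "test_function \<theta>"
  obtains M where "M > 0" "\<And>x. \<bar>\<theta> x\<bar> \<le> M"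
proof -
  obtain R where R: "\<And>x. norm x > R \<Longrightarrow> \<theta> x = 0"
    using test_function_support[OF assms] by blast
  have "bounded (\<theta> ` cball 0 R)"
    using assms by (intro compact_imp_bounded compact_continuous_image)
      (auto intro: smooth_continuous test_function_smooth)
  then obtain M where M: "M > 0" "\<And>x. x \<in> cball 0 R \<Longrightarrow> \<bar>\<theta> x\<bar> \<le> M"
    unfolding bounded_pos by auto
  have "\<bar>\<theta> x\<bar> \<le> M" for x
    using M R[of x] by (cases "norm x \<le> R") auto
  with M(1) show thesis using that by blast
qed

lemma test_function_integrable:
  assumes "test_function \<theta>"
  shows "integrable lborel \<theta>"
proof -
  obtain R where R: "\<And>x. norm x > R \<Longrightarrow> \<theta> x = 0"
    using test_function_support[OF assms] by blast
  have "set_integrable lborel (cball 0 R) \<theta>"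
    unfolding set_integrable_def
    using assms by (intro borel_integrable_compact) (auto intro: smooth_continuous test_function_smooth)
  moreover have "(\<lambda>x. indicator (cball 0 R) x *\<^sub>R \<theta> x) = \<theta>"
    using R by (intro ext) (auto simp: indicator_def not_le)
  ultimately show ?thesis by (simp add: set_integrable_def)
qed

lemma test_function_lipschitz:
  assumes "test_function \<theta>"
  obtains L where "L > 0" "\<And>x y. \<bar>\<theta> (x + y) - \<theta> x\<bar> \<le> L * norm y"
proof -
  have "\<forall>i. \<exists>M. \<forall>x. \<bar>partial i \<theta> x\<bar> \<le> M"
    using test_function_bounded[OF test_function_partial[OF assms]] by metis
  then obtain M where M: "\<And>i x. \<bar>partial i \<theta> x\<bar> \<le> M i" by metis
  define L where "L = (\<Sum>i\<in>UNIV. M i) + 1"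
  have Mnn: "M i \<ge> 0" for i using M[of i 0] by linarith
  have Lpos: "L > 0" unfolding L_def using Mnn by (simp add: add_nonneg_pos sum_nonneg)
  have diff: "\<theta> differentiable (at x)" for x
    using assms by (simp add: smooth_differentiable test_function_smooth)
  have "onorm (frechet_derivative \<theta> (at x)) \<le> L" for x
  proof (rule onorm_le)
    fix y
    have "norm (frechet_derivative \<theta> (at x) y) \<le> (\<Sum>i\<in>UNIV. \<bar>y $ i\<bar> * \<bar>partial i \<theta> x\<bar>)"
      unfolding frechet_derivative_eq_sum_partial[OF diff] 
      by (rule order_trans[OF norm_sum]) (simp add: abs_mult)
    also have "\<dots> \<le> (\<Sum>i\<in>UNIV. norm y * M i)"
      by (intro sum_mono mult_mono M) (auto simp: component_le_norm_cart)
    also have "\<dots> \<le> L * norm y"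
      unfolding L_def by (simp add: distrib_right sum_distrib_right mult.commute[of "norm y"])
    finally show "norm (frechet_derivative \<theta> (at x) y) \<le> L * norm y" .
  qed
  then have "norm (\<theta> (x + y) - \<theta> x) \<le> L * norm ((x + y) - x)" for x y
    using diff frechet_derivative_works
    by (intro differentiable_bound[of UNIV \<theta> "\<lambda>x. frechet_derivative \<theta> (at x)"]) auto
  with Lpos show thesis using that by auto
qed

section \<open>Lebesgue measure under affine maps\<close>

lemma nn_integral_lborel_affine:
  fixes f :: "'a::euclidean_space \<Rightarrow> ennreal"
  assumes [measurable]: "f \<in> borel_measurable borel" and c: "c \<noteq> 0"
  shows "(\<integral>\<^sup>+x. f x \<partial>lborel) = ennreal (\<bar>c\<bar> ^ DIM('a)) * (\<integral>\<^sup>+x. f (t + c *\<^sub>R x) \<partial>lborel)"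
  by (subst lborel_affine[OF c, of t])
     (simp add: nn_integral_density nn_integral_distr nn_integral_cmult)

lemma integrable_lborel_affine:
  fixes f :: "'a::euclidean_space \<Rightarrow> 'b::{banach, second_countable_topology}"
  assumes f: "integrable lborel f" and c: "c \<noteq> 0"
  shows "integrable lborel (\<lambda>x. f (t + c *\<^sub>R x))"
  using f f[THEN borel_measurable_integrable] c unfolding integrable_iff_bounded
  by (subst (asm) nn_integral_lborel_affine[where c=c and t=t]) (auto simp: ennreal_mult_less_top)

lemma integral_lborel_affine:
  fixes f :: "'a::euclidean_space \<Rightarrow> 'b::{banach, second_countable_topology}"
  assumes [measurable]: "f \<in> borel_measurable borel" and c: "c \<noteq> 0"
  shows "(LINT x|lborel. f x) = \<bar>c\<bar> ^ DIM('a) *\<^sub>R (LINT x|lborel. f (t + c *\<^sub>R x))"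
proof -
  have "(LINT x|lborel. f x) =
      (LINT x|density (distr lborel borel (\<lambda>x. t + c *\<^sub>R x)) (\<lambda>_. ennreal (\<bar>c\<bar> ^ DIM('a))). f x)"
    by (subst lborel_affine[OF c, of t]) simp
  also have "\<dots> = \<bar>c\<bar> ^ DIM('a) *\<^sub>R (LINT x|lborel. f (t + c *\<^sub>R x))"
    by (subst integral_density) (auto simp: integral_distr)
  finally show ?thesis .
qed

lemma nn_integral_lborel_translate:
  fixes f :: "'a::euclidean_space \<Rightarrow> ennreal"
  assumes "f \<in> borel_measurable borel"
  shows "(\<integral>\<^sup>+x. f (t + x) \<partial>lborel) = (\<integral>\<^sup>+x. f x \<partial>lborel)"
  using nn_integral_lborel_affine[OF assms, of 1 t] by simp

lemma integral_lborel_translate: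
  fixes f :: "'a::euclidean_space \<Rightarrow> 'b::{banach, second_countable_topology}"
  assumes "f \<in> borel_measurable borel"
  shows "(LINT x|lborel. f (t + x)) = (LINT x|lborel. f x)"
  using integral_lborel_affine[OF assms, of 1 t] by simp

section \<open>Integrating test functions against locally integrable functions\<close>

lemma test_function_borel_measurable: "test_function \<theta> \<Longrightarrow> \<theta> \<in> borel_measurable borel"
  by (intro borel_measurable_continuous_onI smooth_continuous test_function_smooth)

lemma integrable_test_function_scaleR:
  fixes g :: "real^'n::finite \<Rightarrow> 'b::{banach, second_countable_topology}"
  assumes \<theta>: "test_function \<theta>" and [measurable]: "g \<in> borel_measurable borel"
    and g: "\<And>R. set_integrable lborel (cball 0 R) g"
  shows "integrable lborel (\<lambda>x. \<theta> x *\<^sub>R g x)"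
proof -
  obtain R where R: "\<And>x. norm x > R \<Longrightarrow> \<theta> x = 0" using test_function_support[OF \<theta>] by blast
  obtain M where M: "M > 0" "\<And>x. \<bar>\<theta> x\<bar> \<le> M" using test_function_bounded[OF \<theta>] by blast
  have [measurable]: "\<theta> \<in> borel_measurable borel" by (rule test_function_borel_measurable[OF \<theta>])
  show ?thesis
  proof (rule Bochner_Integration.integrable_bound)
    show "integrable lborel (\<lambda>x. M *\<^sub>R (indicator (cball 0 R) x *\<^sub>R g x))"
      using g[of R] unfolding set_integrable_def by (rule integrable_scaleR_right)
    show "AE x in lborel. norm (\<theta> x *\<^sub>R g x) \<le> norm (M *\<^sub>R (indicator (cball 0 R) x *\<^sub>R g x))"
      using M R by (auto simp: indicator_def not_le intro!: mult_right_mono)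
  qed simp
qed

text \<open>Differentiation under the integral sign, with the derivative falling on the test function: the
difference quotients are dominated, since a test function is Lipschitz and for \<open>\<bar>h\<bar> \<le> 1\<close> its
translates by \<open>(t + h) y\<close> are all supported in one ball. With \<open>g = u\<close> this turns a weak gradient
into the derivative of \<open>t \<mapsto> \<integral> u(x) \<theta>(x + t y) dx\<close>; with a complex exponential in place of \<open>g\<close> it replaces the integration by
parts that gives the decay of Fourier transforms.\<close>

lemma has_vector_derivative_integral_translate:
  fixes g :: "real^'n::finite \<Rightarrow> 'b::{banach, second_countable_topology}"
  assumes \<theta>: "test_function \<theta>" and [measurable]: "g \<in> borel_measurable borel"
    and g: "\<And>R. set_integrable lborel (cball 0 R) g"
  shows "((\<lambda>t. LINT x|lborel. \<theta> (x + t *\<^sub>R y) *\<^sub>R g x) has_vector_derivative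
      (\<Sum>i\<in>UNIV. y $ i *\<^sub>R (LINT x|lborel. partial i \<theta> (x + t *\<^sub>R y) *\<^sub>R g x))) (at t)"
    (is "(?F has_vector_derivative ?D) _")
proof -
  have shift: "test_function (\<lambda>x. \<eta> (x + s *\<^sub>R y))" if "test_function \<eta>" for \<eta> s
    using test_function_affine[OF that, of 1 "s *\<^sub>R y"] by (simp add: add.commute)
  have int: "integrable lborel (\<lambda>x. \<eta> (x + s *\<^sub>R y) *\<^sub>R g x)" if "test_function \<eta>" for \<eta> s
    by (rule integrable_test_function_scaleR[OF shift[OF that]]) (use g in auto)
  have [measurable]: "\<theta> \<in> borel_measurable borel" "\<And>i. partial i \<theta> \<in> borel_measurable borel"
    using test_function_borel_measurable[OF \<theta>]
      test_function_borel_measurable[OF test_function_partial[OF \<theta>]] by auto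
  obtain R where R: "\<And>x. norm x > R \<Longrightarrow> \<theta> x = 0" using test_function_support[OF \<theta>] by blast
  obtain L where L: "L > 0" "\<And>x y. \<bar>\<theta> (x + y) - \<theta> x\<bar> \<le> L * norm y"
    using test_function_lipschitz[OF \<theta>] by blast
  define R' where "R' = R + (\<bar>t\<bar> + 1) * norm y"
  have D: "?D = (LINT x|lborel. (\<Sum>i\<in>UNIV. y $ i * partial i \<theta> (x + t *\<^sub>R y)) *\<^sub>R g x)"
  proof -
    have "integrable lborel (\<lambda>x. y $ i *\<^sub>R (partial i \<theta> (x + t *\<^sub>R y) *\<^sub>R g x))" for i
      by (intro integrable_scaleR_right int test_function_partial \<theta>)
    then have "(LINT x|lborel. (\<Sum>i\<in>UNIV. y $ i *\<^sub>R (partial i \<theta> (x + t *\<^sub>R y) *\<^sub>R g x))) = ?D"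
      by (subst Bochner_Integration.integral_sum) (simp_all del: scaleR_scaleR)
    then show ?thesis by (simp add: scaleR_left.sum)
  qed
  have lim: "((\<lambda>h. (?F (t + h) - ?F t) /\<^sub>R h) \<longlongrightarrow> ?D) (at 0)"
    unfolding tendsto_at_iff_sequentially
  proof (intro allI impI)
    fix X :: "nat \<Rightarrow> real"
    assume X: "\<forall>i. X i \<in> UNIV - {0}" and X0: "X \<longlonglongrightarrow> 0"
    then obtain N where N: "\<And>n. n \<ge> N \<Longrightarrow> \<bar>X n\<bar> < 1"
      using LIMSEQ_D[OF X0, of 1] by auto
    \<comment> \<open>Domination holds only for increments of modulus at most one, so finitely many terms are skipped.\<close>
    define Y where "Y n = X (n + N)" for n
    have Y: "Y n \<noteq> 0" "\<bar>Y n\<bar> < 1" for n using X N by (auto simp: Y_def)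
    have Y0: "Y \<longlonglongrightarrow> 0" unfolding Y_def using X0 by (rule LIMSEQ_ignore_initial_segment)
    let ?q = "\<lambda>n x. ((\<theta> (x + (t + Y n) *\<^sub>R y) - \<theta> (x + t *\<^sub>R y)) / Y n) *\<^sub>R g x"
    have eq: "(?F (t + Y n) - ?F t) /\<^sub>R Y n = (LINT x|lborel. ?q n x)" for n
      using int[OF \<theta>, of "t + Y n"] int[OF \<theta>, of t]
      by (simp add: diff_divide_distrib scaleR_diff_left divide_inverse mult.commute[of _ "inverse _"]
           scaleR_scaleR[symmetric] scaleR_right_diff_distrib del: scaleR_scaleR)
    have "(\<lambda>n. LINT x|lborel. ?q n x) \<longlonglongrightarrow> ?D"
      unfolding D
    proof (rule integral_dominated_convergence[where w = "\<lambda>x. L * norm y * norm (indicator (cball 0 R') x *\<^sub>R g x)"])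
      show "integrable lborel (\<lambda>x. L * norm y * norm (indicator (cball 0 R') x *\<^sub>R g x))"
        using g[of R'] unfolding set_integrable_def by (intro integrable_mult_right integrable_norm)
      show "AE x in lborel. (\<lambda>n. ?q n x) \<longlonglongrightarrow> (\<Sum>i\<in>UNIV. y $ i * partial i \<theta> (x + t *\<^sub>R y)) *\<^sub>R g x"
      proof (intro AE_I2 tendsto_scaleR tendsto_const)
        fix x
        have diff: "\<theta> differentiable (at z)" for z
          using \<theta> by (simp add: smooth_differentiable test_function_smooth)
        have "((\<lambda>s. \<theta> (x + s *\<^sub>R y)) has_derivative
            (\<lambda>s. frechet_derivative \<theta> (at (x + t *\<^sub>R y)) (s *\<^sub>R y))) (at t)"
          by (rule has_derivative_compose[of "\<lambda>s. x + s *\<^sub>R y"])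
             (use diff frechet_derivative_works in \<open>auto intro!: derivative_eq_intros\<close>)
        then have "((\<lambda>s. \<theta> (x + s *\<^sub>R y)) has_real_derivative
            (\<Sum>i\<in>UNIV. y $ i * partial i \<theta> (x + t *\<^sub>R y))) (at t)"
          unfolding has_field_derivative_def
          by (rule has_derivative_eq_rhs)
             (auto simp: frechet_derivative_eq_sum_partial[OF diff] sum_distrib_left mult_ac fun_eq_iff)
        then have "((\<lambda>h. (\<theta> (x + (t + h) *\<^sub>R y) - \<theta> (x + t *\<^sub>R y)) / h) \<longlongrightarrow>
            (\<Sum>i\<in>UNIV. y $ i * partial i \<theta> (x + t *\<^sub>R y))) (at 0)"
          by (simp add: DERIV_def)
        with Y Y0 show "(\<lambda>n. (\<theta> (x + (t + Y n) *\<^sub>R y) - \<theta> (x + t *\<^sub>R y)) / Y n) \<longlonglongrightarrow>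
            (\<Sum>i\<in>UNIV. y $ i * partial i \<theta> (x + t *\<^sub>R y))"
          unfolding tendsto_at_iff_sequentially by (auto simp: o_def)
      qed
      fix n
      show "AE x in lborel. norm (?q n x) \<le> L * norm y * norm (indicator (cball 0 R') x *\<^sub>R g x)"
      proof (rule AE_I2)
        fix x
        show "norm (?q n x) \<le> L * norm y * norm (indicator (cball 0 R') x *\<^sub>R g x)"
        proof (cases "norm x \<le> R'")
          case True
          have "\<bar>\<theta> ((x + t *\<^sub>R y) + Y n *\<^sub>R y) - \<theta> (x + t *\<^sub>R y)\<bar> \<le> L * norm (Y n *\<^sub>R y)"
            by (rule L)
          then have "\<bar>\<theta> (x + (t + Y n) *\<^sub>R y) - \<theta> (x + t *\<^sub>R y)\<bar> / \<bar>Y n\<bar> \<le> L * norm y"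
            using Y(1)[of n] by (simp add: algebra_simps divide_le_eq)
          from mult_right_mono[OF this norm_ge_zero[of "g x"]] show ?thesis
            using True by (simp add: indicator_def)
        next
          case False
          have "\<theta> (x + s *\<^sub>R y) = 0" if "\<bar>s\<bar> \<le> \<bar>t\<bar> + 1" for s
          proof (rule R)
            have "norm x \<le> norm (x + s *\<^sub>R y) + norm (s *\<^sub>R y)"
              using norm_triangle_ineq4[of "x + s *\<^sub>R y" "s *\<^sub>R y"] by simp
            also have "norm (s *\<^sub>R y) \<le> (\<bar>t\<bar> + 1) * norm y"
              using that by (simp add: mult_right_mono)
            finally show "norm (x + s *\<^sub>R y) > R" using False by (simp add: R'_def)
          qed
          from this[of "t + Y n"] this[of t] Y(2)[of n] show ?thesis
            using False by (simp add: indicator_def)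
        qed
      qed
    qed measurable
    then have "(\<lambda>n. (?F (t + Y n) - ?F t) /\<^sub>R Y n) \<longlonglongrightarrow> ?D"
      unfolding eq .
    then show "((\<lambda>h. (?F (t + h) - ?F t) /\<^sub>R h) \<circ> X) \<longlonglongrightarrow> ?D"
      unfolding o_def Y_def by (rule LIMSEQ_offset)
  qed
  have "norm (?F (t + h) - ?F t - h *\<^sub>R ?D) / norm h = norm ((?F (t + h) - ?F t) /\<^sub>R h - ?D)"
    if "h \<noteq> 0" for h
  proof -
    have "?F (t + h) - ?F t - h *\<^sub>R ?D = h *\<^sub>R ((?F (t + h) - ?F t) /\<^sub>R h - ?D)"
      using that by (simp add: scaleR_diff_right)
    then show ?thesis using that by simp
  qed
  then have "((\<lambda>h. norm (?F (t + h) - ?F t - h *\<^sub>R ?D) / norm h) \<longlongrightarrow> 0) (at 0)"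
    using tendsto_norm_zero[OF LIM_zero[OF lim]]
    by (rule_tac Lim_transform_eventually) (auto simp: eventually_at_filter)
  then show ?thesis
    unfolding has_vector_derivative_def has_derivative_at by (auto intro: bounded_linear_scaleR_left)
qed

section \<open>An integrable weight\<close>

lemma nn_integral_inverse_1_plus_square_finite:
  "(\<integral>\<^sup>+x. ennreal (1 / (1 + (x::real)\<^sup>2)) \<partial>lborel) < \<infinity>"
proof -
  let ?f = "\<lambda>x::real. ennreal (1 / (1 + x\<^sup>2))"
  have half: "(\<integral>\<^sup>+x\<in>{0..}. ?f x \<partial>lborel) = ennreal (pi / 2 - arctan 0)"
  proof (rule nn_integral_FTC_atLeast)
    show "(arctan has_real_derivative 1 / (1 + x\<^sup>2)) (at x)" for x
      using DERIV_arctan[of x] by (simp add: inverse_eq_divide)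
  qed (auto simp: tendsto_arctan_at_top)
  have "(\<integral>\<^sup>+x\<in>{..0}. ?f x \<partial>lborel) = (\<integral>\<^sup>+x\<in>{0..}. ?f x \<partial>lborel)"
    by (subst nn_integral_real_affine[where c = "-1" and t = 0])
       (auto intro!: nn_integral_cong simp: indicator_def)
  moreover have "(\<integral>\<^sup>+x. ?f x \<partial>lborel) \<le> (\<integral>\<^sup>+x. ?f x * indicator {0..} x + ?f x * indicator {..0} x \<partial>lborel)"
    by (intro nn_integral_mono) (auto simp: indicator_def)
  ultimately have "(\<integral>\<^sup>+x. ?f x \<partial>lborel) \<le> ennreal (pi / 2) + ennreal (pi / 2)"
    using half by (simp add: nn_integral_add)
  then show ?thesis by (simp add: ennreal_plus[symmetric] le_less_trans del: ennreal_plus)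
qed

text \<open>Each factor \<open>1 + \<bar>x\<bar>\<^sup>2\<close> dominates one of the three factors \<open>1 + x\<^sub>i\<^sup>2\<close>, so the weight is bounded by a
product of functions of one variable, each with a finite integral.\<close>

lemma integrable_weight: "integrable lborel (\<lambda>x::real^3. 1 / (1 + (norm x)\<^sup>2) ^ 3)"
proof -
  have "(\<integral>\<^sup>+x. ennreal (norm (1 / (1 + (norm (x::real^3))\<^sup>2) ^ 3)) \<partial>lborel)
      \<le> (\<integral>\<^sup>+x. (\<Prod>b\<in>Basis. ennreal (1 / (1 + ((x::real^3) \<bullet> b)\<^sup>2))) \<partial>lborel)"
  proof (rule nn_integral_mono)
    fix x :: "real^3"
    have "(1 / (1 + (norm x)\<^sup>2)) ^ 3 = (\<Prod>b\<in>(Basis::(real^3) set). 1 / (1 + (norm x)\<^sup>2))"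
      by simp
    also have "\<dots> \<le> (\<Prod>b\<in>Basis. 1 / (1 + (x \<bullet> b)\<^sup>2))"
    proof (rule prod_mono)
      fix b :: "real^3" assume "b \<in> Basis"
      then have "(x \<bullet> b)\<^sup>2 \<le> (norm x)\<^sup>2"
        using Basis_le_norm[of b x] by (simp add: abs_le_square_iff[symmetric])
      then show "0 \<le> 1 / (1 + (norm x)\<^sup>2) \<and> 1 / (1 + (norm x)\<^sup>2) \<le> 1 / (1 + (x \<bullet> b)\<^sup>2)"
        by (auto intro!: divide_left_mono mult_pos_pos add_pos_nonneg)
    qed
    finally show "ennreal (norm (1 / (1 + (norm x)\<^sup>2) ^ 3)) \<le> (\<Prod>b\<in>Basis. ennreal (1 / (1 + (x \<bullet> b)\<^sup>2)))"
      by (simp add: prod_ennreal power_one_over ennreal_leI)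
  qed
  also have "\<dots> = (\<Prod>b\<in>(Basis::(real^3) set). (\<integral>\<^sup>+x. ennreal (1 / (1 + x\<^sup>2)) \<partial>lborel))"
    by (rule nn_integral_lborel_prod) auto
  also have "\<dots> < \<infinity>"
    using nn_integral_inverse_1_plus_square_finite by (simp add: power_less_top_ennreal)
  finally show ?thesis
    by (auto simp: integrable_iff_bounded)
qed

section \<open>Iterated integrals\<close>

lemma
  fixes f :: "'a::euclidean_space \<Rightarrow> 'b::euclidean_space \<Rightarrow> 'c::{banach, second_countable_topology}"
  assumes meas[measurable]: "(\<lambda>(x, y). f x y) \<in> borel_measurable (lborel \<Otimes>\<^sub>M lborel)"
    and fin: "(\<integral>\<^sup>+x. \<integral>\<^sup>+y. ennreal (norm (f x y)) \<partial>lborel \<partial>lborel) < \<infinity>"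
  shows integral_swap: "(LINT x|lborel. LINT y|lborel. f x y) = (LINT y|lborel. LINT x|lborel. f x y)"
    and integrable_inner_integral: "integrable lborel (\<lambda>y. LINT x|lborel. f x y)"
proof -
  have "(\<integral>\<^sup>+z. ennreal (norm (case z of (x, y) \<Rightarrow> f x y)) \<partial>(lborel \<Otimes>\<^sub>M lborel))
      = (\<integral>\<^sup>+x. \<integral>\<^sup>+y. ennreal (norm (f x y)) \<partial>lborel \<partial>lborel)"
    by (subst lborel.nn_integral_fst[symmetric]) simp_all
  then have int: "integrable (lborel \<Otimes>\<^sub>M lborel) (\<lambda>(x, y). f x y)"
    using fin by (simp add: integrable_iff_bounded)
  show "(LINT x|lborel. LINT y|lborel. f x y) = (LINT y|lborel. LINT x|lborel. f x y)"
    using lborel_pair.Fubini_integral[OF int] by simp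
  show "integrable lborel (\<lambda>y. LINT x|lborel. f x y)"
    by (rule lborel_pair.integrable_snd[OF int])
qed

section \<open>Fourier kernels of test functions\<close>

abbreviation fourier_kernel :: "(real^3 \<Rightarrow> real) \<Rightarrow> real^3 \<Rightarrow> complex" where
  "fourier_kernel m \<equiv> inv_fourier (\<lambda>\<xi>. of_real (m \<xi>))"

text \<open>The kernel without its normalising factor, and as an integral of Borel functions with respect to
\<open>lborel\<close>, for which Fubini's theorem and affine substitutions are at hand.\<close>

definition oscillatory_integral :: "(real^3 \<Rightarrow> real) \<Rightarrow> real^3 \<Rightarrow> complex" where
  "oscillatory_integral m z = (LINT \<xi>|lborel. m \<xi> *\<^sub>R exp (\<i> * of_real (z \<bullet> \<xi>)))"

lemma kernel_eq_oscillatory_integral: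
  assumes "test_function m"
  shows "fourier_kernel m z = oscillatory_integral m z / of_real ((2 * pi) ^ 3)"
proof -
  have [measurable]: "m \<in> borel_measurable borel" by (rule test_function_borel_measurable[OF assms])
  show ?thesis
    unfolding inv_fourier_def oscillatory_integral_def
    by (subst integral_completion) (auto simp: scaleR_conv_of_real mult.commute)
qed

lemma norm_exp_imaginary [simp]: "norm (exp (\<i> * of_real t)) = 1"
  by (simp add: norm_exp_eq_Re)

lemma norm_oscillatory_integral_le:
  assumes "test_function m"
  shows "norm (oscillatory_integral m z) \<le> (LINT \<xi>|lborel. \<bar>m \<xi>\<bar>)"
  unfolding oscillatory_integral_def
  by (rule order_trans[OF integral_norm_bound]) simp

lemma oscillatory_integral_measurable:
  assumes "test_function m"
  shows "oscillatory_integral m \<in> borel_measurable borel"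
proof -
  have [measurable]: "m \<in> borel_measurable borel" by (rule test_function_borel_measurable[OF assms])
  have "(\<lambda>z. oscillatory_integral m z) \<in> borel_measurable borel"
    unfolding oscillatory_integral_def by measurable
  then show ?thesis by simp
qed

lemma kernel_measurable:
  assumes "test_function m"
  shows "fourier_kernel m \<in> borel_measurable borel"
proof -
  note [measurable] = oscillatory_integral_measurable[OF assms]
  have "(\<lambda>z. oscillatory_integral m z / of_real ((2 * pi) ^ 3)) \<in> borel_measurable borel"
    by measurable
  then show ?thesis using kernel_eq_oscillatory_integral[OF assms] by presburger
qed

text \<open>Translating the test function multiplies the oscillatory integral by a character. Both sides are the
derivative at \<open>0\<close> of that translation.\<close>

lemma oscillatory_integral_partial:
  assumes m: "test_function m"
  shows "oscillatory_integral (partial i m) z = - \<i> * of_real (z $ i) * oscillatory_integral m z"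
proof -
  let ?g = "\<lambda>\<xi>::real^3. exp (\<i> * of_real (z \<bullet> \<xi>))"
  have [measurable]: "m \<in> borel_measurable borel" by (rule test_function_borel_measurable[OF m])
  have "set_integrable lborel (cball 0 R) ?g" for R
    unfolding set_integrable_def by (intro borel_integrable_compact continuous_intros) auto
  then have "((\<lambda>t. LINT \<xi>|lborel. m (\<xi> + t *\<^sub>R axis i 1) *\<^sub>R ?g \<xi>) has_vector_derivative
      (\<Sum>k\<in>UNIV. axis i 1 $ k *\<^sub>R (LINT \<xi>|lborel. partial k m (\<xi> + 0 *\<^sub>R axis i 1) *\<^sub>R ?g \<xi>))) (at 0)"
    by (intro has_vector_derivative_integral_translate[OF m]) auto
  also have "(\<Sum>k\<in>UNIV. axis i 1 $ k *\<^sub>R (LINT \<xi>|lborel. partial k m (\<xi> + 0 *\<^sub>R axis i 1) *\<^sub>R ?g \<xi>))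
      = (\<Sum>k\<in>UNIV. if k = i then oscillatory_integral (partial k m) z else 0)"
    by (intro sum.cong) (auto simp: axis_def oscillatory_integral_def)
  also have "\<dots> = oscillatory_integral (partial i m) z" by simp
  finally have d1: "((\<lambda>t. LINT \<xi>|lborel. m (\<xi> + t *\<^sub>R axis i 1) *\<^sub>R ?g \<xi>) has_vector_derivative
      oscillatory_integral (partial i m) z) (at 0)" .
  have "(LINT \<xi>|lborel. m (\<xi> + t *\<^sub>R axis i 1) *\<^sub>R ?g \<xi>)
      = exp (- \<i> * of_real (z $ i) * of_real t) * oscillatory_integral m z" for t
  proof -
    have "(LINT \<xi>|lborel. m (\<xi> + t *\<^sub>R axis i 1) *\<^sub>R ?g \<xi>)
        = (LINT \<xi>|lborel. m (t *\<^sub>R axis i 1 + \<xi>) *\<^sub>R ?g ((t *\<^sub>R axis i 1 + \<xi>) - t *\<^sub>R axis i 1))"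
      by (simp add: add.commute)
    also have "\<dots> = (LINT \<xi>|lborel. m \<xi> *\<^sub>R ?g (\<xi> - t *\<^sub>R axis i 1))"
      by (rule integral_lborel_translate) measurable
    also have "\<dots> = (LINT \<xi>|lborel. exp (- \<i> * of_real (z $ i) * of_real t) * (m \<xi> *\<^sub>R ?g \<xi>))"
      by (intro Bochner_Integration.integral_cong refl)
         (simp add: inner_diff_right inner_axis exp_diff exp_minus divide_inverse algebra_simps)
    finally show ?thesis unfolding oscillatory_integral_def by (simp only: integral_mult_right_zero)
  qed
  moreover have "((\<lambda>t. exp (- \<i> * of_real (z $ i) * of_real t) * oscillatory_integral m z)
      has_vector_derivative - \<i> * of_real (z $ i) * oscillatory_integral m z) (at 0)"
    by (rule has_vector_derivative_real_field[where f = "\<lambda>t. exp (- \<i> * of_real (z $ i) * t) * oscillatory_integral m z"])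
       (auto intro!: derivative_eq_intros)
  ultimately have "((\<lambda>t. LINT \<xi>|lborel. m (\<xi> + t *\<^sub>R axis i 1) *\<^sub>R ?g \<xi>) has_vector_derivative
      - \<i> * of_real (z $ i) * oscillatory_integral m z) (at 0)" by simp
  with d1 show ?thesis by (rule vector_derivative_unique_at)
qed

lemma oscillatory_integral_component_decay:
  assumes "test_function m"
  obtains C where "C \<ge> 0" "\<And>z. \<bar>z $ i\<bar> ^ N * norm (oscillatory_integral m z) \<le> C"
proof -
  have test: "test_function ((partial i ^^ k) m)" for k
    by (induction k) (auto intro: assms test_function_partial)
  have "norm (oscillatory_integral ((partial i ^^ k) m) z) = \<bar>z $ i\<bar> ^ k * norm (oscillatory_integral m z)" for k z
    by (induction k) (auto simp: oscillatory_integral_partial[OF test] norm_mult mult_ac)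
  then have "\<bar>z $ i\<bar> ^ N * norm (oscillatory_integral m z) \<le> (LINT \<xi>|lborel. \<bar>(partial i ^^ N) m \<xi>\<bar>)" for z
    using norm_oscillatory_integral_le[OF test] by metis
  then show thesis by (intro that[of "LINT \<xi>|lborel. \<bar>(partial i ^^ N) m \<xi>\<bar>"]) auto
qed

text \<open>Eight derivatives in each coordinate direction bound \<open>\<bar>z\<^sub>i\<bar>\<^sup>8\<close> times the kernel. The power four of
\<open>1 + \<bar>z\<bar>\<^sup>2\<close> leaves the integrable weight after one such factor has been spent on a second moment.\<close>

lemma kernel_decay:
  assumes m: "test_function m"
  obtains C where "C \<ge> 0" "\<And>z. norm (fourier_kernel m z) \<le> C / (1 + (norm z)\<^sup>2) ^ 4"
proof -
  have "\<forall>i. \<exists>C\<ge>0. \<forall>z. \<bar>z $ i\<bar> ^ 8 * norm (oscillatory_integral m z) \<le> C"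
    using oscillatory_integral_component_decay[OF m, of _ 8] by metis
  then obtain C where C: "\<And>i. C i \<ge> 0" "\<And>i z. \<bar>z $ i\<bar> ^ 8 * norm (oscillatory_integral m z) \<le> C i"
    by metis
  define C0 where "C0 = (LINT \<xi>|lborel. \<bar>m \<xi>\<bar>)"
  \<comment> \<open>One of \<open>1\<close>, \<open>z\<^sub>1\<^sup>2\<close>, \<open>z\<^sub>2\<^sup>2\<close>, \<open>z\<^sub>3\<^sup>2\<close> is at least a quarter of \<open>1 + \<bar>z\<bar>\<^sup>2\<close>; and \<open>256 = 4\<^sup>4\<close>.\<close>
  define D where "D = 256 * (C0 + C 1 + C 2 + C 3)"
  have C0: "C0 \<ge> 0" unfolding C0_def by simp
  have "(1 + (norm z)\<^sup>2) ^ 4 * norm (oscillatory_integral m z) \<le> D" for z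
  proof -
    let ?o = "norm (oscillatory_integral m z)"
    have nz: "(norm z)\<^sup>2 = (z $ 1)\<^sup>2 + (z $ 2)\<^sup>2 + (z $ 3)\<^sup>2"
      unfolding power2_norm_eq_inner by (simp add: inner_vec_def sum_3 power2_eq_square)
    have *: ?thesis if t: "1 + (norm z)\<^sup>2 \<le> 4 * t" and "t ^ 4 * ?o \<le> D / 256" for t
    proof -
      have "(1 + (norm z)\<^sup>2) ^ 4 \<le> (4 * t) ^ 4" using t by (intro power_mono) auto
      then have "(1 + (norm z)\<^sup>2) ^ 4 * ?o \<le> (4 * t) ^ 4 * ?o" by (rule mult_right_mono) simp
      with that(2) show ?thesis by (simp add: power_mult_distrib)
    qed
    have comp: "((z $ i)\<^sup>2) ^ 4 * ?o \<le> C i" for i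
      using C(2)[of z i] by (simp add: power_mult[symmetric])
    have le: "C i \<le> D / 256" if "i = 1 \<or> i = 2 \<or> i = 3" for i
      using that C(1)[of 1] C(1)[of 2] C(1)[of 3] C0 by (auto simp: D_def)
    have "?o \<le> C0" unfolding C0_def by (rule norm_oscillatory_integral_le[OF m])
    then have zero: "1 ^ 4 * ?o \<le> D / 256"
      using C(1)[of 1] C(1)[of 2] C(1)[of 3] by (simp add: D_def)
    consider "1 + (norm z)\<^sup>2 \<le> 4 * 1" | "1 + (norm z)\<^sup>2 \<le> 4 * (z $ 1)\<^sup>2"
      | "1 + (norm z)\<^sup>2 \<le> 4 * (z $ 2)\<^sup>2" | "1 + (norm z)\<^sup>2 \<le> 4 * (z $ 3)\<^sup>2"
      unfolding nz by linarith
    then show ?thesis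
      using * zero order_trans[OF comp le] by cases blast+
  qed
  moreover have "norm (fourier_kernel m z) \<le> norm (oscillatory_integral m z)" for z
  proof -
    have "1 \<le> (2 * pi) ^ 3" using pi_gt3 by (intro one_le_power) simp
    from mult_left_mono[OF this norm_ge_zero[of "oscillatory_integral m z"]] show ?thesis
      by (simp add: kernel_eq_oscillatory_integral[OF m] norm_divide divide_le_eq norm_mult norm_power)
  qed
  ultimately have "(1 + (norm z)\<^sup>2) ^ 4 * norm (fourier_kernel m z) \<le> D" for z
    by (meson mult_left_mono order_trans zero_le_power add_nonneg_nonneg zero_le_one zero_le_power2)
  moreover have "0 < (1 + (norm z)\<^sup>2) ^ 4" for z :: "real^3"
    by (intro zero_less_power add_pos_nonneg) auto
  ultimately have "norm (fourier_kernel m z) \<le> D / (1 + (norm z)\<^sup>2) ^ 4" for z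
    by (simp add: pos_le_divide_eq mult.commute)
  moreover have "D \<ge> 0" using C C0 by (simp add: D_def)
  ultimately show thesis using that by blast
qed

lemma kernel_moment_integrable:
  assumes m: "test_function m"
  shows "integrable lborel (\<lambda>z. norm (fourier_kernel m z) * (1 + (norm z)\<^sup>2))"
proof -
  note [measurable] = kernel_measurable[OF m]
  obtain C where C: "C \<ge> 0" "\<And>z. norm (fourier_kernel m z) \<le> C / (1 + (norm z)\<^sup>2) ^ 4"
    using kernel_decay[OF m] by blast
  show ?thesis
  proof (rule Bochner_Integration.integrable_bound)
    show "integrable lborel (\<lambda>z::real^3. C * (1 / (1 + (norm z)\<^sup>2) ^ 3))"
      using integrable_weight by (rule integrable_mult_right)
    have "norm (fourier_kernel m z) * (1 + (norm z)\<^sup>2) \<le> C * (1 / (1 + (norm z)\<^sup>2) ^ 3)" for z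
    proof -
      have pos: "1 + (norm z)\<^sup>2 > 0" by (simp add: add_pos_nonneg)
      have "norm (fourier_kernel m z) * (1 + (norm z)\<^sup>2) \<le> C / (1 + (norm z)\<^sup>2) ^ 4 * (1 + (norm z)\<^sup>2)"
        using C pos by (intro mult_right_mono) auto
      also have "\<dots> = C * (1 / (1 + (norm z)\<^sup>2) ^ 3)"
        using pos by (simp add: power_Suc eval_nat_numeral)
      finally show ?thesis .
    qed
    then show "AE z in lborel. norm (norm (fourier_kernel m z) * (1 + (norm z)\<^sup>2)) \<le> norm (C * (1 / (1 + (norm z)\<^sup>2) ^ 3))"
      using C(1) by (intro AE_I2) (auto simp: abs_mult)
  qed simp
qed

lemma kernel_integrable:
  assumes m: "test_function m"
  shows "integrable lborel (fourier_kernel m)"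
proof (rule Bochner_Integration.integrable_bound[OF kernel_moment_integrable[OF m]])
  show "fourier_kernel m \<in> borel_measurable lborel" using kernel_measurable[OF m] by simp
  have "norm (fourier_kernel m z) * 1 \<le> norm (fourier_kernel m z) * (1 + (norm z)\<^sup>2)" for z
    by (rule mult_left_mono) auto
  then show "AE z in lborel. norm (fourier_kernel m z) \<le> norm (norm (fourier_kernel m z) * (1 + (norm z)\<^sup>2))"
    by (intro AE_I2) (auto simp: abs_mult)
qed

lemma oscillatory_integral_integrable:
  assumes m: "test_function m"
  shows "integrable lborel (oscillatory_integral m)"
proof -
  have "oscillatory_integral m = (\<lambda>z. of_real ((2 * pi) ^ 3) * fourier_kernel m z)"
    by (auto simp: kernel_eq_oscillatory_integral[OF m])
  then show ?thesis using kernel_integrable[OF m] by simp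
qed

lemma oscillatory_integral_dilate:
  assumes m: "test_function m" and c: "c > 0"
  shows "oscillatory_integral (\<lambda>\<xi>. m (c *\<^sub>R \<xi>)) z = (1 / c) ^ 3 *\<^sub>R oscillatory_integral m ((1 / c) *\<^sub>R z)"
proof -
  have [measurable]: "m \<in> borel_measurable borel" by (rule test_function_borel_measurable[OF m])
  have "oscillatory_integral m ((1 / c) *\<^sub>R z)
      = \<bar>c\<bar> ^ DIM(real^3) *\<^sub>R (LINT \<xi>|lborel. m (0 + c *\<^sub>R \<xi>) *\<^sub>R exp (\<i> * of_real ((1 / c) *\<^sub>R z \<bullet> (0 + c *\<^sub>R \<xi>))))"
    unfolding oscillatory_integral_def by (rule integral_lborel_affine) (use c in auto)
  also have "\<dots> = c ^ 3 *\<^sub>R oscillatory_integral (\<lambda>\<xi>. m (c *\<^sub>R \<xi>)) z"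
    using c by (simp add: oscillatory_integral_def)
  finally show ?thesis using c by (simp add: power_divide)
qed

text \<open>Both sides equal the double integral of \<open>m(c x) \<psi>(w) exp(i x \<cdot> w)\<close>.\<close>

lemma integral_oscillatory_integral_duality:
  assumes m: "test_function m" and \<psi>: "test_function \<psi>" and c: "c > 0"
  shows "(LINT z|lborel. \<psi> (c *\<^sub>R z) *\<^sub>R oscillatory_integral m z)
       = (LINT x|lborel. m (c *\<^sub>R x) *\<^sub>R oscillatory_integral \<psi> x)"
proof -
  have [measurable]: "m \<in> borel_measurable borel" "\<psi> \<in> borel_measurable borel"
    using test_function_borel_measurable m \<psi> by auto
  note [measurable] = oscillatory_integral_measurable[OF m]
  have mc: "test_function (\<lambda>x. m (c *\<^sub>R x))"
    using test_function_affine[OF m, of c 0] c by simp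
  have "(LINT x|lborel. m (c *\<^sub>R x) *\<^sub>R oscillatory_integral \<psi> x)
      = (LINT x|lborel. LINT w|lborel. (m (c *\<^sub>R x) * \<psi> w) *\<^sub>R exp (\<i> * of_real (x \<bullet> w)))"
    by (simp add: oscillatory_integral_def scaleR_scaleR[symmetric] del: scaleR_scaleR)
  also have "\<dots> = (LINT w|lborel. LINT x|lborel. (m (c *\<^sub>R x) * \<psi> w) *\<^sub>R exp (\<i> * of_real (x \<bullet> w)))"
  proof (rule integral_swap)
    have "(\<integral>\<^sup>+x. \<integral>\<^sup>+w. ennreal (norm ((m (c *\<^sub>R x) * \<psi> w) *\<^sub>R exp (\<i> * of_real (x \<bullet> w)))) \<partial>lborel \<partial>lborel)
        = (\<integral>\<^sup>+x. ennreal (norm (m (c *\<^sub>R x))) \<partial>lborel) * (\<integral>\<^sup>+w. ennreal (norm (\<psi> w)) \<partial>lborel)"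
      by (simp add: abs_mult ennreal_mult nn_integral_cmult nn_integral_multc)
    also have "\<dots> < \<infinity>"
      using test_function_integrable[OF mc] test_function_integrable[OF \<psi>]
      by (simp add: integrable_iff_bounded ennreal_mult_less_top)
    finally show "(\<integral>\<^sup>+x. \<integral>\<^sup>+w. ennreal (norm ((m (c *\<^sub>R x) * \<psi> w) *\<^sub>R exp (\<i> * of_real (x \<bullet> w)))) \<partial>lborel \<partial>lborel) < \<infinity>" .
  qed measurable
  also have "\<dots> = (LINT w|lborel. \<psi> w *\<^sub>R oscillatory_integral (\<lambda>x. m (c *\<^sub>R x)) w)"
    by (simp add: oscillatory_integral_def scaleR_scaleR[symmetric] inner_commute mult.commute[of "m _"]
        del: scaleR_scaleR)
  also have "\<dots> = (1 / c) ^ 3 *\<^sub>R (LINT w|lborel. \<psi> w *\<^sub>R oscillatory_integral m ((1 / c) *\<^sub>R w))"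
    by (simp only: oscillatory_integral_dilate[OF m c] scaleR_left_commute[of "\<psi> _"]
         integral_scaleR_right)
  also have "(LINT w|lborel. \<psi> w *\<^sub>R oscillatory_integral m ((1 / c) *\<^sub>R w))
      = \<bar>c\<bar> ^ DIM(real^3) *\<^sub>R (LINT z|lborel. \<psi> (0 + c *\<^sub>R z) *\<^sub>R oscillatory_integral m ((1 / c) *\<^sub>R (0 + c *\<^sub>R z)))"
    by (rule integral_lborel_affine) (use c in auto)
  finally show ?thesis using c by (simp add: power_divide)
qed

text \<open>The integral of the kernel is the value of \<open>m\<close> at \<open>0\<close>. Instead of Fourier inversion, the integral is
regularised by the factor \<open>\<psi>(c z)\<close>, which tends to \<open>\<psi>(0) = 1\<close> as \<open>c\<close> tends to \<open>0\<close>. By duality the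
regularised integral is that of \<open>m(c x)\<close> against an integrable function, and it tends to \<open>0\<close> because
\<open>m(c x)\<close> tends to \<open>m(0) = 0\<close>.\<close>

lemma integral_kernel_eq_0:
  fixes m \<psi> :: "real^3 \<Rightarrow> real"
  assumes m: "test_function m" and \<psi>: "test_function \<psi>" and "m 0 = 0" "\<psi> 0 = 1"
  shows "(LINT z|lborel. fourier_kernel m z) = 0"
proof -
  have lim: "(\<lambda>n. LINT z|lborel. p ((1 / real (Suc n)) *\<^sub>R z) *\<^sub>R oscillatory_integral q z)
      \<longlonglongrightarrow> (LINT z|lborel. p 0 *\<^sub>R oscillatory_integral q z)"
    if p: "test_function p" and q: "test_function q" for p q :: "real^3 \<Rightarrow> real"
  proof -
    have [measurable]: "p \<in> borel_measurable borel" by (rule test_function_borel_measurable[OF p])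
    note [measurable] = oscillatory_integral_measurable[OF q]
    obtain M where M: "M > 0" "\<And>x. \<bar>p x\<bar> \<le> M" using test_function_bounded[OF p] by blast
    show ?thesis
    proof (rule integral_dominated_convergence[where w = "\<lambda>z. M * norm (oscillatory_integral q z)"])
      show "integrable lborel (\<lambda>z. M * norm (oscillatory_integral q z))"
        using oscillatory_integral_integrable[OF q] by (intro integrable_mult_right integrable_norm)
      show "AE z in lborel. (\<lambda>n. p ((1 / real (Suc n)) *\<^sub>R z) *\<^sub>R oscillatory_integral q z)
          \<longlonglongrightarrow> p 0 *\<^sub>R oscillatory_integral q z"
      proof (intro AE_I2 tendsto_scaleR tendsto_const)
        fix z :: "real^3"
        have "isCont p 0"
          using smooth_continuous[OF test_function_smooth[OF p], of UNIV]
          by (simp add: continuous_on_eq_continuous_at)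
        moreover have "(\<lambda>n. (1 / real (Suc n)) *\<^sub>R z) \<longlonglongrightarrow> 0 *\<^sub>R z"
          using LIMSEQ_inverse_real_of_nat
          by (intro tendsto_scaleR tendsto_const) (simp add: inverse_eq_divide)
        ultimately show "(\<lambda>n. p ((1 / real (Suc n)) *\<^sub>R z)) \<longlonglongrightarrow> p 0"
          using isCont_tendsto_compose by fastforce
      qed
    qed (use M in \<open>auto intro!: mult_right_mono\<close>)
  qed
  have "(\<lambda>n. LINT z|lborel. \<psi> ((1 / real (Suc n)) *\<^sub>R z) *\<^sub>R oscillatory_integral m z)
      \<longlonglongrightarrow> (LINT z|lborel. oscillatory_integral m z)"
    using lim[OF \<psi> m] \<open>\<psi> 0 = 1\<close> by simp
  moreover have "(\<lambda>n. LINT z|lborel. \<psi> ((1 / real (Suc n)) *\<^sub>R z) *\<^sub>R oscillatory_integral m z) \<longlonglongrightarrow> 0"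
    using lim[OF m \<psi>] \<open>m 0 = 0\<close> by (subst integral_oscillatory_integral_duality[OF m \<psi>]) auto
  ultimately have "(LINT z|lborel. oscillatory_integral m z) = 0"
    by (rule LIMSEQ_unique)
  then show ?thesis by (simp add: kernel_eq_oscillatory_integral[OF m])
qed

section \<open>Dyadic blocks as convolutions\<close>

lemma schwartz_measurable:
  assumes "\<theta> \<in> schwartz"
  shows "\<theta> \<in> borel_measurable borel"
  using assms by (intro borel_measurable_continuous_onI smooth_continuous) (simp add: schwartz_def)

lemma schwartz_power_bounded:
  assumes "\<theta> \<in> schwartz"
  obtains B where "\<And>x. norm x ^ k * norm (\<theta> x) \<le> B"
proof -
  have "bounded (range (\<lambda>x. norm x ^ k * norm (iter_partial [] \<theta> x)))"
    using assms unfolding schwartz_def by blast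
  then obtain B where B: "\<forall>y\<in>range (\<lambda>x. norm x ^ k * norm (\<theta> x)). norm y \<le> B"
    unfolding bounded_iff by auto
  have "norm x ^ k * norm (\<theta> x) \<le> B" for x
    using bspec[OF B rangeI[of _ x]] by (simp add: abs_mult)
  then show thesis by (rule that)
qed

lemma schwartz_bounded:
  assumes "\<theta> \<in> schwartz"
  obtains B where "B \<ge> 0" "\<And>x. norm (\<theta> x) \<le> B"
proof -
  obtain B where B: "\<And>x. norm x ^ 0 * norm (\<theta> x) \<le> B"
    using schwartz_power_bounded[OF assms] by blast
  then have "norm (\<theta> x) \<le> B" for x by simp
  moreover from this[of 0] have "B \<ge> 0" by (meson norm_ge_zero order_trans)
  ultimately show thesis using that by blast
qed

lemma schwartz_integrable:
  assumes \<theta>: "\<theta> \<in> schwartz"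
  shows "integrable lborel \<theta>"
proof -
  obtain B where B: "B \<ge> 0" "\<And>x. norm (\<theta> x) \<le> B" using schwartz_bounded[OF \<theta>] by blast
  obtain D where D: "\<And>x. norm x ^ 6 * norm (\<theta> x) \<le> D" using schwartz_power_bounded[OF \<theta>] by blast
  note [measurable] = schwartz_measurable[OF \<theta>]
  show ?thesis
  proof (rule Bochner_Integration.integrable_bound)
    show "integrable lborel (\<lambda>x::real^3. 8 * (B + D) * (1 / (1 + (norm x)\<^sup>2) ^ 3))"
      using integrable_weight by (rule integrable_mult_right)
    have bound: "norm (\<theta> x) \<le> 8 * (B + D) * (1 / (1 + (norm x)\<^sup>2) ^ 3)" for x
    proof -
      have pos: "1 + (norm x)\<^sup>2 > 0" by (simp add: add_pos_nonneg)
      have D0: "0 \<le> D" using D[of 0] by simp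
      have "(1 + (norm x)\<^sup>2) ^ 3 * norm (\<theta> x) \<le> 8 * (B + D)"
      proof (cases "norm x \<le> 1")
        case True
        then have "(norm x)\<^sup>2 \<le> 1" by (simp add: power_le_one)
        then have "(1 + (norm x)\<^sup>2) ^ 3 \<le> 2 ^ 3" by (intro power_mono) auto
        then have "(1 + (norm x)\<^sup>2) ^ 3 * norm (\<theta> x) \<le> 2 ^ 3 * B"
          using B by (intro mult_mono) auto
        then show ?thesis using D0 by simp
      next
        case False
        then have "1 \<le> (norm x)\<^sup>2" by simp
        then have "(1 + (norm x)\<^sup>2) ^ 3 \<le> (2 * (norm x)\<^sup>2) ^ 3" by (intro power_mono) auto
        then have "(1 + (norm x)\<^sup>2) ^ 3 * norm (\<theta> x) \<le> (2 * (norm x)\<^sup>2) ^ 3 * norm (\<theta> x)"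
          by (intro mult_right_mono) auto
        also have "\<dots> = 8 * (norm x ^ 6 * norm (\<theta> x))"
          by (simp add: power_mult_distrib power_mult[symmetric])
        also have "\<dots> \<le> 8 * D" using D by simp
        finally show ?thesis using B by simp
      qed
      then show ?thesis using pos by (simp add: field_simps)
    qed
    show "AE x in lborel. norm (\<theta> x) \<le> norm (8 * (B + D) * (1 / (1 + (norm x)\<^sup>2) ^ 3))"
      by (rule AE_I2, rule order_trans[OF bound]) (simp only: real_norm_def abs_ge_self)
  qed simp
qed

text \<open>The multiplier \<open>m\<close> is integrable, so the two Fourier integrals may be interchanged; this is Fubini's
theorem rather than Fourier inversion.\<close>

lemma fourier_multiplier:
  assumes m: "test_function m" and \<theta>: "integrable lborel \<theta>"
  shows "fourier (\<lambda>\<xi>. of_real (m \<xi>) * inv_fourier \<theta> \<xi>) x = (LINT y|lborel. fourier_kernel m (y - x) * \<theta> y)"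
proof -
  have [measurable]: "m \<in> borel_measurable borel" by (rule test_function_borel_measurable[OF m])
  have [measurable]: "\<theta> \<in> borel_measurable borel" using \<theta> by auto
  let ?c = "complex_of_real ((2 * pi) ^ 3)"
  let ?f = "\<lambda>\<xi> y. (m \<xi> *\<^sub>R (exp (- \<i> * of_real (\<xi> \<bullet> x)) * (exp (\<i> * of_real (\<xi> \<bullet> y)) * \<theta> y))) / ?c"
  have "inv_fourier \<theta> \<xi> = (LINT y|lborel. exp (\<i> * of_real (\<xi> \<bullet> y)) * \<theta> y) / ?c" for \<xi>
    unfolding inv_fourier_def by (subst integral_completion) auto
  then have "fourier (\<lambda>\<xi>. of_real (m \<xi>) * inv_fourier \<theta> \<xi>) x
      = (LINT \<xi>|lebesgue. exp (- \<i> * of_real (\<xi> \<bullet> x)) * (of_real (m \<xi>) *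
           ((LINT y|lborel. exp (\<i> * of_real (\<xi> \<bullet> y)) * \<theta> y) / ?c)))"
    by (simp only: fourier_def)
  also have "\<dots> = (LINT \<xi>|lborel. exp (- \<i> * of_real (\<xi> \<bullet> x)) * (of_real (m \<xi>) *
           ((LINT y|lborel. exp (\<i> * of_real (\<xi> \<bullet> y)) * \<theta> y) / ?c)))"
    by (subst integral_completion) auto
  also have "\<dots> = (LINT \<xi>|lborel. LINT y|lborel. ?f \<xi> y)"
  proof (intro Bochner_Integration.integral_cong refl)
    fix \<xi>
    have "(LINT y|lborel. ?f \<xi> y) = (LINT y|lborel. (exp (- \<i> * of_real (\<xi> \<bullet> x)) * of_real (m \<xi>) / ?c)
        * (exp (\<i> * of_real (\<xi> \<bullet> y)) * \<theta> y))"
      by (intro Bochner_Integration.integral_cong refl) (simp add: scaleR_conv_of_real)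
    also have "\<dots> = (exp (- \<i> * of_real (\<xi> \<bullet> x)) * of_real (m \<xi>) / ?c)
        * (LINT y|lborel. exp (\<i> * of_real (\<xi> \<bullet> y)) * \<theta> y)"
      by (rule integral_mult_right_zero)
    finally show "exp (- \<i> * of_real (\<xi> \<bullet> x)) * (of_real (m \<xi>) *
           ((LINT y|lborel. exp (\<i> * of_real (\<xi> \<bullet> y)) * \<theta> y) / ?c)) = (LINT y|lborel. ?f \<xi> y)"
      by simp
  qed
  also have "\<dots> = (LINT y|lborel. LINT \<xi>|lborel. ?f \<xi> y)"
  proof (rule integral_swap)
    have "(\<integral>\<^sup>+\<xi>. \<integral>\<^sup>+y. ennreal (norm (?f \<xi> y)) \<partial>lborel \<partial>lborel)
        \<le> (\<integral>\<^sup>+\<xi>. \<integral>\<^sup>+y. ennreal (\<bar>m \<xi>\<bar> * norm (\<theta> y)) \<partial>lborel \<partial>lborel)"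
    proof (intro nn_integral_mono ennreal_leI)
      fix \<xi> y :: "real^3"
      have "1 \<le> (2 * pi) ^ 3" using pi_gt3 by (intro one_le_power) simp
      moreover have "norm (exp (- \<i> * of_real (\<xi> \<bullet> x))) = 1"
        using norm_exp_imaginary[of "- (\<xi> \<bullet> x)"] by simp
      ultimately show "norm (?f \<xi> y) \<le> \<bar>m \<xi>\<bar> * norm (\<theta> y)"
        using mult_left_mono[of 1 "(2 * pi) ^ 3" "\<bar>m \<xi>\<bar> * norm (\<theta> y)"]
        by (simp add: norm_divide norm_mult norm_power divide_le_eq)
    qed
    also have "\<dots> = (\<integral>\<^sup>+\<xi>. ennreal (norm (m \<xi>)) \<partial>lborel) * (\<integral>\<^sup>+y. ennreal (norm (\<theta> y)) \<partial>lborel)"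
      by (simp add: ennreal_mult nn_integral_cmult nn_integral_multc)
    also have "\<dots> < \<infinity>"
      using test_function_integrable[OF m] \<theta> by (simp add: integrable_iff_bounded ennreal_mult_less_top)
    finally show "(\<integral>\<^sup>+\<xi>. \<integral>\<^sup>+y. ennreal (norm (?f \<xi> y)) \<partial>lborel \<partial>lborel) < \<infinity>" .
  qed measurable
  also have "\<dots> = (LINT y|lborel. fourier_kernel m (y - x) * \<theta> y)"
  proof (intro Bochner_Integration.integral_cong refl)
    fix y
    have "(LINT \<xi>|lborel. ?f \<xi> y)
        = (LINT \<xi>|lborel. (m \<xi> *\<^sub>R exp (\<i> * of_real ((y - x) \<bullet> \<xi>))) * (\<theta> y / ?c))"
    proof (intro Bochner_Integration.integral_cong refl)
      fix \<xi>
      have "exp (\<i> * of_real ((y - x) \<bullet> \<xi>)) = exp (- \<i> * of_real (\<xi> \<bullet> x)) * exp (\<i> * of_real (\<xi> \<bullet> y))"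
        by (simp add: exp_add[symmetric] inner_diff_left inner_commute algebra_simps)
      then show "?f \<xi> y = (m \<xi> *\<^sub>R exp (\<i> * of_real ((y - x) \<bullet> \<xi>))) * (\<theta> y / ?c)" by simp
    qed
    also have "\<dots> = oscillatory_integral m (y - x) * (\<theta> y / ?c)"
      unfolding oscillatory_integral_def by (rule integral_mult_left_zero)
    finally show "(LINT \<xi>|lborel. ?f \<xi> y) = fourier_kernel m (y - x) * \<theta> y"
      by (simp add: kernel_eq_oscillatory_integral[OF m])
  qed
  finally show ?thesis .
qed

definition kernel_convolution :: "(real^3 \<Rightarrow> real) \<Rightarrow> (real^3 \<Rightarrow> complex) \<Rightarrow> real^3 \<Rightarrow> complex" where
  "kernel_convolution m f y = (LINT x|lborel. fourier_kernel m (y - x) * f x)"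

lemma kernel_convolution_measurable:
  assumes "test_function m" and [measurable]: "f \<in> borel_measurable borel"
  shows "kernel_convolution m f \<in> borel_measurable borel"
proof -
  note [measurable] = kernel_measurable[OF assms(1)]
  have "(\<lambda>y. kernel_convolution m f y) \<in> borel_measurable borel"
    unfolding kernel_convolution_def by measurable
  then show ?thesis by simp
qed

text \<open>Quadratic growth in a square integrable function covers \<open>G \<circ> u\<close> for every Hoelder continuous \<open>G\<close>,
constants included. The growth bound splits the absolute double integral in Fubini's theorem into a part where the kernel and
the Schwartz function are both integrated, and a part where the Schwartz function is bounded by its
supremum and the kernel and \<open>u\<^sup>2\<close> are integrated.\<close>

lemma
  fixes f :: "real^3 \<Rightarrow> complex" and u :: "real^3 \<Rightarrow> real"
  assumes [measurable]: "f \<in> borel_measurable borel" "u \<in> borel_measurable borel"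
    and ab: "a \<ge> 0" "b \<ge> 0" and f: "\<And>x. norm (f x) \<le> a + b * (u x)\<^sup>2"
    and u: "(\<integral>\<^sup>+x. ennreal ((u x)\<^sup>2) \<partial>lborel) < \<infinity>"
  shows tempered_quadratic_growth: "tempered f"
    and tempered_kernel_convolution: "test_function m \<Longrightarrow> tempered (kernel_convolution m f)"
    and distr_of_kernel_convolution:
      "test_function m \<Longrightarrow> \<theta> \<in> schwartz \<Longrightarrow>
       distr_of f (fourier (\<lambda>\<xi>. of_real (m \<xi>) * inv_fourier \<theta> \<xi>)) = distr_of (kernel_convolution m f) \<theta>"
proof -
  have u': "integrable lborel (\<lambda>x. (u x)\<^sup>2)" using u by (simp add: integrable_iff_bounded)
  have "integrable lborel (\<lambda>x. f x * \<theta> x)" if \<theta>: "\<theta> \<in> schwartz" for \<theta>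
  proof -
    note [measurable] = schwartz_measurable[OF \<theta>]
    obtain B where B: "B \<ge> 0" "\<And>x. norm (\<theta> x) \<le> B" using schwartz_bounded[OF \<theta>] by blast
    show ?thesis
    proof (rule Bochner_Integration.integrable_bound)
      show "integrable lborel (\<lambda>x. a * norm (\<theta> x) + b * B * (u x)\<^sup>2)"
        using u' schwartz_integrable[OF \<theta>] by (intro Bochner_Integration.integrable_add integrable_mult_right integrable_norm)
      have bound: "norm (f x * \<theta> x) \<le> a * norm (\<theta> x) + b * B * (u x)\<^sup>2" for x
      proof -
        have "norm (f x * \<theta> x) \<le> (a + b * (u x)\<^sup>2) * norm (\<theta> x)"
          unfolding norm_mult using f by (intro mult_right_mono) auto
        also have "b * (u x)\<^sup>2 * norm (\<theta> x) \<le> b * (u x)\<^sup>2 * B"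
          using B ab by (intro mult_left_mono) auto
        then have "(a + b * (u x)\<^sup>2) * norm (\<theta> x) \<le> a * norm (\<theta> x) + b * B * (u x)\<^sup>2"
          by (simp add: algebra_simps)
        finally show ?thesis .
      qed
      show "AE x in lborel. norm (f x * \<theta> x) \<le> norm (a * norm (\<theta> x) + b * B * (u x)\<^sup>2)"
        by (rule AE_I2, rule order_trans[OF bound]) (simp only: real_norm_def abs_ge_self)
    qed simp
  qed
  then show "tempered f"
    unfolding tempered_def
    by (auto intro!: measurable_completion integrable_completion[THEN iffD2] borel_measurable_times
        schwartz_measurable)
  assume m: "test_function m"
  note [measurable] = kernel_measurable[OF m] kernel_convolution_measurable[OF m]
  define Km where "Km = (\<integral>\<^sup>+z. ennreal (norm (fourier_kernel m z)) \<partial>lborel)"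
  have Km: "Km < \<infinity>"
    using kernel_integrable[OF m] unfolding Km_def by (simp add: integrable_iff_bounded)
  have Km1: "(\<integral>\<^sup>+x. ennreal (norm (fourier_kernel m (y - x))) \<partial>lborel) = Km" for y
    unfolding Km_def
    by (subst nn_integral_lborel_affine[where c = "-1" and t = y and f = "\<lambda>z. ennreal (norm (fourier_kernel m z))"]) auto
  have Km2: "(\<integral>\<^sup>+y. ennreal (norm (fourier_kernel m (y - x))) \<partial>lborel) = Km" for x
    unfolding Km_def
    by (subst nn_integral_lborel_affine[where c = 1 and t = "-x" and f = "\<lambda>z. ennreal (norm (fourier_kernel m z))"]) auto
  have fin: "(\<integral>\<^sup>+x. \<integral>\<^sup>+y. ennreal (norm (fourier_kernel m (y - x) * f x * \<theta> y)) \<partial>lborel \<partial>lborel) < \<infinity>"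
    if \<theta>: "\<theta> \<in> schwartz" for \<theta>
  proof -
    note [measurable] = schwartz_measurable[OF \<theta>]
    obtain B where B: "B \<ge> 0" "\<And>x. norm (\<theta> x) \<le> B" using schwartz_bounded[OF \<theta>] by blast
    have "(\<integral>\<^sup>+x. \<integral>\<^sup>+y. ennreal (norm (fourier_kernel m (y - x) * f x * \<theta> y)) \<partial>lborel \<partial>lborel)
      \<le> (\<integral>\<^sup>+x. \<integral>\<^sup>+y. ennreal a * (ennreal (norm (\<theta> y)) * ennreal (norm (fourier_kernel m (y - x))))
            + ennreal (b * B) * (ennreal ((u x)\<^sup>2) * ennreal (norm (fourier_kernel m (y - x)))) \<partial>lborel \<partial>lborel)"
    proof (intro nn_integral_mono)
      fix x y
      have "norm (f x) * norm (\<theta> y) \<le> (a + b * (u x)\<^sup>2) * norm (\<theta> y)"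
        using f by (intro mult_right_mono) auto
      also have "b * (u x)\<^sup>2 * norm (\<theta> y) \<le> b * (u x)\<^sup>2 * B"
        using B ab by (intro mult_left_mono) auto
      then have "(a + b * (u x)\<^sup>2) * norm (\<theta> y) \<le> a * norm (\<theta> y) + b * B * (u x)\<^sup>2"
        by (simp add: algebra_simps)
      finally have "norm (f x) * norm (\<theta> y) \<le> a * norm (\<theta> y) + b * B * (u x)\<^sup>2" .
      from mult_left_mono[OF this norm_ge_zero[of "fourier_kernel m (y - x)"]]
      have "norm (fourier_kernel m (y - x) * f x * \<theta> y)
          \<le> a * (norm (\<theta> y) * norm (fourier_kernel m (y - x))) + b * B * ((u x)\<^sup>2 * norm (fourier_kernel m (y - x)))"
        by (simp add: norm_mult algebra_simps)
      then show "ennreal (norm (fourier_kernel m (y - x) * f x * \<theta> y))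
        \<le> ennreal a * (ennreal (norm (\<theta> y)) * ennreal (norm (fourier_kernel m (y - x))))
            + ennreal (b * B) * (ennreal ((u x)\<^sup>2) * ennreal (norm (fourier_kernel m (y - x))))"
        using ab B by (simp add: ennreal_mult[symmetric] ennreal_plus[symmetric] ennreal_leI del: ennreal_plus)
    qed
    also have "\<dots> = ennreal a * (\<integral>\<^sup>+x. \<integral>\<^sup>+y. ennreal (norm (\<theta> y)) * ennreal (norm (fourier_kernel m (y - x))) \<partial>lborel \<partial>lborel)
        + ennreal (b * B) * (\<integral>\<^sup>+x. \<integral>\<^sup>+y. ennreal ((u x)\<^sup>2) * ennreal (norm (fourier_kernel m (y - x))) \<partial>lborel \<partial>lborel)"
      by (simp add: nn_integral_add nn_integral_cmult)
    also have "(\<integral>\<^sup>+x. \<integral>\<^sup>+y. ennreal ((u x)\<^sup>2) * ennreal (norm (fourier_kernel m (y - x))) \<partial>lborel \<partial>lborel)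
        = (\<integral>\<^sup>+x. ennreal ((u x)\<^sup>2) \<partial>lborel) * Km"
      by (simp add: nn_integral_cmult nn_integral_multc Km2)
    also have "(\<integral>\<^sup>+x. \<integral>\<^sup>+y. ennreal (norm (\<theta> y)) * ennreal (norm (fourier_kernel m (y - x))) \<partial>lborel \<partial>lborel)
        = (\<integral>\<^sup>+y. \<integral>\<^sup>+x. ennreal (norm (\<theta> y)) * ennreal (norm (fourier_kernel m (y - x))) \<partial>lborel \<partial>lborel)"
      by (rule lborel_pair.Fubini') measurable
    also have "\<dots> = (\<integral>\<^sup>+y. ennreal (norm (\<theta> y)) \<partial>lborel) * Km"
      by (simp add: nn_integral_cmult nn_integral_multc Km1)
    also have "ennreal a * ((\<integral>\<^sup>+y. ennreal (norm (\<theta> y)) \<partial>lborel) * Km)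
        + ennreal (b * B) * ((\<integral>\<^sup>+x. ennreal ((u x)\<^sup>2) \<partial>lborel) * Km) < \<infinity>"
      using Km u schwartz_integrable[OF \<theta>] by (simp add: integrable_iff_bounded ennreal_mult_less_top)
    finally show ?thesis .
  qed
  have eq: "(LINT x|lborel. fourier_kernel m (y - x) * f x * \<theta> y) = kernel_convolution m f y * \<theta> y" for \<theta> y
    unfolding kernel_convolution_def by (rule integral_mult_left_zero)
  have "integrable lborel (\<lambda>y. kernel_convolution m f y * \<theta> y)" if \<theta>: "\<theta> \<in> schwartz" for \<theta>
  proof -
    note [measurable] = schwartz_measurable[OF \<theta>]
    show ?thesis
      unfolding eq[symmetric] using fin[OF \<theta>] by (intro integrable_inner_integral) measurable
  qed
  then show "tempered (kernel_convolution m f)"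
    unfolding tempered_def
    by (auto intro!: measurable_completion integrable_completion[THEN iffD2] borel_measurable_times
        schwartz_measurable)
  assume \<theta>: "\<theta> \<in> schwartz"
  note [measurable] = schwartz_measurable[OF \<theta>]
  have "distr_of f (fourier (\<lambda>\<xi>. of_real (m \<xi>) * inv_fourier \<theta> \<xi>))
      = (LINT x|lebesgue. f x * (LINT y|lborel. fourier_kernel m (y - x) * \<theta> y))"
    unfolding distr_of_def fourier_multiplier[OF m schwartz_integrable[OF \<theta>]] ..
  also have "\<dots> = (LINT x|lborel. f x * (LINT y|lborel. fourier_kernel m (y - x) * \<theta> y))"
    by (rule integral_completion) measurable
  also have "\<dots> = (LINT x|lborel. LINT y|lborel. fourier_kernel m (y - x) * f x * \<theta> y)"
    by (subst integral_mult_right_zero[symmetric]) (simp add: mult_ac)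
  also have "\<dots> = (LINT y|lborel. LINT x|lborel. fourier_kernel m (y - x) * f x * \<theta> y)"
    using fin[OF \<theta>] by (intro integral_swap) measurable
  also have "\<dots> = distr_of (kernel_convolution m f) \<theta>"
    unfolding eq distr_of_def by (rule integral_completion[symmetric]) measurable
  finally show "distr_of f (fourier (\<lambda>\<xi>. of_real (m \<xi>) * inv_fourier \<theta> \<xi>)) = distr_of (kernel_convolution m f) \<theta>" .
qed

section \<open>Translations of functions with a square integrable weak gradient\<close>

lemma
  fixes f g :: "'a \<Rightarrow> real"
  assumes [measurable]: "f \<in> borel_measurable M" "g \<in> borel_measurable M"
    and f: "integrable M (\<lambda>x. (f x)\<^sup>2)" and g: "integrable M (\<lambda>x. (g x)\<^sup>2)"
  shows integrable_mult_square_integrable: "integrable M (\<lambda>x. f x * g x)"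
    and Cauchy_Schwarz_integral:
      "\<bar>LINT x|M. f x * g x\<bar> \<le> sqrt (LINT x|M. (f x)\<^sup>2) * sqrt (LINT x|M. (g x)\<^sup>2)"
proof -
  show int: "integrable M (\<lambda>x. f x * g x)"
  proof (rule Bochner_Integration.integrable_bound[OF Bochner_Integration.integrable_add[OF f g]])
    have "\<bar>a * b\<bar> \<le> a\<^sup>2 + b\<^sup>2" for a b :: real
    proof -
      have "0 \<le> \<bar>a\<bar> * \<bar>b\<bar>" by simp
      moreover have "2 * (\<bar>a\<bar> * \<bar>b\<bar>) \<le> a\<^sup>2 + b\<^sup>2"
        using sum_squares_bound[of "\<bar>a\<bar>" "\<bar>b\<bar>"] by (simp add: mult.assoc)
      ultimately show ?thesis unfolding abs_mult by linarith
    qed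
    then show "AE x in M. norm (f x * g x) \<le> norm ((f x)\<^sup>2 + (g x)\<^sup>2)"
      by (intro AE_I2) simp
  qed simp
  have "(\<integral>\<^sup>+x. ennreal \<bar>f x\<bar> * ennreal \<bar>g x\<bar> \<partial>M)\<^sup>2
      \<le> (\<integral>\<^sup>+x. (ennreal \<bar>f x\<bar>)\<^sup>2 \<partial>M) * (\<integral>\<^sup>+x. (ennreal \<bar>g x\<bar>)\<^sup>2 \<partial>M)"
    by (rule Cauchy_Schwarz_nn_integral) auto
  also have "(\<integral>\<^sup>+x. ennreal \<bar>f x\<bar> * ennreal \<bar>g x\<bar> \<partial>M) = ennreal (LINT x|M. \<bar>f x * g x\<bar>)"
    using nn_integral_eq_integral[OF integrable_abs[OF int]] by (simp add: ennreal_mult abs_mult)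
  also have "(\<integral>\<^sup>+x. (ennreal \<bar>f x\<bar>)\<^sup>2 \<partial>M) = ennreal (LINT x|M. (f x)\<^sup>2)"
    using f by (subst nn_integral_eq_integral[symmetric]) (auto simp: ennreal_power)
  also have "(\<integral>\<^sup>+x. (ennreal \<bar>g x\<bar>)\<^sup>2 \<partial>M) = ennreal (LINT x|M. (g x)\<^sup>2)"
    using g by (subst nn_integral_eq_integral[symmetric]) (auto simp: ennreal_power)
  finally have "(LINT x|M. \<bar>f x * g x\<bar>)\<^sup>2 \<le> (LINT x|M. (f x)\<^sup>2) * (LINT x|M. (g x)\<^sup>2)"
    by (simp add: ennreal_mult[symmetric] ennreal_power)
  then have "(LINT x|M. \<bar>f x * g x\<bar>) \<le> sqrt ((LINT x|M. (f x)\<^sup>2) * (LINT x|M. (g x)\<^sup>2))"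
    by (rule real_le_rsqrt)
  moreover have "\<bar>LINT x|M. f x * g x\<bar> \<le> (LINT x|M. \<bar>f x * g x\<bar>)"
    using integral_norm_bound[of M "\<lambda>x. f x * g x"] by simp
  ultimately show "\<bar>LINT x|M. f x * g x\<bar> \<le> sqrt (LINT x|M. (f x)\<^sup>2) * sqrt (LINT x|M. (g x)\<^sup>2)"
    unfolding real_sqrt_mult by (rule order_trans[rotated])
qed

lemma square_integrable_imp_locally_integrable:
  fixes u :: "'a::euclidean_space \<Rightarrow> real"
  assumes [measurable]: "u \<in> borel_measurable borel" and u: "integrable lborel (\<lambda>x. (u x)\<^sup>2)"
  shows "set_integrable lborel (cball 0 R) u"
  unfolding set_integrable_def
proof (rule Bochner_Integration.integrable_bound)
  show "integrable lborel (\<lambda>x. indicator (cball 0 R) x + (u x)\<^sup>2)"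
    using u emeasure_lborel_cball_finite
    by (intro Bochner_Integration.integrable_add integrable_real_indicator) auto
  have "\<bar>a\<bar> \<le> 1 + a\<^sup>2" for a :: real
    using sum_squares_bound[of 1 "\<bar>a\<bar>"] by simp
  then show "AE x in lborel. norm (indicator (cball 0 R) x *\<^sub>R u x) \<le> norm (indicator (cball 0 R) x + (u x)\<^sup>2)"
    by (intro AE_I2) (auto simp: indicator_def)
  show "(\<lambda>x. indicator (cball 0 R) x *\<^sub>R u x) \<in> borel_measurable lborel"
    by (intro borel_measurable_scaleR borel_measurable_indicator) auto
qed

text \<open>A measurable function is almost everywhere a limit of continuous functions. Clipping keeps these
between \<open>-R\<close> and \<open>R\<close>, the Weierstrass theorem replaces them by polynomials on a large ball, and
multiplication by a fixed cutoff that is \<open>1\<close> on the support of \<open>v\<close> makes the polynomials test functions.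
The cutoff is a dilate of \<open>\<psi>\<close>, which is constant near the origin.\<close>

lemma square_integral_approximation_by_test_functions:
  fixes v \<psi> :: "real^'n::finite \<Rightarrow> real"
  assumes [measurable]: "v \<in> borel_measurable borel"
    and bounded: "\<And>x. \<bar>v x\<bar> \<le> R" and supp: "\<And>x. norm x > R \<Longrightarrow> v x = 0" and R: "R > 0"
    and \<psi>: "test_function \<psi>" "\<And>x. norm x \<le> \<rho> \<Longrightarrow> \<psi> x = 1" "\<And>x. \<bar>\<psi> x\<bar> \<le> 1" and \<rho>: "\<rho> > 0"
  obtains S \<tau> where "\<And>n::nat. test_function (\<tau> n)"
    "\<And>n x. \<bar>\<tau> n x\<bar> \<le> (R + 1) * indicator (cball 0 S) x"
    "AE x in lborel. (\<lambda>n. \<tau> n x) \<longlonglongrightarrow> v x"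
proof -
  define \<kappa> where "\<kappa> x = \<psi> ((\<rho> / R) *\<^sub>R x)" for x
  have \<kappa>: "test_function \<kappa>"
    using test_function_affine[OF \<psi>(1), of "\<rho> / R" 0] R \<rho> by (simp add: \<kappa>_def[abs_def])
  have \<kappa>1: "\<kappa> x = 1" if "norm x \<le> R" for x
    using that R \<rho> by (auto simp: \<kappa>_def field_simps intro!: \<psi>(2))
  obtain S where S: "\<And>x. norm x > S \<Longrightarrow> \<kappa> x = 0"
    using test_function_support[OF \<kappa>] by blast
  have "v measurable_on UNIV"
    by (intro lebesgue_measurable_imp_measurable_on measurable_completion) auto
  then obtain N g where N: "negligible N" and g: "\<And>n::nat. continuous_on UNIV (g n)"
    and lim: "\<And>x. x \<notin> N \<Longrightarrow> (\<lambda>n. g n x) \<longlonglongrightarrow> v x"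
    unfolding measurable_on_def by auto
  define c where "c n x = max (- R) (min R (g n x))" for n x
  have "\<exists>p. real_polynomial_function p \<and> (\<forall>x\<in>cball 0 S. \<bar>c n x - p x\<bar> < 1 / real (Suc n))" for n
  proof -
    have "continuous_on (cball 0 S) (c n)"
      unfolding c_def using continuous_on_subset[OF g] by (intro continuous_intros) auto
    then show ?thesis
      by (rule Stone_Weierstrass_real_polynomial_function[OF compact_cball, of 0 S "c n" "1 / real (Suc n)"])
         (simp, blast)
  qed
  then obtain p where p: "\<And>n. real_polynomial_function (p n)"
    and pc: "\<And>n x. x \<in> cball 0 S \<Longrightarrow> \<bar>c n x - p n x\<bar> < 1 / real (Suc n)" by metis
  define \<tau> where "\<tau> n x = p n x * \<kappa> x" for n x
  show thesis
  proof (rule that[of \<tau> S])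
    show "test_function (\<tau> n)" for n
      unfolding \<tau>_def[abs_def] by (rule test_function_mult[OF smooth_polynomial[OF p] \<kappa>])
    show "\<bar>\<tau> n x\<bar> \<le> (R + 1) * indicator (cball 0 S) x" for n x
    proof (cases "norm x \<le> S")
      case True
      have "\<bar>c n x\<bar> \<le> R" using R by (auto simp: c_def)
      moreover have "\<bar>c n x - p n x\<bar> < 1 / real (Suc n)" using pc True by simp
      moreover have "1 / real (Suc n) \<le> 1" by simp
      ultimately have "\<bar>p n x\<bar> \<le> R + 1" by linarith
      then have "\<bar>p n x\<bar> * \<bar>\<kappa> x\<bar> \<le> (R + 1) * 1"
        using \<psi>(3) R by (intro mult_mono) (auto simp: \<kappa>_def)
      then show ?thesis using True by (simp add: \<tau>_def abs_mult)
    next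
      case False
      then show ?thesis using S by (simp add: \<tau>_def)
    qed
    have "AE x in lebesgue. x \<notin> N"
      using N by (intro AE_not_in) (simp add: negligible_iff_null_sets)
    then have "AE x in lborel. x \<notin> N" by (simp add: AE_completion_iff)
    then show "AE x in lborel. (\<lambda>n. \<tau> n x) \<longlonglongrightarrow> v x"
    proof eventually_elim
      case (elim x)
      show ?case
      proof (cases "norm x \<le> S")
        case True
        have "(\<lambda>n. c n x) \<longlonglongrightarrow> max (- R) (min R (v x))"
          unfolding c_def by (intro tendsto_max tendsto_min tendsto_const lim elim)
        moreover have "max (- R) (min R (v x)) = v x"
          using bounded[of x] by (auto simp: max_def min_def)
        moreover have "(\<lambda>n. c n x - p n x) \<longlonglongrightarrow> 0"
        proof (rule Lim_null_comparison)
          show "\<forall>\<^sub>F n in sequentially. norm (c n x - p n x) \<le> inverse (real (Suc n))"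
            using pc True by (intro always_eventually) (auto simp: inverse_eq_divide intro!: less_imp_le)
        qed (rule LIMSEQ_inverse_real_of_nat)
        ultimately have "(\<lambda>n. c n x - (c n x - p n x)) \<longlonglongrightarrow> v x - 0"
          by (intro tendsto_diff) auto
        then have "(\<lambda>n. \<tau> n x) \<longlonglongrightarrow> v x * \<kappa> x"
          unfolding \<tau>_def by (intro tendsto_mult tendsto_const) simp
        moreover have "v x * \<kappa> x = v x"
          using supp[of x] \<kappa>1[of x] by (cases "norm x \<le> R") auto
        ultimately show ?thesis by simp
      next
        case False
        then have "\<kappa> x = 0" using S by auto
        moreover from this have "v x = 0" using supp[of x] \<kappa>1[of x] by (cases "norm x \<le> R") auto
        ultimately show ?thesis by (simp add: \<tau>_def)
      qed
    qed
  qed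
qed

text \<open>A function is determined in \<open>L\<^sup>2\<close> by its pairings with test functions. Pairing \<open>w\<close> with test functions
that approximate a bounded truncation \<open>v\<close> of \<open>w\<close> gives \<open>\<integral>v\<^sup>2 \<le> M (\<integral>v\<^sup>2)\<^bsup>1/2\<^esup>\<close> in the limit, and
Fatou's lemma removes the truncation.\<close>

lemma square_integral_le_by_duality:
  fixes w \<psi> :: "real^'n::finite \<Rightarrow> real"
  assumes [measurable]: "w \<in> borel_measurable borel"
    and w: "\<And>R. set_integrable lborel (cball 0 R) w"
    and dual: "\<And>\<theta>. test_function \<theta> \<Longrightarrow> \<bar>LINT x|lborel. w x * \<theta> x\<bar> \<le> M * sqrt (LINT x|lborel. (\<theta> x)\<^sup>2)"
    and M: "M \<ge> 0"
    and \<psi>: "test_function \<psi>" "\<And>x. norm x \<le> \<rho> \<Longrightarrow> \<psi> x = 1" "\<And>x. \<bar>\<psi> x\<bar> \<le> 1" and \<rho>: "\<rho> > 0"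
  shows "(\<integral>\<^sup>+x. ennreal ((w x)\<^sup>2) \<partial>lborel) \<le> ennreal (M\<^sup>2)"
proof -
  define v where "v n x = (if \<bar>w x\<bar> \<le> real (Suc n) \<and> norm x \<le> real (Suc n) then w x else 0)" for n x
  have [measurable]: "v n \<in> borel_measurable borel" for n
    unfolding v_def[abs_def] by measurable
  have le: "(\<integral>\<^sup>+x. ennreal ((v n x)\<^sup>2) \<partial>lborel) \<le> ennreal (M\<^sup>2)" for n
  proof -
    define R where "R = real (Suc n)"
    have R: "R > 0" by (simp add: R_def)
    have vR: "\<bar>v n x\<bar> \<le> R" "norm x > R \<Longrightarrow> v n x = 0" for x by (auto simp: v_def R_def)
    obtain S \<tau> where \<tau>: "\<And>k. test_function (\<tau> k)"
      and bound: "\<And>k x. \<bar>\<tau> k x\<bar> \<le> (R + 1) * indicator (cball 0 S) x"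
      and lim: "AE x in lborel. (\<lambda>k. \<tau> k x) \<longlonglongrightarrow> v n x"
      by (rule square_integral_approximation_by_test_functions[OF _ vR R \<psi> \<rho>]) (measurable, blast)
    have [measurable]: "\<tau> k \<in> borel_measurable borel" for k
      by (rule test_function_borel_measurable[OF \<tau>])
    have l1: "(\<lambda>k. LINT x|lborel. w x * \<tau> k x) \<longlonglongrightarrow> (LINT x|lborel. w x * v n x)"
    proof (rule integral_dominated_convergence[where w = "\<lambda>x. (R + 1) * norm (indicator (cball 0 S) x *\<^sub>R w x)"])
      show "integrable lborel (\<lambda>x. (R + 1) * norm (indicator (cball 0 S) x *\<^sub>R w x))"
        using w[of S] unfolding set_integrable_def by (intro integrable_mult_right integrable_norm)
      show "AE x in lborel. (\<lambda>k. w x * \<tau> k x) \<longlonglongrightarrow> w x * v n x"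
        using lim by eventually_elim (intro tendsto_mult tendsto_const)
      show "AE x in lborel. norm (w x * \<tau> k x) \<le> (R + 1) * norm (indicator (cball 0 S) x *\<^sub>R w x)" for k
        using mult_left_mono[OF bound abs_ge_zero] by (intro AE_I2) (simp add: abs_mult mult_ac)
    qed measurable
    have l2: "(\<lambda>k. LINT x|lborel. (\<tau> k x)\<^sup>2) \<longlonglongrightarrow> (LINT x|lborel. (v n x)\<^sup>2)"
    proof (rule integral_dominated_convergence[where w = "\<lambda>x. (R + 1)\<^sup>2 * indicator (cball 0 S) x"])
      show "integrable lborel (\<lambda>x::real^'n. (R + 1)\<^sup>2 * indicator (cball 0 S) x)"
        using emeasure_lborel_cball_finite by (intro integrable_mult_right integrable_real_indicator) auto
      show "AE x in lborel. (\<lambda>k. (\<tau> k x)\<^sup>2) \<longlonglongrightarrow> (v n x)\<^sup>2"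
        using lim by eventually_elim (intro tendsto_power)
      show "AE x in lborel. norm ((\<tau> k x)\<^sup>2) \<le> (R + 1)\<^sup>2 * indicator (cball 0 S) x" for k
      proof (intro AE_I2)
        fix x
        have "\<bar>\<tau> k x\<bar>\<^sup>2 \<le> ((R + 1) * indicator (cball 0 S) x)\<^sup>2"
          using bound by (intro power_mono) auto
        then show "norm ((\<tau> k x)\<^sup>2) \<le> (R + 1)\<^sup>2 * indicator (cball 0 S) x"
          by (cases "norm x \<le> S") (simp_all add: indicator_def)
      qed
    qed measurable
    define I where "I = (LINT x|lborel. (v n x)\<^sup>2)"
    have I0: "I \<ge> 0" by (simp add: I_def)
    have wv: "w x * v n x = (v n x)\<^sup>2" for x by (simp add: v_def power2_eq_square)
    have "\<bar>I\<bar> \<le> M * sqrt I"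
    proof (rule tendsto_le[OF trivial_limit_sequentially])
      show "(\<lambda>k. M * sqrt (LINT x|lborel. (\<tau> k x)\<^sup>2)) \<longlonglongrightarrow> M * sqrt I"
        unfolding I_def by (intro tendsto_mult tendsto_const tendsto_real_sqrt l2)
      show "(\<lambda>k. \<bar>LINT x|lborel. w x * \<tau> k x\<bar>) \<longlonglongrightarrow> \<bar>I\<bar>"
        unfolding I_def wv[symmetric] by (intro tendsto_rabs l1)
    qed (use dual \<tau> in auto)
    then have "sqrt I * sqrt I \<le> M * sqrt I" using I0 by simp
    then have "sqrt I \<le> M"
      using M I0 mult_right_le_imp_le[of "sqrt I" "sqrt I" M] by (cases "I = 0") auto
    then have "I \<le> M\<^sup>2" by (rule sqrt_le_D)
    moreover have "integrable lborel (\<lambda>x. (v n x)\<^sup>2)"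
    proof (rule Bochner_Integration.integrable_bound)
      show "integrable lborel (\<lambda>x::real^'n. R\<^sup>2 * indicator (cball 0 R) x)"
        using emeasure_lborel_cball_finite by (intro integrable_mult_right integrable_real_indicator) auto
      have "(v n x)\<^sup>2 \<le> R\<^sup>2 * indicator (cball 0 R) x" for x
        using vR[of x] R by (auto simp: indicator_def abs_le_square_iff[symmetric] not_le)
      then show "AE x in lborel. norm ((v n x)\<^sup>2) \<le> norm (R\<^sup>2 * indicator (cball 0 R) x)"
        by (intro AE_I2) simp
    qed measurable
    ultimately show ?thesis
      by (subst nn_integral_eq_integral) (auto simp: I_def ennreal_leI)
  qed
  have "(\<integral>\<^sup>+x. ennreal ((w x)\<^sup>2) \<partial>lborel) = (\<integral>\<^sup>+x. liminf (\<lambda>n. ennreal ((v n x)\<^sup>2)) \<partial>lborel)"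
  proof (intro nn_integral_cong)
    fix x
    obtain k where k: "max \<bar>w x\<bar> (norm x) \<le> real k" using real_arch_simple by blast
    have "\<forall>\<^sub>F n in sequentially. ennreal ((v n x)\<^sup>2) = ennreal ((w x)\<^sup>2)"
      using eventually_ge_at_top[of k]
    proof eventually_elim
      case (elim n)
      then have "real k \<le> real (Suc n)" by simp
      then have "\<bar>w x\<bar> \<le> real (Suc n)" "norm x \<le> real (Suc n)" using k by linarith+
      then show ?case by (simp add: v_def)
    qed
    then have "(\<lambda>n. ennreal ((v n x)\<^sup>2)) \<longlonglongrightarrow> ennreal ((w x)\<^sup>2)"
      by (rule tendsto_eventually)
    then show "ennreal ((w x)\<^sup>2) = liminf (\<lambda>n. ennreal ((v n x)\<^sup>2))"
      by (rule lim_imp_Liminf[OF trivial_limit_sequentially, symmetric])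
  qed
  also have "\<dots> \<le> liminf (\<lambda>n. \<integral>\<^sup>+x. ennreal ((v n x)\<^sup>2) \<partial>lborel)"
    by (rule nn_integral_liminf) measurable
  also have "\<dots> \<le> liminf (\<lambda>_::nat. ennreal (M\<^sup>2))"
    by (rule Liminf_mono) (simp add: le)
  also have "\<dots> = ennreal (M\<^sup>2)"
    by (rule Liminf_const) simp
  finally show ?thesis .
qed

text \<open>For a test function \<open>\<theta>\<close> the pairing of \<open>u(x + y) - u(x)\<close> with \<open>\<theta>\<close> is the increment between \<open>t = 0\<close> and
\<open>t = -1\<close> of \<open>F(t) = \<integral> u(x) \<theta>(x + t y) dx\<close>. The weak gradient expresses \<open>F'\<close> as a pairing of \<open>y \<bullet> W\<close>
with a translate of \<open>\<theta>\<close>, so the mean value theorem and the Cauchy-Schwarz inequality bound the pairing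
by \<open>\<bar>y\<bar>\<close> times the \<open>L\<^sup>2\<close> norms of \<open>W\<close> and \<open>\<theta>\<close>; duality concludes.\<close>

lemma translation_difference_le_weak_gradient:
  fixes u \<psi> :: "real^'n::finite \<Rightarrow> real" and W :: "real^'n \<Rightarrow> real^'n"
  assumes [measurable]: "u \<in> borel_measurable borel" "W \<in> borel_measurable borel"
    and u: "(\<integral>\<^sup>+x. ennreal ((u x)\<^sup>2) \<partial>lborel) < \<infinity>"
    and W: "(\<integral>\<^sup>+x. ennreal ((norm (W x))\<^sup>2) \<partial>lborel) < \<infinity>"
    and weak: "\<And>i \<theta>. test_function \<theta> \<Longrightarrow>
        (LINT x|lborel. W x $ i * \<theta> x) = - (LINT x|lborel. u x * partial i \<theta> x)"
    and \<psi>: "test_function \<psi>" "\<And>x. norm x \<le> \<rho> \<Longrightarrow> \<psi> x = 1" "\<And>x. \<bar>\<psi> x\<bar> \<le> 1" and \<rho>: "\<rho> > 0"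
  shows "(\<integral>\<^sup>+x. ennreal ((u (x + y) - u x)\<^sup>2) \<partial>lborel)
       \<le> ennreal ((norm y)\<^sup>2) * (\<integral>\<^sup>+x. ennreal ((norm (W x))\<^sup>2) \<partial>lborel)"
proof -
  have "(\<lambda>x. W x \<bullet> axis i 1) \<in> borel_measurable borel" for i by measurable
  then have [measurable]: "(\<lambda>x. W x $ i) \<in> borel_measurable borel" for i by (simp add: inner_axis)
  have u2: "integrable lborel (\<lambda>x. (u x)\<^sup>2)" using u by (simp add: integrable_iff_bounded)
  have W2: "integrable lborel (\<lambda>x. (norm (W x))\<^sup>2)" using W by (simp add: integrable_iff_bounded)
  define A where "A = sqrt (LINT x|lborel. (norm (W x))\<^sup>2)"
  have A0: "A \<ge> 0" by (simp add: A_def)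
  have uy2: "integrable lborel (\<lambda>x. (u (x + y))\<^sup>2)"
    using integrable_lborel_affine[OF u2, of 1 y] by (simp add: add.commute)
  note uloc = square_integrable_imp_locally_integrable[OF _ u2]
  have uyloc: "set_integrable lborel (cball 0 R) (\<lambda>x. u (x + y))" for R
    by (rule square_integrable_imp_locally_integrable[OF _ uy2]) measurable
  have dual: "\<bar>LINT x|lborel. (u (x + y) - u x) * \<theta> x\<bar> \<le> norm y * A * sqrt (LINT x|lborel. (\<theta> x)\<^sup>2)"
    if \<theta>: "test_function \<theta>" for \<theta>
  proof -
    have [measurable]: "\<theta> \<in> borel_measurable borel" by (rule test_function_borel_measurable[OF \<theta>])
    define F where "F t = (LINT x|lborel. \<theta> (x + t *\<^sub>R y) *\<^sub>R u x)" for t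
    define F' where "F' t = (\<Sum>i\<in>UNIV. y $ i *\<^sub>R (LINT x|lborel. partial i \<theta> (x + t *\<^sub>R y) *\<^sub>R u x))" for t
    have deriv: "(F has_real_derivative F' t) (at t)" for t
      unfolding has_real_derivative_iff_has_vector_derivative F_def[abs_def] F'_def
      by (rule has_vector_derivative_integral_translate[OF \<theta> _ uloc]) measurable
    have shift: "test_function (\<lambda>x. \<theta> (x + t *\<^sub>R y))" for t
      using test_function_affine[OF \<theta>, of 1 "t *\<^sub>R y"] by (simp add: add.commute)
    have F'_le: "\<bar>F' t\<bar> \<le> norm y * A * sqrt (LINT x|lborel. (\<theta> x)\<^sup>2)" for t
    proof -
      let ?\<eta> = "\<lambda>x. \<theta> (x + t *\<^sub>R y)"
      have \<eta>2: "integrable lborel (\<lambda>x. (?\<eta> x)\<^sup>2)"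
      proof -
        have "smooth ?\<eta>" using shift test_function_smooth by blast
        then show ?thesis
          using test_function_integrable[OF test_function_mult[OF _ shift[of t]], of ?\<eta>]
          by (simp add: power2_eq_square)
      qed
      have "partial i ?\<eta> = (\<lambda>x. partial i \<theta> (x + t *\<^sub>R y))" for i
        using partial_affine[of \<theta> i "t *\<^sub>R y" 1] smooth_differentiable[OF test_function_smooth[OF \<theta>]]
        by (simp add: add.commute)
      then have "(LINT x|lborel. partial i \<theta> (x + t *\<^sub>R y) *\<^sub>R u x) = - (LINT x|lborel. W x $ i * ?\<eta> x)" for i
        using weak[OF shift[of t], of i] by (simp add: mult.commute)
      then have "F' t = - (\<Sum>i\<in>UNIV. LINT x|lborel. y $ i * (W x $ i * ?\<eta> x))"
        by (simp add: F'_def sum_negf)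
      also have "(\<Sum>i\<in>UNIV. LINT x|lborel. y $ i * (W x $ i * ?\<eta> x))
          = (LINT x|lborel. (\<Sum>i\<in>UNIV. y $ i * (W x $ i * ?\<eta> x)))"
      proof (rule Bochner_Integration.integral_sum[symmetric])
        fix i
        have "integrable lborel (\<lambda>x. (W x $ i)\<^sup>2)"
          by (rule Bochner_Integration.integrable_bound[OF W2])
             (auto simp: component_le_norm_cart abs_le_square_iff[symmetric])
        then show "integrable lborel (\<lambda>x. y $ i * (W x $ i * ?\<eta> x))"
          using \<eta>2 by (intro integrable_mult_right integrable_mult_square_integrable) auto
      qed
      also have "\<dots> = (LINT x|lborel. (y \<bullet> W x) * ?\<eta> x)"
        by (simp add: inner_vec_def sum_distrib_right mult.assoc)
      finally have F'_eq: "F' t = - (LINT x|lborel. (y \<bullet> W x) * ?\<eta> x)" .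
      have yW: "(y \<bullet> W x)\<^sup>2 \<le> (norm y)\<^sup>2 * (norm (W x))\<^sup>2" for x
        using Cauchy_Schwarz_ineq2[of y "W x"]
        by (simp add: power_mult_distrib[symmetric] abs_le_square_iff[symmetric] abs_mult)
      have yW2: "integrable lborel (\<lambda>x. (y \<bullet> W x)\<^sup>2)"
        by (rule Bochner_Integration.integrable_bound[OF integrable_mult_right[OF W2, of "(norm y)\<^sup>2"]])
           (use yW in auto)
      have "\<bar>F' t\<bar> \<le> sqrt (LINT x|lborel. (y \<bullet> W x)\<^sup>2) * sqrt (LINT x|lborel. (?\<eta> x)\<^sup>2)"
        unfolding F'_eq abs_minus using yW2 \<eta>2 by (intro Cauchy_Schwarz_integral) measurable
      also have "(LINT x|lborel. (?\<eta> x)\<^sup>2) = (LINT x|lborel. (\<theta> x)\<^sup>2)"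
        using integral_lborel_translate[of "\<lambda>x. (\<theta> x)\<^sup>2" "t *\<^sub>R y"] by (simp add: add.commute)
      also have "(LINT x|lborel. (y \<bullet> W x)\<^sup>2) \<le> (LINT x|lborel. (norm y)\<^sup>2 * (norm (W x))\<^sup>2)"
        using yW yW2 integrable_mult_right[OF W2] by (intro integral_mono) auto
      then have "sqrt (LINT x|lborel. (y \<bullet> W x)\<^sup>2) \<le> norm y * A"
        by (simp add: A_def real_sqrt_mult[symmetric] real_le_lsqrt real_sqrt_le_iff)
           (metis norm_ge_zero real_sqrt_le_mono real_sqrt_mult real_sqrt_unique)
      finally show ?thesis by (simp add: mult_right_mono)
    qed
    obtain z where z: "F 0 - F (-1) = (0 - (-1)) * F' z"
      using MVT2[of "-1" 0 F F'] deriv by auto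
    have Fm1: "F (-1) = (LINT x|lborel. u (x + y) * \<theta> x)"
      unfolding F_def using integral_lborel_translate[of "\<lambda>x. \<theta> (x - y) * u x" y]
      by (simp add: mult.commute add.commute)
    have "(LINT x|lborel. (u (x + y) - u x) * \<theta> x) = F (-1) - F 0"
      using integrable_test_function_scaleR[OF \<theta> _ uyloc] integrable_test_function_scaleR[OF \<theta> _ uloc]
      by (subst Fm1) (simp add: F_def left_diff_distrib mult.commute[of "\<theta> _"])
    also have "\<dots> = - F' z" using z by simp
    finally show ?thesis using F'_le[of z] by simp
  qed
  have "(\<integral>\<^sup>+x. ennreal ((u (x + y) - u x)\<^sup>2) \<partial>lborel) \<le> ennreal ((norm y * A)\<^sup>2)"
  proof (rule square_integral_le_by_duality[OF _ _ dual _ \<psi> \<rho>])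
    show "set_integrable lborel (cball 0 R) (\<lambda>x. u (x + y) - u x)" for R
      using uyloc[of R] uloc[of R] by (intro set_integral_diff) auto
  qed (use A0 in auto)
  also have "\<dots> = ennreal ((norm y)\<^sup>2) * (\<integral>\<^sup>+x. ennreal ((norm (W x))\<^sup>2) \<partial>lborel)"
    using W2 by (subst nn_integral_eq_integral) (auto simp: A_def power_mult_distrib ennreal_mult)
  finally show ?thesis .
qed

section \<open>Convolution with a kernel of integral zero\<close>

lemma powr_ge_tangent:
  fixes p t :: real
  assumes p: "p \<ge> 1" and t: "t \<ge> 0"
  shows "1 + p * (t - 1) \<le> t powr p"
proof (cases "t = 0")
  case False
  have "(t powr p) powr (1 / p) * 1 powr (1 - 1 / p) \<le> 1 / p * t powr p + (1 - 1 / p) * 1"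
    using p t False by (intro Youngs_inequality_0) auto
  then have "p * t \<le> p * (1 / p * t powr p + (1 - 1 / p))"
    using p t by (simp add: powr_powr)
  then show ?thesis using p by (simp add: algebra_simps)
qed (use p in auto)

text \<open>Jensen's inequality for the measure with density \<open>k\<close>, normalised: the graph of the power function
lies above its tangent at the mean of \<open>d\<close>.\<close>

lemma integral_powr_le_weighted:
  fixes k d :: "'a \<Rightarrow> real"
  assumes [measurable]: "k \<in> borel_measurable M" "d \<in> borel_measurable M"
    and k: "\<And>x. k x \<ge> 0" "integrable M k" and d: "\<And>x. d x \<ge> 0"
    and kd: "integrable M (\<lambda>x. k x * d x)" and p: "p \<ge> 1"
  shows "ennreal ((LINT x|M. k x * d x) powr p)
    \<le> ennreal ((LINT x|M. k x) powr (p - 1)) * (\<integral>\<^sup>+x. ennreal (k x * d x powr p) \<partial>M)"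
proof -
  define H where "H = (LINT x|M. k x)"
  define I where "I = (LINT x|M. k x * d x)"
  have H0: "H \<ge> 0" and I0: "I \<ge> 0" using k d by (auto simp: H_def I_def)
  have Ipos: "H > 0" if "I > 0"
  proof (rule ccontr)
    assume "\<not> H > 0"
    then have "H = 0" using H0 by simp
    then have "AE x in M. k x = 0"
      using integral_nonneg_eq_0_iff_AE[OF k(2)] k(1) by (simp add: H_def)
    then have "I = 0" unfolding I_def by (intro integral_eq_zero_AE) auto
    with that show False by simp
  qed
  show ?thesis
  proof (cases "I = 0")
    case False
    then have I: "I > 0" and H: "H > 0" using I0 Ipos by auto
    \<comment> \<open>The weighted mean of \<open>d\<close>, at which the tangent is taken.\<close>
    define \<mu> where "\<mu> = I / H"
    have \<mu>: "\<mu> > 0" using I H by (simp add: \<mu>_def)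
    have tangent: "\<mu> powr p * (k x + p * (k x * d x / \<mu> - k x)) \<le> k x * d x powr p" for x
    proof -
      have "k x * \<mu> powr p * (1 + p * (d x / \<mu> - 1)) \<le> k x * \<mu> powr p * ((d x / \<mu>) powr p)"
        using p d \<mu> k(1) by (intro mult_left_mono powr_ge_tangent) auto
      also have "\<dots> = k x * d x powr p"
        using \<mu> d by (simp add: powr_divide)
      finally show ?thesis by (simp add: algebra_simps)
    qed
    have int: "integrable M (\<lambda>x. \<mu> powr p * (k x + p * (k x * d x / \<mu> - k x)))"
      using k(2) kd by (intro integrable_mult_right Bochner_Integration.integrable_add
          Bochner_Integration.integrable_diff integrable_divide)
    have "(LINT x|M. \<mu> powr p * (k x + p * (k x * d x / \<mu> - k x))) = \<mu> powr p * (H + p * (I / \<mu> - H))"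
      using k(2) kd by (simp add: H_def I_def)
    also have "\<dots> = \<mu> powr p * H" using H I by (simp add: \<mu>_def)
    finally have eq: "(LINT x|M. \<mu> powr p * (k x + p * (k x * d x / \<mu> - k x))) = \<mu> powr p * H" .
    have "ennreal (\<mu> powr p * H) \<le> (\<integral>\<^sup>+x. ennreal (\<mu> powr p * (k x + p * (k x * d x / \<mu> - k x))) \<partial>M)"
    proof -
      have "\<mu> powr p * H \<le> enn2real (\<integral>\<^sup>+x. ennreal (\<mu> powr p * (k x + p * (k x * d x / \<mu> - k x))) \<partial>M)"
        unfolding eq[symmetric] real_lebesgue_integral_def[OF int] by simp
      moreover have "(\<integral>\<^sup>+x. ennreal (\<mu> powr p * (k x + p * (k x * d x / \<mu> - k x))) \<partial>M) < top"
        using int unfolding real_integrable_def by (simp add: less_top)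
      ultimately show ?thesis
        using ennreal_leI by fastforce
    qed
    also have "\<dots> \<le> (\<integral>\<^sup>+x. ennreal (k x * d x powr p) \<partial>M)"
      by (intro nn_integral_mono ennreal_leI tangent)
    finally have "ennreal (\<mu> powr p * H) \<le> (\<integral>\<^sup>+x. ennreal (k x * d x powr p) \<partial>M)" .
    then have "ennreal (H powr (p - 1)) * ennreal (\<mu> powr p * H)
        \<le> ennreal (H powr (p - 1)) * (\<integral>\<^sup>+x. ennreal (k x * d x powr p) \<partial>M)"
      by (rule mult_left_mono) simp
    also have "ennreal (H powr (p - 1)) * ennreal (\<mu> powr p * H) = ennreal (H powr (p - 1) * (\<mu> powr p * H))"
      using H by (simp add: ennreal_mult)
    also have "H powr (p - 1) * (\<mu> powr p * H) = I powr p"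
    proof -
      have "H powr (p - 1) * H = H powr p"
        using H by (simp add: powr_diff)
      then have "H powr (p - 1) * (\<mu> powr p * H) = H powr p * \<mu> powr p"
        by (metis mult.assoc mult.commute)
      then show ?thesis using H I by (simp add: \<mu>_def powr_divide)
    qed
    finally show ?thesis by (simp add: H_def I_def)
  qed (simp add: I_def[symmetric])
qed

lemma kernel_convolution_eq_reflected:
  assumes m: "test_function m" and [measurable]: "f \<in> borel_measurable borel"
  shows "kernel_convolution m f y = (LINT z|lborel. fourier_kernel m z * f (y - z))"
proof -
  note [measurable] = kernel_measurable[OF m]
  have "kernel_convolution m f y = \<bar>-1\<bar> ^ DIM(real^3) *\<^sub>R
      (LINT z|lborel. fourier_kernel m (y - (y + (-1) *\<^sub>R z)) * f (y + (-1) *\<^sub>R z))"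
    unfolding kernel_convolution_def by (rule integral_lborel_affine) auto
  then show ?thesis by simp
qed

text \<open>As the kernel has integral zero, \<open>f(y)\<close> may be subtracted inside the convolution. Jensen's inequality
for each \<open>y\<close>, integrated over \<open>y\<close>, takes the place of Minkowski's integral inequality. Where the
convolution integral does not converge it has the value \<open>0\<close> by convention, and the bound is trivial.\<close>

lemma kernel_convolution_powr_le:
  assumes m: "test_function m" and [measurable]: "f \<in> borel_measurable borel"
    and m0: "(LINT z|lborel. fourier_kernel m z) = 0" and p: "p \<ge> 1"
  shows "(\<integral>\<^sup>+y. ennreal (norm (kernel_convolution m f y) powr p) \<partial>lborel)
    \<le> ennreal ((LINT z|lborel. norm (fourier_kernel m z)) powr (p - 1)) *
       (\<integral>\<^sup>+z. ennreal (norm (fourier_kernel m z)) * (\<integral>\<^sup>+y. ennreal (norm (f (y - z) - f y) powr p) \<partial>lborel) \<partial>lborel)"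
    (is "_ \<le> ennreal ?H * _")
proof -
  note [measurable] = kernel_measurable[OF m]
  note ki = kernel_integrable[OF m]
  have "ennreal (norm (kernel_convolution m f y) powr p)
      \<le> ennreal ?H * (\<integral>\<^sup>+z. ennreal (norm (fourier_kernel m z) * norm (f (y - z) - f y) powr p) \<partial>lborel)" for y
  proof (cases "integrable lborel (\<lambda>z. fourier_kernel m z * f (y - z))")
    case True
    then have int: "integrable lborel (\<lambda>z. fourier_kernel m z * (f (y - z) - f y))"
      using ki by (simp add: right_diff_distrib)
    have "kernel_convolution m f y = (LINT z|lborel. fourier_kernel m z * (f (y - z) - f y))"
      using True ki m0 by (simp add: kernel_convolution_eq_reflected[OF m] right_diff_distrib)
    then have "norm (kernel_convolution m f y) \<le> (LINT z|lborel. norm (fourier_kernel m z) * norm (f (y - z) - f y))"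
      using integral_norm_bound[of lborel "\<lambda>z. fourier_kernel m z * (f (y - z) - f y)"] by (simp add: norm_mult)
    then have "ennreal (norm (kernel_convolution m f y) powr p)
        \<le> ennreal ((LINT z|lborel. norm (fourier_kernel m z) * norm (f (y - z) - f y)) powr p)"
      using p by (intro ennreal_leI powr_mono2) auto
    also have "\<dots> \<le> ennreal ?H * (\<integral>\<^sup>+z. ennreal (norm (fourier_kernel m z) * norm (f (y - z) - f y) powr p) \<partial>lborel)"
      using integrable_norm[OF int] integrable_norm[OF ki] p
      by (intro integral_powr_le_weighted) (auto simp: norm_mult)
    finally show ?thesis .
  next
    case False
    then have "kernel_convolution m f y = 0"
      by (simp add: kernel_convolution_eq_reflected[OF m] not_integrable_integral_eq)
    then show ?thesis by simp
  qed
  then have "(\<integral>\<^sup>+y. ennreal (norm (kernel_convolution m f y) powr p) \<partial>lborel)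
      \<le> (\<integral>\<^sup>+y. ennreal ?H * (\<integral>\<^sup>+z. ennreal (norm (fourier_kernel m z) * norm (f (y - z) - f y) powr p) \<partial>lborel) \<partial>lborel)"
    by (rule nn_integral_mono)
  also have "\<dots> = ennreal ?H * (\<integral>\<^sup>+y. \<integral>\<^sup>+z. ennreal (norm (fourier_kernel m z) * norm (f (y - z) - f y) powr p) \<partial>lborel \<partial>lborel)"
    by (rule nn_integral_cmult) measurable
  also have "(\<integral>\<^sup>+y. \<integral>\<^sup>+z. ennreal (norm (fourier_kernel m z) * norm (f (y - z) - f y) powr p) \<partial>lborel \<partial>lborel)
      = (\<integral>\<^sup>+z. \<integral>\<^sup>+y. ennreal (norm (fourier_kernel m z) * norm (f (y - z) - f y) powr p) \<partial>lborel \<partial>lborel)"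
    by (rule lborel_pair.Fubini') measurable
  also have "\<dots> = (\<integral>\<^sup>+z. ennreal (norm (fourier_kernel m z)) * (\<integral>\<^sup>+y. ennreal (norm (f (y - z) - f y) powr p) \<partial>lborel) \<partial>lborel)"
    by (intro nn_integral_cong) (simp add: ennreal_mult nn_integral_cmult)
  finally show ?thesis .
qed

lemma kernel_dilate:
  assumes m: "test_function m" and c: "c > 0"
  shows "fourier_kernel (\<lambda>\<xi>. m (c *\<^sub>R \<xi>)) z = of_real ((1 / c) ^ 3) * fourier_kernel m ((1 / c) *\<^sub>R z)"
proof -
  have "test_function (\<lambda>\<xi>. m (c *\<^sub>R \<xi>))" using test_function_affine[OF m, of c 0] c by simp
  from kernel_eq_oscillatory_integral[OF this, of z] show ?thesis
    by (simp only: kernel_eq_oscillatory_integral[OF m] oscillatory_integral_dilate[OF assms]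
      scaleR_conv_of_real[where 'a = complex] times_divide_eq_right)
qed

lemma nn_integral_kernel_dilate:
  assumes m: "test_function m" and c: "c > 0" and [measurable]: "w \<in> borel_measurable borel"
  shows "(\<integral>\<^sup>+z. ennreal (norm (fourier_kernel (\<lambda>\<xi>. m (c *\<^sub>R \<xi>)) z)) * w z \<partial>lborel)
       = (\<integral>\<^sup>+z. ennreal (norm (fourier_kernel m z)) * w (c *\<^sub>R z) \<partial>lborel)"
proof -
  note [measurable] = kernel_measurable[OF m]
  have "(\<integral>\<^sup>+z. ennreal (norm (fourier_kernel m z)) * w (c *\<^sub>R z) \<partial>lborel)
      = ennreal (\<bar>1 / c\<bar> ^ DIM(real^3)) *
        (\<integral>\<^sup>+z. ennreal (norm (fourier_kernel m (0 + (1 / c) *\<^sub>R z))) * w (c *\<^sub>R (0 + (1 / c) *\<^sub>R z)) \<partial>lborel)"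
    by (rule nn_integral_lborel_affine) (use c in auto)
  also have "\<dots> = (\<integral>\<^sup>+z. ennreal ((1 / c) ^ 3) * (ennreal (norm (fourier_kernel m ((1 / c) *\<^sub>R z))) * w z) \<partial>lborel)"
    using c by (subst nn_integral_cmult) auto
  also have "\<dots> = (\<integral>\<^sup>+z. ennreal (norm (fourier_kernel (\<lambda>\<xi>. m (c *\<^sub>R \<xi>)) z)) * w z \<partial>lborel)"
    using c by (intro nn_integral_cong)
      (simp add: kernel_dilate[OF m c] norm_mult norm_power norm_divide ennreal_mult mult.assoc[symmetric])
  finally show ?thesis by simp
qed

section \<open>Estimate of a single dyadic block\<close>

lemma nn_integral_translation_difference_le:
  fixes u :: "'a::euclidean_space \<Rightarrow> real"
  assumes [measurable]: "u \<in> borel_measurable borel"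
  shows "(\<integral>\<^sup>+x. ennreal ((u (x + y) - u x)\<^sup>2) \<partial>lborel) \<le> 4 * (\<integral>\<^sup>+x. ennreal ((u x)\<^sup>2) \<partial>lborel)"
proof -
  have "(a - b)\<^sup>2 \<le> 2 * a\<^sup>2 + 2 * b\<^sup>2" for a b :: real
    using zero_le_power2[of "a + b"] by (simp add: power2_eq_square algebra_simps)
  then have "(\<integral>\<^sup>+x. ennreal ((u (x + y) - u x)\<^sup>2) \<partial>lborel)
      \<le> (\<integral>\<^sup>+x. ennreal (2 * (u (x + y))\<^sup>2 + 2 * (u x)\<^sup>2) \<partial>lborel)"
    by (intro nn_integral_mono ennreal_leI)
  also have "\<dots> = 2 * (\<integral>\<^sup>+x. ennreal ((u (y + x))\<^sup>2) \<partial>lborel) + 2 * (\<integral>\<^sup>+x. ennreal ((u x)\<^sup>2) \<partial>lborel)"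
    by (simp add: ennreal_mult nn_integral_add nn_integral_cmult add.commute)
  also have "(\<integral>\<^sup>+x. ennreal ((u (y + x))\<^sup>2) \<partial>lborel) = (\<integral>\<^sup>+x. ennreal ((u x)\<^sup>2) \<partial>lborel)"
    by (rule nn_integral_lborel_translate) measurable
  finally show ?thesis by (simp add: distrib_right[symmetric])
qed

lemma epow_le_ennreal:
  assumes "a \<le> ennreal b" "b \<ge> 0" "p \<ge> 0"
  shows "epow a p \<le> ennreal (b powr p)"
proof -
  have "a \<noteq> \<infinity>" using assms(1) by (auto simp: top_unique)
  moreover have "enn2real a \<le> b" using enn2real_mono[OF assms(1)] assms(2) by simp
  ultimately show ?thesis
    using assms(3) by (auto simp: epow_def intro!: ennreal_leI powr_mono2)
qed

text \<open>The estimate of one block. Since \<open>p \<alpha> = 2\<close>, the \<open>p\<close>-th power of an increment of \<open>f\<close> is controlled by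
the square of the increment of \<open>u\<close>. The dilation moves from the kernel to its argument, so the
constant \<open>D\<close> involves the mass and the second moment of the undilated kernel only and is the same at
all scales \<open>c\<close>.\<close>

lemma kernel_convolution_holder_le:
  fixes m \<psi> :: "real^3 \<Rightarrow> real" and \<alpha> K :: real
  assumes m: "test_function m" "m 0 = 0" and \<psi>: "test_function \<psi>" "\<psi> 0 = 1"
    and \<alpha>: "0 < \<alpha>" "\<alpha> < 1" and K: "K \<ge> 0"
  obtains D where "D \<ge> 0"
    "\<And>(c::real) f (u::real^3 \<Rightarrow> real) A B. c > 0 \<Longrightarrow> A \<ge> 0 \<Longrightarrow> B \<ge> 0 \<Longrightarrow>
      f \<in> borel_measurable borel \<Longrightarrow> u \<in> borel_measurable borel \<Longrightarrow>
      (\<And>x y. norm (f x - f y) \<le> K * \<bar>u x - u y\<bar> powr \<alpha>) \<Longrightarrow>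
      (\<integral>\<^sup>+x. ennreal ((u x)\<^sup>2) \<partial>lborel) \<le> ennreal (B\<^sup>2) \<Longrightarrow>
      (\<And>y. (\<integral>\<^sup>+x. ennreal ((u (x + y) - u x)\<^sup>2) \<partial>lborel) \<le> ennreal ((norm y * A)\<^sup>2)) \<Longrightarrow>
      Lp_norm (2 / \<alpha>) (kernel_convolution (\<lambda>\<xi>. m (c *\<^sub>R \<xi>)) f) \<le> ennreal (D * (min (c * A) B) powr \<alpha>)"
proof -
  define p where "p = 2 / \<alpha>"
  have p: "p \<ge> 1" using \<alpha> by (simp add: p_def field_simps)
  note [measurable] = kernel_measurable[OF m(1)]
  define H where "H = (LINT z|lborel. norm (fourier_kernel m z))"
  define Q where "Q = (LINT z|lborel. norm (fourier_kernel m z) * (1 + (norm z)\<^sup>2))"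
  have H0: "H \<ge> 0" and Q0: "Q \<ge> 0" by (simp_all add: H_def Q_def)
  define E where "E = H powr (p - 1) * (K powr p * (4 * Q))"
  have E0: "E \<ge> 0" using Q0 by (simp add: E_def)
  show thesis
  proof (rule that[of "E powr (\<alpha> / 2)"])
    fix c A B :: real and f :: "real^3 \<Rightarrow> complex" and u :: "real^3 \<Rightarrow> real"
    assume c: "c > 0" and A: "A \<ge> 0" and B: "B \<ge> 0"
      and [measurable]: "f \<in> borel_measurable borel" "u \<in> borel_measurable borel"
      and f: "\<And>x y. norm (f x - f y) \<le> K * \<bar>u x - u y\<bar> powr \<alpha>"
      and uB: "(\<integral>\<^sup>+x. ennreal ((u x)\<^sup>2) \<partial>lborel) \<le> ennreal (B\<^sup>2)"
      and uA: "\<And>y. (\<integral>\<^sup>+x. ennreal ((u (x + y) - u x)\<^sup>2) \<partial>lborel) \<le> ennreal ((norm y * A)\<^sup>2)"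
    define \<mu> where "\<mu> = min (c * A) B"
    have \<mu>: "\<mu> \<ge> 0" using A B c by (simp add: \<mu>_def)
    let ?m = "\<lambda>\<xi>. m (c *\<^sub>R \<xi>)"
    have mc: "test_function ?m" using test_function_affine[OF m(1), of c 0] c by simp
    note [measurable] = kernel_measurable[OF mc] kernel_convolution_measurable[OF mc]
    have mc0: "(LINT z|lborel. fourier_kernel ?m z) = 0"
      by (rule integral_kernel_eq_0[OF mc \<psi>(1) _ \<psi>(2)]) (simp add: m)
    have Hc: "(LINT z|lborel. norm (fourier_kernel ?m z)) = H"
      using nn_integral_kernel_dilate[OF m(1) c, of "\<lambda>_. 1"] H0
        nn_integral_eq_integral[OF integrable_norm[OF kernel_integrable[OF m(1)]]]
        nn_integral_eq_integral[OF integrable_norm[OF kernel_integrable[OF mc]]]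
      by (simp add: H_def)
    \<comment> \<open>Up to the Hoelder constant, the bound for the \<open>p\<close>-th powers of the increments of \<open>f\<close> by \<open>z\<close>.\<close>
    define w where "w z = ennreal (min ((norm z * A)\<^sup>2) (4 * B\<^sup>2))" for z :: "real^3"
    have [measurable]: "w \<in> borel_measurable borel" unfolding w_def[abs_def] by measurable
    have diff: "(\<integral>\<^sup>+y. ennreal (norm (f (y - z) - f y) powr p) \<partial>lborel) \<le> ennreal (K powr p) * w z" for z
    proof -
      have "norm (f (y - z) - f y) powr p \<le> K powr p * (u (y + (- z)) - u y)\<^sup>2" for y
      proof -
        have "norm (f (y - z) - f y) powr p \<le> (K * \<bar>u (y - z) - u y\<bar> powr \<alpha>) powr p"
          using p by (intro powr_mono2 f) auto
        also have "\<dots> = K powr p * (u (y - z) - u y)\<^sup>2"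
          using K \<alpha> by (simp add: powr_mult powr_powr p_def)
        finally show ?thesis by simp
      qed
      then have "(\<integral>\<^sup>+y. ennreal (norm (f (y - z) - f y) powr p) \<partial>lborel)
          \<le> (\<integral>\<^sup>+y. ennreal (K powr p * (u (y + (- z)) - u y)\<^sup>2) \<partial>lborel)"
        by (intro nn_integral_mono ennreal_leI)
      also have "\<dots> = ennreal (K powr p) * (\<integral>\<^sup>+y. ennreal ((u (y + (- z)) - u y)\<^sup>2) \<partial>lborel)"
        by (simp add: ennreal_mult nn_integral_cmult)
      also have "(\<integral>\<^sup>+y. ennreal ((u (y + (- z)) - u y)\<^sup>2) \<partial>lborel) \<le> w z"
      proof -
        have "(\<integral>\<^sup>+y. ennreal ((u (y + (- z)) - u y)\<^sup>2) \<partial>lborel) \<le> 4 * (\<integral>\<^sup>+x. ennreal ((u x)\<^sup>2) \<partial>lborel)"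
          by (rule nn_integral_translation_difference_le) measurable
        also have "\<dots> \<le> 4 * ennreal (B\<^sup>2)" using uB by (rule mult_left_mono) simp
        also have "\<dots> = ennreal (4 * B\<^sup>2)" by (simp add: ennreal_mult)
        finally show ?thesis using uA[of "- z"] by (simp add: w_def min_def)
      qed
      finally show ?thesis by (simp add: mult_left_mono)
    qed
    have w: "w (c *\<^sub>R z) \<le> ennreal (4 * \<mu>\<^sup>2) * ennreal (1 + (norm z)\<^sup>2)" for z
    proof -
      have "min ((norm (c *\<^sub>R z) * A)\<^sup>2) (4 * B\<^sup>2) \<le> 4 * \<mu>\<^sup>2 * (1 + (norm z)\<^sup>2)"
      proof (cases "c * A \<le> B")
        case True
        have "(norm (c *\<^sub>R z) * A)\<^sup>2 = \<mu>\<^sup>2 * (norm z)\<^sup>2"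
          using c True by (simp add: \<mu>_def min_def power_mult_distrib)
        also have "\<dots> \<le> 4 * \<mu>\<^sup>2 * (1 + (norm z)\<^sup>2)" by (simp add: algebra_simps add_nonneg_nonneg)
        finally show ?thesis by simp
      next
        case False
        then have "4 * B\<^sup>2 \<le> 4 * \<mu>\<^sup>2 * (1 + (norm z)\<^sup>2)" by (simp add: \<mu>_def min_def algebra_simps)
        then show ?thesis by simp
      qed
      then have "w (c *\<^sub>R z) \<le> ennreal (4 * \<mu>\<^sup>2 * (1 + (norm z)\<^sup>2))"
        unfolding w_def by (rule ennreal_leI)
      then show ?thesis by (simp add: ennreal_mult)
    qed
    have "(\<integral>\<^sup>+y. ennreal (norm (kernel_convolution ?m f y) powr p) \<partial>lborel)
      \<le> ennreal (H powr (p - 1)) *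
         (\<integral>\<^sup>+z. ennreal (norm (fourier_kernel ?m z)) * (\<integral>\<^sup>+y. ennreal (norm (f (y - z) - f y) powr p) \<partial>lborel) \<partial>lborel)"
      using kernel_convolution_powr_le[OF mc _ mc0 p, of f] by (simp add: Hc)
    also have "\<dots> \<le> ennreal (H powr (p - 1)) *
         (\<integral>\<^sup>+z. ennreal (norm (fourier_kernel ?m z)) * (ennreal (K powr p) * w z) \<partial>lborel)"
      by (intro mult_left_mono nn_integral_mono diff) auto
    also have "(\<integral>\<^sup>+z. ennreal (norm (fourier_kernel ?m z)) * (ennreal (K powr p) * w z) \<partial>lborel)
        = ennreal (K powr p) * (\<integral>\<^sup>+z. ennreal (norm (fourier_kernel ?m z)) * w z \<partial>lborel)"
      by (subst nn_integral_cmult[symmetric]) (auto simp: mult_ac)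
    also have "(\<integral>\<^sup>+z. ennreal (norm (fourier_kernel ?m z)) * w z \<partial>lborel)
        = (\<integral>\<^sup>+z. ennreal (norm (fourier_kernel m z)) * w (c *\<^sub>R z) \<partial>lborel)"
      by (rule nn_integral_kernel_dilate[OF m(1) c]) measurable
    also have "\<dots> \<le> (\<integral>\<^sup>+z. ennreal (norm (fourier_kernel m z)) * (ennreal (4 * \<mu>\<^sup>2) * ennreal (1 + (norm z)\<^sup>2)) \<partial>lborel)"
      by (intro mult_left_mono nn_integral_mono w) auto
    also have "\<dots> = (\<integral>\<^sup>+z. ennreal (4 * \<mu>\<^sup>2) * ennreal (norm (fourier_kernel m z) * (1 + (norm z)\<^sup>2)) \<partial>lborel)"
      by (intro nn_integral_cong) (simp add: ennreal_mult mult_ac)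
    also have "\<dots> = ennreal (4 * \<mu>\<^sup>2) * ennreal Q"
      unfolding Q_def using kernel_moment_integrable[OF m(1)]
      by (subst nn_integral_cmult) (auto simp: nn_integral_eq_integral)
    also have "ennreal (H powr (p - 1)) * (ennreal (K powr p) * (ennreal (4 * \<mu>\<^sup>2) * ennreal Q)) = ennreal (E * \<mu>\<^sup>2)"
      using Q0 by (simp add: E_def ennreal_mult[symmetric] mult_ac)
    finally have "(\<integral>\<^sup>+y. ennreal (norm (kernel_convolution ?m f y) powr p) \<partial>lborel) \<le> ennreal (E * \<mu>\<^sup>2)"
      by (simp add: mult_left_mono)
    then have "Lp_norm p (kernel_convolution ?m f) \<le> ennreal ((E * \<mu>\<^sup>2) powr (1 / p))"
      unfolding Lp_norm_def nn_integral_completion using E0 p by (intro epow_le_ennreal) auto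
    also have "(E * \<mu>\<^sup>2) powr (1 / p) = E powr (\<alpha> / 2) * \<mu> powr \<alpha>"
    proof -
      have "(\<mu> powr 2) powr (\<alpha> / 2) = \<mu> powr \<alpha>" unfolding powr_powr by simp
      then have "(\<mu>\<^sup>2) powr (\<alpha> / 2) = \<mu> powr \<alpha>" using \<mu> by simp
      then show ?thesis using E0 \<mu> \<alpha> by (simp add: powr_mult p_def)
    qed
    finally show "Lp_norm (2 / \<alpha>) (kernel_convolution ?m f) \<le> ennreal (E powr (\<alpha> / 2) * (min (c * A) B) powr \<alpha>)"
      by (simp add: p_def \<mu>_def)
  qed simp
qed

section \<open>Summation over the dyadic scales\<close>

lemma nn_integral_count_space_powr_abs_finite:
  assumes "\<delta> > 0"
  shows "(\<integral>\<^sup>+k. ennreal (2 powr (- \<delta> * \<bar>real_of_int k\<bar>)) \<partial>count_space UNIV) < \<infinity>"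
proof -
  let ?f = "\<lambda>k::int. ennreal (2 powr (- \<delta> * \<bar>real_of_int k\<bar>))"
  have geom: "(\<integral>\<^sup>+n. ennreal (2 powr (- \<delta> * real n)) \<partial>count_space UNIV) < \<infinity>"
  proof -
    have eq: "2 powr (- \<delta> * real n) = (2 powr (- \<delta>)) ^ n" for n
      by (simp add: powr_realpow[symmetric] powr_powr)
    have "2 powr (- \<delta>) < 2 powr 0" using assms by (intro powr_less_mono) auto
    then have "summable (\<lambda>n. (2 powr (- \<delta>)) ^ n :: real)" by (intro summable_geometric) simp
    then have "(\<Sum>n. ennreal ((2 powr (- \<delta>)) ^ n)) \<noteq> top" by (intro ennreal_suminf_neq_top) auto
    then show ?thesis by (simp only: nn_integral_count_space_nat eq less_top infinity_ennreal_def)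
  qed
  have "?f k \<le> ?f k * indicator (range int) k + ?f k * indicator (range (\<lambda>n. - int n)) k" for k
  proof (cases "k \<ge> 0")
    case True
    then have "k \<in> range int" by (metis int_nat_eq rangeI)
    then show ?thesis by simp
  next
    case False
    then have "k = - int (nat (- k))" by simp
    then have "k \<in> range (\<lambda>n. - int n)" by blast
    then show ?thesis by simp
  qed
  then have "(\<integral>\<^sup>+k. ?f k \<partial>count_space UNIV)
      \<le> (\<integral>\<^sup>+k. ?f k * indicator (range int) k + ?f k * indicator (range (\<lambda>n. - int n)) k \<partial>count_space UNIV)"
    by (rule nn_integral_mono)
  also have "\<dots> = (\<integral>\<^sup>+k. ?f k \<partial>count_space (range int)) + (\<integral>\<^sup>+k. ?f k \<partial>count_space (range (\<lambda>n. - int n)))"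
    by (subst nn_integral_add) (auto simp: nn_integral_count_space_indicator)
  also have "(\<integral>\<^sup>+k. ?f k \<partial>count_space (range int)) = (\<integral>\<^sup>+n. ?f (int n) \<partial>count_space UNIV)"
    by (rule nn_integral_bij_count_space[symmetric]) (simp add: bij_betw_def)
  also have "(\<integral>\<^sup>+k. ?f k \<partial>count_space (range (\<lambda>n. - int n))) = (\<integral>\<^sup>+n. ?f (- int n) \<partial>count_space UNIV)"
    by (rule nn_integral_bij_count_space[symmetric]) (simp add: bij_betw_def inj_on_def)
  finally show ?thesis using geom by (simp add: le_less_trans)
qed

text \<open>\<open>N\<close> is the scale at which the two entries of the minimum balance. Counted from there, the second entry
gives decay at rate \<open>s\<close> towards low frequencies and the first one decay at rate \<open>\<alpha> - s\<close> towards high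
frequencies. Rounding \<open>N\<close> down to an integer costs the factor \<open>2 powr (\<alpha> - s)\<close>.\<close>

lemma dyadic_min_le:
  fixes A B s \<alpha> :: real and k :: int
  assumes A: "A > 0" and B: "B > 0" and s: "0 < s" "s < \<alpha>"
  defines "N \<equiv> \<lfloor>log 2 (A / B)\<rfloor>"
  shows "2 powr (of_int (k + N) * s) * (min (2 powr (- of_int (k + N)) * A) B) powr \<alpha>
    \<le> 2 powr (\<alpha> - s) * (A powr s * B powr (\<alpha> - s)) * 2 powr (- min s (\<alpha> - s) * \<bar>of_int k\<bar>)"
    (is "?L \<le> _")
proof -
  define \<rho> where "\<rho> = A / B"
  have \<rho>: "\<rho> > 0" using A B by (simp add: \<rho>_def)
  have N1: "2 powr of_int N \<le> \<rho>"
    using \<rho> by (simp add: N_def \<rho>_def[symmetric] powr_le_iff)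
  have N2: "2 powr (- of_int N) \<le> 2 / \<rho>"
  proof -
    have "log 2 \<rho> \<le> of_int N + 1" by (simp add: N_def \<rho>_def[symmetric])
    then have "\<rho> \<le> 2 powr (of_int N + 1)" using \<rho> by (simp add: log_le_iff)
    then have "\<rho> \<le> 2 powr of_int N * 2" by (simp add: powr_add)
    then show ?thesis using \<rho> by (simp add: powr_minus field_simps)
  qed
  define X where "X = A powr s * B powr (\<alpha> - s)"
  have X0: "X > 0" using A B by (simp add: X_def)
  have one: "1 \<le> 2 powr (\<alpha> - s)" using s by (simp add: ge_one_powr_ge_zero)
  have low: "?L \<le> 2 powr (of_int k * s) * X"
  proof -
    have "?L \<le> 2 powr (of_int (k + N) * s) * B powr \<alpha>"
      using A B s by (intro mult_left_mono powr_mono2) auto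
    also have "\<dots> = 2 powr (of_int k * s) * (2 powr of_int N) powr s * B powr \<alpha>"
      by (simp add: powr_powr powr_add distrib_right)
    also have "\<dots> \<le> 2 powr (of_int k * s) * \<rho> powr s * B powr \<alpha>"
      using s N1 by (intro mult_right_mono mult_left_mono powr_mono2) auto
    also have "\<dots> = 2 powr (of_int k * s) * X"
      using A B by (simp add: \<rho>_def X_def powr_divide powr_diff)
    finally show ?thesis .
  qed
  have high: "?L \<le> 2 powr (\<alpha> - s) * X * 2 powr (- of_int k * (\<alpha> - s))"
  proof -
    have "?L \<le> 2 powr (of_int (k + N) * s) * (2 powr (- of_int (k + N)) * A) powr \<alpha>"
      using A B s by (intro mult_left_mono powr_mono2) auto
    also have "\<dots> = 2 powr (of_int (k + N) * s) * 2 powr (- of_int (k + N) * \<alpha>) * A powr \<alpha>"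
      using A by (simp add: powr_mult powr_powr)
    also have "\<dots> = 2 powr (- of_int k * (\<alpha> - s)) * (2 powr (- of_int N)) powr (\<alpha> - s) * A powr \<alpha>"
      by (simp add: powr_powr powr_add[symmetric] algebra_simps)
    also have "\<dots> \<le> 2 powr (- of_int k * (\<alpha> - s)) * (2 / \<rho>) powr (\<alpha> - s) * A powr \<alpha>"
      using s N2 by (intro mult_right_mono mult_left_mono powr_mono2) auto
    also have "(2 / \<rho>) powr (\<alpha> - s) * A powr \<alpha> = 2 powr (\<alpha> - s) * X"
    proof -
      have "(2 / \<rho>) powr (\<alpha> - s) = 2 powr (\<alpha> - s) * B powr (\<alpha> - s) / A powr (\<alpha> - s)"
        using A B by (simp add: \<rho>_def powr_divide powr_mult)
      moreover have "A powr \<alpha> = A powr (\<alpha> - s) * A powr s" by (simp add: powr_add[symmetric])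
      ultimately show ?thesis using A by (simp add: X_def)
    qed
    then have "2 powr (- of_int k * (\<alpha> - s)) * (2 / \<rho>) powr (\<alpha> - s) * A powr \<alpha>
        = 2 powr (\<alpha> - s) * X * 2 powr (- of_int k * (\<alpha> - s))"
      by (simp add: mult_ac)
    finally show ?thesis .
  qed
  show ?thesis
  proof (cases "k \<ge> 0")
    case True
    have "2 powr (- of_int k * (\<alpha> - s)) \<le> 2 powr (- min s (\<alpha> - s) * \<bar>of_int k\<bar>)"
      using True mult_right_mono[of "min s (\<alpha> - s)" "\<alpha> - s" "real_of_int k"]
      by (intro powr_mono) (auto simp: mult.commute)
    then have "2 powr (\<alpha> - s) * X * 2 powr (- of_int k * (\<alpha> - s))
        \<le> 2 powr (\<alpha> - s) * X * 2 powr (- min s (\<alpha> - s) * \<bar>of_int k\<bar>)"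
      using X0 by (intro mult_left_mono) auto
    with high show ?thesis unfolding X_def by linarith
  next
    case False
    have "of_int k * s = - s * \<bar>of_int k\<bar>" using False by simp
    also have "\<dots> \<le> - min s (\<alpha> - s) * \<bar>of_int k\<bar>" by (intro mult_right_mono) auto
    finally have "2 powr (of_int k * s) \<le> 2 powr (- min s (\<alpha> - s) * \<bar>of_int k\<bar>)"
      by (intro powr_mono) auto
    then have "2 powr (of_int k * s) * X \<le> 2 powr (- min s (\<alpha> - s) * \<bar>of_int k\<bar>) * X"
      using X0 by (intro mult_right_mono) auto
    also have "\<dots> \<le> 2 powr (\<alpha> - s) * (2 powr (- min s (\<alpha> - s) * \<bar>of_int k\<bar>) * X)"
      using one X0 mult_right_mono[OF one, of "2 powr (- min s (\<alpha> - s) * \<bar>of_int k\<bar>) * X"] by simp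
    finally show ?thesis using low unfolding X_def by (simp add: mult_ac)
  qed
qed

text \<open>If \<open>A\<close> or \<open>B\<close> vanishes then so does every term; otherwise the index is shifted by the balancing scale,
which makes the sum comparable with a geometric series that depends on \<open>s\<close> and \<open>\<alpha>\<close> alone.\<close>

lemma nn_integral_dyadic_interpolation:
  assumes s: "0 < s" "s < \<alpha>"
  obtains S where "S \<ge> 0"
    "\<And>A B. A \<ge> 0 \<Longrightarrow> B \<ge> 0 \<Longrightarrow>
      (\<integral>\<^sup>+j. ennreal (2 powr (of_int j * s) * (min (2 powr (- of_int j) * A) B) powr \<alpha>) \<partial>count_space (UNIV :: int set))
      \<le> ennreal (S * (A powr s * B powr (\<alpha> - s)))"
proof -
  define \<delta> where "\<delta> = min s (\<alpha> - s)"
  have "\<delta> > 0" using s by (simp add: \<delta>_def)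
  then have fin: "(\<integral>\<^sup>+k. ennreal (2 powr (- \<delta> * \<bar>real_of_int k\<bar>)) \<partial>count_space UNIV) < \<infinity>"
    by (rule nn_integral_count_space_powr_abs_finite)
  define S0 where "S0 = enn2real (\<integral>\<^sup>+k. ennreal (2 powr (- \<delta> * \<bar>real_of_int k\<bar>)) \<partial>count_space UNIV)"
  have S0: "(\<integral>\<^sup>+k. ennreal (2 powr (- \<delta> * \<bar>real_of_int k\<bar>)) \<partial>count_space UNIV) = ennreal S0"
    using fin by (simp add: S0_def less_top)
  have S00: "S0 \<ge> 0" by (simp add: S0_def)
  show thesis
  proof (rule that[of "2 powr (\<alpha> - s) * S0"])
    fix A B :: real assume AB: "A \<ge> 0" "B \<ge> 0"
    let ?g = "\<lambda>j::int. ennreal (2 powr (of_int j * s) * (min (2 powr (- of_int j) * A) B) powr \<alpha>)"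
    show "(\<integral>\<^sup>+j. ?g j \<partial>count_space UNIV) \<le> ennreal (2 powr (\<alpha> - s) * S0 * (A powr s * B powr (\<alpha> - s)))"
    proof (cases "A = 0 \<or> B = 0")
      case True
      then have "min (2 powr (- of_int j) * A) B = 0" for j :: int
        using AB by (auto simp: min_absorb1 min_absorb2)
      then show ?thesis by simp
    next
      case False
      then have A: "A > 0" and B: "B > 0" using AB by auto
      let ?N = "\<lfloor>log 2 (A / B)\<rfloor>"
      have "bij_betw (\<lambda>k. k + ?N) UNIV UNIV"
        by (rule bij_betwI[of _ _ _ "\<lambda>k. k - ?N"]) auto
      then have "(\<integral>\<^sup>+j. ?g j \<partial>count_space UNIV) = (\<integral>\<^sup>+k. ?g (k + ?N) \<partial>count_space UNIV)"
        by (rule nn_integral_bij_count_space[symmetric])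
      also have "\<dots> \<le> (\<integral>\<^sup>+k. ennreal (2 powr (\<alpha> - s) * (A powr s * B powr (\<alpha> - s)))
          * ennreal (2 powr (- \<delta> * \<bar>real_of_int k\<bar>)) \<partial>count_space UNIV)"
        using dyadic_min_le[OF A B s] unfolding \<delta>_def
        by (intro nn_integral_mono) (simp add: ennreal_mult[symmetric] ennreal_leI)
      also have "\<dots> = ennreal (2 powr (\<alpha> - s) * (A powr s * B powr (\<alpha> - s))) * ennreal S0"
        unfolding S0[symmetric] by (rule nn_integral_cmult) auto
      also have "\<dots> = ennreal (2 powr (\<alpha> - s) * S0 * (A powr s * B powr (\<alpha> - s)))"
        using S00 by (simp add: ennreal_mult[symmetric] mult_ac)
      finally show ?thesis .
    qed
  qed (use S00 in simp)
qed

section \<open>Signed powers\<close>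

lemma powr_add_le:
  fixes a b \<alpha> :: real
  assumes "a \<ge> 0" "b \<ge> 0" "0 < \<alpha>" "\<alpha> \<le> 1"
  shows "(a + b) powr \<alpha> \<le> a powr \<alpha> + b powr \<alpha>"
proof (cases "a + b = 0")
  case False
  then have pos: "a + b > 0" using assms by simp
  have "t \<le> t powr \<alpha>" if "0 \<le> t" "t \<le> 1" for t :: real
    using that assms powr_mono'[of \<alpha> 1 t] by simp
  from this[of "a / (a + b)"] this[of "b / (a + b)"]
  have "a / (a + b) + b / (a + b) \<le> (a / (a + b)) powr \<alpha> + (b / (a + b)) powr \<alpha>"
    using assms pos by simp
  also have "a / (a + b) + b / (a + b) = 1" using pos by (simp add: add_divide_distrib[symmetric])
  also have "(a / (a + b)) powr \<alpha> + (b / (a + b)) powr \<alpha> = (a powr \<alpha> + b powr \<alpha>) / (a + b) powr \<alpha>"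
    using assms pos by (simp add: powr_divide add_divide_distrib)
  finally show ?thesis using pos by (simp add: le_divide_eq)
qed (use assms in simp)

lemma signed_pow_nonneg: "a \<ge> 0 \<Longrightarrow> signed_pow \<sigma> a = a powr \<sigma>"
  by (cases "a = 0") (auto simp: signed_pow_def)

lemma signed_pow_minus: "signed_pow \<sigma> (- a) = - signed_pow \<sigma> a"
  by (simp add: signed_pow_def)

text \<open>For arguments of equal sign this is subadditivity of the power, with constant \<open>1\<close>. For opposite signs
each of the two powers is at most that of the distance, whence the factor \<open>2\<close>.\<close>

lemma signed_pow_holder:
  fixes x y \<alpha> :: real
  assumes \<alpha>: "0 < \<alpha>" "\<alpha> \<le> 1"
  shows "\<bar>signed_pow \<alpha> x - signed_pow \<alpha> y\<bar> \<le> 2 * \<bar>x - y\<bar> powr \<alpha>"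
proof -
  have same: "\<bar>signed_pow \<alpha> a - signed_pow \<alpha> b\<bar> \<le> 2 * \<bar>a - b\<bar> powr \<alpha>" if "0 \<le> b" "b \<le> a" for a b
  proof -
    have "a powr \<alpha> \<le> (a - b) powr \<alpha> + b powr \<alpha>"
      using powr_add_le[of "a - b" b \<alpha>] that \<alpha> by simp
    moreover have "b powr \<alpha> \<le> a powr \<alpha>" using that \<alpha> by (intro powr_mono2) auto
    moreover have "0 \<le> (a - b) powr \<alpha>" by simp
    ultimately show ?thesis using that by (simp add: signed_pow_nonneg)
  qed
  have opposite: "\<bar>signed_pow \<alpha> a - signed_pow \<alpha> b\<bar> \<le> 2 * \<bar>a - b\<bar> powr \<alpha>" if "0 \<le> a" "b \<le> 0" for a b
  proof -
    have "signed_pow \<alpha> a - signed_pow \<alpha> b = a powr \<alpha> + (- b) powr \<alpha>"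
      using that signed_pow_nonneg[of a \<alpha>] signed_pow_nonneg[of "- b" \<alpha>] by (simp add: signed_pow_minus)
    moreover have "a powr \<alpha> \<le> (a - b) powr \<alpha>" "(- b) powr \<alpha> \<le> (a - b) powr \<alpha>"
      using that \<alpha> by (auto intro!: powr_mono2)
    ultimately show ?thesis using that by simp
  qed
  consider "0 \<le> y" "y \<le> x" | "0 \<le> x" "x \<le> y" | "x \<le> 0" "x \<le> y" "y \<le> 0" | "y \<le> x" "x \<le> 0" "y \<le> 0"
    | "0 \<le> x" "y \<le> 0" | "0 \<le> y" "x \<le> 0" by linarith
  then show ?thesis
  proof cases
    case 3
    then show ?thesis using same[of "- y" "- x"] by (simp add: signed_pow_minus)
  next
    case 4
    then show ?thesis using same[of "- x" "- y"] by (simp add: signed_pow_minus abs_minus_commute)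
  qed (use same[of x y] same[of y x] opposite[of x y] opposite[of y x] in \<open>simp_all add: abs_minus_commute\<close>)
qed

lemma signed_pow_signed_pow: "signed_pow \<sigma> (signed_pow \<tau> a) = signed_pow (\<tau> * \<sigma>) a"
proof (cases "a = 0")
  case False
  then have "\<bar>signed_pow \<tau> a\<bar> = \<bar>a\<bar> powr \<tau>" by (simp add: signed_pow_def abs_mult)
  then show ?thesis using False by (simp add: signed_pow_def powr_powr)
qed (simp add: signed_pow_def)

lemma holder_seminorm_bound:
  assumes "holder_seminorm \<alpha> G = ennreal K" "K \<ge> 0"
  shows "\<bar>G x - G y\<bar> \<le> K * \<bar>x - y\<bar> powr \<alpha>"
proof (cases "x = y")
  case False
  have "ennreal (\<bar>G x - G y\<bar> / \<bar>x - y\<bar> powr \<alpha>) \<le> holder_seminorm \<alpha> G"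
    unfolding holder_seminorm_def using False by (intro SUP_upper2[of "(x, y)"]) auto
  then have "\<bar>G x - G y\<bar> / \<bar>x - y\<bar> powr \<alpha> \<le> K" using assms by simp
  then show ?thesis using False by (simp add: divide_le_eq)
qed simp

section \<open>The Besov estimate\<close>

text \<open>For \<open>\<bar>\<xi>\<bar> < 3/4\<close> no \<open>\<phi>(2\<^bsup>-j\<^esup> \<xi>)\<close> with \<open>j \<ge> 0\<close> contributes to the partition of unity, so \<open>\<psi> = 1\<close> there.
This makes \<open>\<psi>\<close> both the regulariser for the integral of the kernels and the cutoff in the
approximation by test functions.\<close>

lemma littlewood_paley_low_frequency:
  assumes "littlewood_paley \<psi> \<phi>"
  shows "test_function \<psi>" "\<And>x. norm x < 3/4 \<Longrightarrow> \<psi> x = 1" "\<bar>\<psi> x\<bar> \<le> 1"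
    and "test_function \<phi>" "\<phi> 0 = 0"
proof -
  have supp: "\<psi> x = 0" if "norm x > 4/3" for x
    using assms that closure_subset[of "{\<xi>. \<psi> \<xi> \<noteq> 0}"] unfolding littlewood_paley_def by fastforce
  have supp1: "\<phi> x = 0" if "norm x > 8/3" for x
    using assms that closure_subset[of "{\<xi>. \<phi> \<xi> \<noteq> 0}"] unfolding littlewood_paley_def by fastforce
  have supp2: "\<phi> x = 0" if "norm x < 3/4" for x
    using assms that closure_subset[of "{\<xi>. \<phi> \<xi> \<noteq> 0}"] unfolding littlewood_paley_def by fastforce
  show "test_function \<psi>" "test_function \<phi>"
    using assms supp supp1 unfolding littlewood_paley_def test_function_iff by blast+
  show "\<phi> 0 = 0" using supp2[of 0] by simp
  show "\<bar>\<psi> x\<bar> \<le> 1" using assms unfolding littlewood_paley_def by (auto simp: image_subset_iff)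
  show "\<psi> x = 1" if x: "norm x < 3/4" for x
  proof -
    have "\<phi> ((1 / 2 ^ j) *\<^sub>R x) = 0" for j :: nat
    proof (rule supp2)
      have "norm x / 2 ^ j \<le> norm x / 1" by (intro divide_left_mono) auto
      moreover have "norm ((1 / 2 ^ j) *\<^sub>R x) = norm x / 2 ^ j" by simp
      ultimately show "norm ((1 / 2 ^ j) *\<^sub>R x) < 3/4" using x by linarith
    qed
    moreover have "(\<lambda>j::nat. \<phi> ((1 / 2 ^ j) *\<^sub>R x)) sums (1 - \<psi> x)"
      using assms unfolding littlewood_paley_def by blast
    ultimately have "(\<lambda>j::nat. 0) sums (1 - \<psi> x)" by simp
    then have "1 - \<psi> x = 0" using sums_unique2[OF sums_zero] by metis
    then show ?thesis by simp
  qed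
qed

lemma epow_one: "epow a 1 = a"
  by (simp add: epow_def less_top)

lemma epow_finite: "a < \<infinity> \<Longrightarrow> epow a p = ennreal (enn2real a powr p)"
  by (auto simp: epow_def)

lemma in_L2_square_integral:
  assumes "in_Lp 2 f"
  shows "(\<integral>\<^sup>+x. ennreal ((norm (f x))\<^sup>2) \<partial>lebesgue) = ennreal ((enn2real (Lp_norm 2 f))\<^sup>2)"
proof -
  define I where "I = (\<integral>\<^sup>+x. ennreal ((norm (f x))\<^sup>2) \<partial>lebesgue)"
  have L: "Lp_norm 2 f = epow I (1 / 2)" by (simp add: Lp_norm_def I_def)
  then have I: "I \<noteq> \<infinity>" using assms by (auto simp: in_Lp_def epow_def)
  then have "enn2real (Lp_norm 2 f) = sqrt (enn2real I)"
    by (simp add: L epow_def powr_half_sqrt)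
  then have "(enn2real (Lp_norm 2 f))\<^sup>2 = enn2real I" by simp
  then show ?thesis using I by (simp add: I_def less_top)
qed

lemma holder_continuous:
  fixes G :: "real \<Rightarrow> real"
  assumes G: "\<And>x y. \<bar>G x - G y\<bar> \<le> K * \<bar>x - y\<bar> powr \<alpha>" and \<alpha>: "\<alpha> > 0"
  shows "continuous_on UNIV G"
proof -
  have "isCont G x" for x
  proof -
    have "((\<lambda>y. \<bar>y - x\<bar> powr \<alpha>) \<longlongrightarrow> 0) (at x)"
      using \<alpha> by (intro tendsto_zero_powrI[where b = \<alpha>] tendsto_rabs_zero LIM_zero tendsto_const) auto
    then have "((\<lambda>y. K * \<bar>y - x\<bar> powr \<alpha>) \<longlongrightarrow> 0) (at x)" by (rule tendsto_mult_right_zero)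
    then have "((\<lambda>y. G y - G x) \<longlongrightarrow> 0) (at x)"
      by (rule Lim_null_comparison[rotated]) (use G in \<open>auto intro!: always_eventually\<close>)
    then show ?thesis unfolding isCont_def by (rule LIM_zero_cancel)
  qed
  then show ?thesis by (simp add: continuous_on_eq_continuous_at)
qed

lemma fourier_multiplier_measurable:
  assumes m: "test_function m" and \<theta>: "\<theta> \<in> schwartz"
  shows "fourier (\<lambda>\<xi>. of_real (m \<xi>) * inv_fourier \<theta> \<xi>) \<in> borel_measurable borel"
proof -
  note [measurable] = kernel_measurable[OF m] schwartz_measurable[OF \<theta>]
  have "(\<lambda>x. LINT y|lborel. fourier_kernel m (y - x) * \<theta> y) \<in> borel_measurable borel" by measurable
  then show ?thesis by (simp add: fourier_multiplier[OF m schwartz_integrable[OF \<theta>], abs_def, symmetric])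
qed

text \<open>The functions in question are Lebesgue measurable, while products of measures and convolutions are
taken with respect to \<open>lborel\<close>. The Borel representative \<open>f'\<close> bridges the two: it defines the same
distribution as \<open>f\<close>, and its convolution with the kernel is a function representing the block.\<close>

lemma distr_Lp_norm_dyadic_block_le:
  fixes f f' :: "real^3 \<Rightarrow> complex" and u :: "real^3 \<Rightarrow> real"
  assumes f: "f \<in> borel_measurable lebesgue" "AE x in lborel. f x = f' x"
    and [measurable]: "f' \<in> borel_measurable borel" "u \<in> borel_measurable borel"
    and ab: "a \<ge> 0" "b \<ge> 0" and f': "\<And>x. norm (f' x) \<le> a + b * (u x)\<^sup>2"
    and u: "(\<integral>\<^sup>+x. ennreal ((u x)\<^sup>2) \<partial>lborel) < \<infinity>"
    and \<phi>: "test_function \<phi>"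
  shows "tempered f"
    and "distr_Lp_norm p (dyadic_block \<phi> j (distr_of f))
      \<le> Lp_norm p (kernel_convolution (\<lambda>\<xi>. \<phi> ((2 powi (- j)) *\<^sub>R \<xi>)) f')"
proof -
  let ?m = "\<lambda>\<xi>. \<phi> ((2 powi (- j)) *\<^sub>R \<xi>)"
  have m: "test_function ?m"
    using test_function_affine[OF \<phi>, of "2 powi (- j)" 0] by simp
  have f'_leb: "f' \<in> borel_measurable lebesgue" by (rule measurable_completion) simp
  have AE: "AE x in lebesgue. f x = f' x" by (rule AE_completion[OF f(2)])
  have temp: "tempered f'"
    by (rule tempered_quadratic_growth[OF _ _ ab f' u]) measurable
  show "tempered f"
    unfolding tempered_def
  proof (intro conjI ballI f(1))
    fix \<theta> assume \<theta>: "\<theta> \<in> schwartz"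
    have \<theta>_leb: "\<theta> \<in> borel_measurable lebesgue"
      by (rule measurable_completion) (simp add: schwartz_measurable[OF \<theta>])
    have "integrable lebesgue (\<lambda>x. f' x * \<theta> x)" using temp \<theta> by (simp add: tempered_def)
    then show "integrable lebesgue (\<lambda>x. f x * \<theta> x)"
      by (rule integrable_cong_AE_imp) (use f(1) \<theta>_leb AE in auto)
  qed
  have "dyadic_block \<phi> j (distr_of f) \<theta> = distr_of (kernel_convolution ?m f') \<theta>" if \<theta>: "\<theta> \<in> schwartz" for \<theta>
  proof -
    let ?g = "fourier (\<lambda>\<xi>. of_real (?m \<xi>) * inv_fourier \<theta> \<xi>)"
    have g_leb: "?g \<in> borel_measurable lebesgue"
      by (rule measurable_completion) (simp add: fourier_multiplier_measurable[OF m \<theta>])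
    have "dyadic_block \<phi> j (distr_of f) \<theta> = distr_of f ?g"
      by (simp add: dyadic_block_def distr_inv_fourier_def distr_mult_def distr_fourier_def)
    also have "\<dots> = distr_of f' ?g"
      unfolding distr_of_def
      by (rule integral_cong_AE) (use f(1) f'_leb g_leb AE in auto)
    also have "\<dots> = distr_of (kernel_convolution ?m f') \<theta>"
      by (rule distr_of_kernel_convolution[OF _ _ ab f' u m \<theta>]) measurable
    finally show ?thesis .
  qed
  moreover have "tempered (kernel_convolution ?m f')"
    by (rule tempered_kernel_convolution[OF _ _ ab f' u m]) measurable
  ultimately show "distr_Lp_norm p (dyadic_block \<phi> j (distr_of f)) \<le> Lp_norm p (kernel_convolution ?m f')"
    unfolding distr_Lp_norm_def by (intro INF_lower) auto
qed

text \<open>Borel representatives of \<open>u\<close> and \<open>W\<close> satisfy the hypotheses of the translation estimate, which feeds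
the block estimate with \<open>c = 2\<^bsup>-j\<^esup>\<close>; the weighted bounds are then summed over all scales.\<close>

lemma besov_norm_holder_composition_le:
  assumes LP: "littlewood_paley \<psi> \<phi>" and \<alpha>: "0 < \<alpha>" "\<alpha> < 1" and s: "0 < s" "s < \<alpha>" and K: "K \<ge> 0"
  obtains C :: real where
    "\<And>G u W. (\<And>x y. \<bar>G x - G y\<bar> \<le> K * \<bar>x - y\<bar> powr \<alpha>) \<Longrightarrow>
      in_Lp 2 u \<Longrightarrow> weak_gradient u W \<Longrightarrow> in_Lp 2 W \<Longrightarrow>
      besov_norm \<phi> s (2 / \<alpha>) 1 (\<lambda>x. G (u x))
        \<le> ennreal C * epow (Lp_norm 2 W) s * epow (Lp_norm 2 u) (\<alpha> - s)"
proof -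
  note \<psi> = littlewood_paley_low_frequency(1,2,3)[OF LP]
  note \<phi> = littlewood_paley_low_frequency(4,5)[OF LP]
  have \<psi>0: "\<psi> 0 = 1" using \<psi>(2)[of 0] by simp
  have \<psi>1: "\<psi> x = 1" if "norm x \<le> 1/2" for x using \<psi>(2)[of x] that by simp
  obtain D where D: "D \<ge> 0" and block:
    "\<And>c f (u::real^3 \<Rightarrow> real) A B. c > 0 \<Longrightarrow> A \<ge> 0 \<Longrightarrow> B \<ge> 0 \<Longrightarrow>
      f \<in> borel_measurable borel \<Longrightarrow> u \<in> borel_measurable borel \<Longrightarrow>
      (\<And>x y. norm (f x - f y) \<le> K * \<bar>u x - u y\<bar> powr \<alpha>) \<Longrightarrow>
      (\<integral>\<^sup>+x. ennreal ((u x)\<^sup>2) \<partial>lborel) \<le> ennreal (B\<^sup>2) \<Longrightarrow>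
      (\<And>y. (\<integral>\<^sup>+x. ennreal ((u (x + y) - u x)\<^sup>2) \<partial>lborel) \<le> ennreal ((norm y * A)\<^sup>2)) \<Longrightarrow>
      Lp_norm (2 / \<alpha>) (kernel_convolution (\<lambda>\<xi>. \<phi> (c *\<^sub>R \<xi>)) f) \<le> ennreal (D * (min (c * A) B) powr \<alpha>)"
    using kernel_convolution_holder_le[OF \<phi> \<psi>(1) \<psi>0 \<alpha> K] by blast
  obtain S where S: "S \<ge> 0" and dyadic_sum: "\<And>A B. A \<ge> 0 \<Longrightarrow> B \<ge> 0 \<Longrightarrow>
      (\<integral>\<^sup>+j. ennreal (2 powr (of_int j * s) * (min (2 powr (- of_int j) * A) B) powr \<alpha>) \<partial>count_space (UNIV :: int set))
      \<le> ennreal (S * (A powr s * B powr (\<alpha> - s)))"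
    using nn_integral_dyadic_interpolation[OF s] by blast
  show thesis
  proof (rule that[of "D * S"])
    fix G u and W :: "real^3 \<Rightarrow> real^3"
    assume G: "\<And>x y. \<bar>G x - G y\<bar> \<le> K * \<bar>x - y\<bar> powr \<alpha>"
      and u: "in_Lp 2 u" and uW: "weak_gradient u W" and W: "in_Lp 2 W"
    define A where "A = enn2real (Lp_norm 2 W)"
    define B where "B = enn2real (Lp_norm 2 u)"
    have A0: "A \<ge> 0" and B0: "B \<ge> 0" by (simp_all add: A_def B_def)
    have u_leb: "u \<in> borel_measurable lebesgue" and W_leb: "W \<in> borel_measurable lebesgue"
      using u W by (auto simp: in_Lp_def)
    obtain u' where [measurable]: "u' \<in> borel_measurable borel" and u': "AE x in lborel. u x = u' x"
      using completion_ex_borel_measurable_real[OF u_leb] by auto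
    have W_comp_leb: "(\<lambda>x. W x $ i) \<in> borel_measurable lebesgue" for i
    proof -
      have "(\<lambda>x. W x \<bullet> axis i 1) \<in> borel_measurable lebesgue" using W_leb by (intro borel_measurable_inner) auto
      then show ?thesis by (simp add: inner_axis)
    qed
    have "\<exists>w. w \<in> borel_measurable borel \<and> (AE x in lborel. W x $ i = w x)" for i
      using completion_ex_borel_measurable_real[OF W_comp_leb[of i]] by auto
    then obtain w where [measurable]: "\<And>i. w i \<in> borel_measurable borel"
      and w: "\<And>i. AE x in lborel. W x $ i = w i x" by metis
    \<comment> \<open>A Borel representative of \<open>W\<close>, assembled from representatives of its components.\<close>
    define W' :: "real^3 \<Rightarrow> real^3" where "W' x = (\<Sum>i\<in>UNIV. w i x *\<^sub>R axis i 1)" for x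
    have W'_comp: "W' x $ i = w i x" for x i
      by (simp add: W'_def axis_def if_distrib[of "(*) _"] cong: if_cong)
    have [measurable]: "W' \<in> borel_measurable borel" unfolding W'_def[abs_def] by measurable
    have [measurable]: "(\<lambda>x. W' x $ i) \<in> borel_measurable borel" for i by (simp add: W'_comp)
    have "AE x in lborel. \<forall>i\<in>UNIV. W x $ i = w i x"
      by (rule AE_finite_allI) (use w in auto)
    then have W': "AE x in lborel. W x = W' x"
      by eventually_elim (simp add: vec_eq_iff W'_comp)
    have [measurable]: "G \<in> borel_measurable borel"
      by (rule borel_measurable_continuous_onI[OF holder_continuous[OF G \<alpha>(1)]])
    have u'_leb: "u' \<in> borel_measurable lebesgue" and W'_leb: "\<And>i. (\<lambda>x. W' x $ i) \<in> borel_measurable lebesgue"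
      by (auto intro!: measurable_completion)
    have AEu: "AE x in lebesgue. u x = u' x" and AEW: "AE x in lebesgue. W x = W' x"
      using u' W' by (auto intro: AE_completion)
    have u'2: "(\<integral>\<^sup>+x. ennreal ((u' x)\<^sup>2) \<partial>lborel) = ennreal (B\<^sup>2)"
    proof -
      have "(\<integral>\<^sup>+x. ennreal ((u' x)\<^sup>2) \<partial>lborel) = (\<integral>\<^sup>+x. ennreal ((norm (u x))\<^sup>2) \<partial>lborel)"
        using u' by (intro nn_integral_cong_AE) (auto elim: eventually_mono)
      then show ?thesis using in_L2_square_integral[OF u] by (simp add: B_def nn_integral_completion)
    qed
    have W'2: "(\<integral>\<^sup>+x. ennreal ((norm (W' x))\<^sup>2) \<partial>lborel) = ennreal (A\<^sup>2)"
    proof -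
      have "(\<integral>\<^sup>+x. ennreal ((norm (W' x))\<^sup>2) \<partial>lborel) = (\<integral>\<^sup>+x. ennreal ((norm (W x))\<^sup>2) \<partial>lborel)"
        using W' by (intro nn_integral_cong_AE) (auto elim: eventually_mono)
      then show ?thesis using in_L2_square_integral[OF W] by (simp add: A_def nn_integral_completion)
    qed
    have weak: "(LINT x|lborel. W' x $ i * \<theta> x) = - (LINT x|lborel. u' x * partial i \<theta> x)"
      if \<theta>: "test_function \<theta>" for i \<theta>
    proof -
      have [measurable]: "\<theta> \<in> borel_measurable borel" "partial i \<theta> \<in> borel_measurable borel"
        using test_function_borel_measurable test_function_partial \<theta> by blast+
      have leb: "\<theta> \<in> borel_measurable lebesgue" "partial i \<theta> \<in> borel_measurable lebesgue"
        by (auto intro!: measurable_completion)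
      have "(LINT x|lborel. W' x $ i * \<theta> x) = (LINT x|lebesgue. W' x $ i * \<theta> x)"
        by (rule integral_completion[symmetric]) measurable
      also have "\<dots> = (LINT x|lebesgue. W x $ i * \<theta> x)"
        by (rule integral_cong_AE) (use W_comp_leb W'_leb leb AEW in auto)
      also have "\<dots> = - (LINT x|lebesgue. u x * partial i \<theta> x)"
        using uW \<theta> unfolding weak_gradient_def by blast
      also have "(LINT x|lebesgue. u x * partial i \<theta> x) = (LINT x|lebesgue. u' x * partial i \<theta> x)"
        by (rule integral_cong_AE) (use u_leb u'_leb leb AEu in auto)
      also have "\<dots> = (LINT x|lborel. u' x * partial i \<theta> x)"
        by (rule integral_completion) measurable
      finally show ?thesis .
    qed
    have trans: "(\<integral>\<^sup>+x. ennreal ((u' (x + y) - u' x)\<^sup>2) \<partial>lborel) \<le> ennreal ((norm y * A)\<^sup>2)" for y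
    proof -
      have "(\<integral>\<^sup>+x. ennreal ((u' (x + y) - u' x)\<^sup>2) \<partial>lborel)
          \<le> ennreal ((norm y)\<^sup>2) * (\<integral>\<^sup>+x. ennreal ((norm (W' x))\<^sup>2) \<partial>lborel)"
        by (rule translation_difference_le_weak_gradient[where \<psi> = \<psi> and \<rho> = "1/2", OF _ _ _ _ weak])
           (use \<psi>1 \<psi>(1,3) in \<open>auto simp: u'2 W'2\<close>)
      then show ?thesis by (simp add: W'2 ennreal_mult[symmetric] power_mult_distrib)
    qed
    define f where "f x = complex_of_real (G (u x))" for x
    define f' where "f' x = complex_of_real (G (u' x))" for x
    have f_leb: "f \<in> borel_measurable lebesgue"
      unfolding f_def[abs_def]
      by (intro borel_measurable_of_real measurable_compose[OF u_leb]) measurable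
    have ff': "AE x in lborel. f x = f' x" using u' by (auto simp: f_def f'_def elim: eventually_mono)
    have [measurable]: "f' \<in> borel_measurable borel" unfolding f'_def[abs_def] by measurable
    \<comment> \<open>\<open>t\<^sup>\<alpha> \<le> 1 + t\<^sup>2\<close> for \<open>t \<ge> 0\<close>, as \<open>\<alpha> < 2\<close>.\<close>
    have growth: "norm (f' x) \<le> (\<bar>G 0\<bar> + K) + K * (u' x)\<^sup>2" for x
    proof -
      have "\<bar>u' x\<bar> powr \<alpha> \<le> 1 + (u' x)\<^sup>2"
      proof (cases "\<bar>u' x\<bar> \<le> 1")
        case True
        then have "\<bar>u' x\<bar> powr \<alpha> \<le> 1" using \<alpha> powr_mono2[of \<alpha> "\<bar>u' x\<bar>" 1] by simp
        then show ?thesis by (simp add: add_increasing2)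
      next
        case False
        then have "\<bar>u' x\<bar> powr \<alpha> \<le> \<bar>u' x\<bar> powr 2" using \<alpha> by (intro powr_mono) auto
        then show ?thesis by simp
      qed
      then have "K * \<bar>u' x - 0\<bar> powr \<alpha> \<le> K * (1 + (u' x)\<^sup>2)" using K by (intro mult_left_mono) auto
      moreover have "\<bar>G (u' x)\<bar> \<le> \<bar>G 0\<bar> + \<bar>G (u' x) - G 0\<bar>" by simp
      ultimately have "\<bar>G (u' x)\<bar> \<le> \<bar>G 0\<bar> + K * (1 + (u' x)\<^sup>2)" using G[of "u' x" 0] by linarith
      then show ?thesis by (simp add: f'_def algebra_simps)
    qed
    have holder: "norm (f' x - f' y) \<le> K * \<bar>u' x - u' y\<bar> powr \<alpha>" for x y
      using G[of "u' x" "u' y"] by (simp add: f'_def of_real_diff[symmetric] del: of_real_diff)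
    have u'fin: "(\<integral>\<^sup>+x. ennreal ((u' x)\<^sup>2) \<partial>lborel) < \<infinity>" by (simp add: u'2)
    have GK: "\<bar>G 0\<bar> + K \<ge> 0" using K by simp
    note dy = distr_Lp_norm_dyadic_block_le[OF f_leb ff' _ _ GK K growth u'fin \<phi>(1)]
    have N: "distr_Lp_norm (2 / \<alpha>) (dyadic_block \<phi> j (distr_of f))
        \<le> ennreal (D * (min (2 powr (- of_int j) * A) B) powr \<alpha>)" for j
    proof -
      have "2 powi (- j) = 2 powr (- real_of_int j)"
        using powr_real_of_int'[of 2 "- j"] by simp
      moreover have "Lp_norm (2 / \<alpha>) (kernel_convolution (\<lambda>\<xi>. \<phi> ((2 powi (- j)) *\<^sub>R \<xi>)) f')
          \<le> ennreal (D * (min (2 powi (- j) * A) B) powr \<alpha>)"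
        using u'2 by (intro block[where u = u'] A0 B0 holder trans) auto
      ultimately show ?thesis
        using order_trans[OF dy(2)] by simp
    qed
    have "besov_norm \<phi> s (2 / \<alpha>) 1 (\<lambda>x. G (u x))
        = (\<integral>\<^sup>+j. ennreal (2 powr (of_int j * s)) * distr_Lp_norm (2 / \<alpha>) (dyadic_block \<phi> j (distr_of f))
            \<partial>count_space UNIV)"
      using dy(1) by (simp add: besov_norm_def epow_one f_def[abs_def])
    also have "\<dots> \<le> (\<integral>\<^sup>+j. ennreal D * ennreal (2 powr (of_int j * s) * (min (2 powr (- of_int j) * A) B) powr \<alpha>)
            \<partial>count_space UNIV)"
    proof (rule nn_integral_mono)
      fix j :: int
      have "ennreal (2 powr (of_int j * s)) * distr_Lp_norm (2 / \<alpha>) (dyadic_block \<phi> j (distr_of f))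
          \<le> ennreal (2 powr (of_int j * s)) * ennreal (D * (min (2 powr (- of_int j) * A) B) powr \<alpha>)"
        by (intro mult_left_mono N) simp
      also have "\<dots> = ennreal D * ennreal (2 powr (of_int j * s) * (min (2 powr (- of_int j) * A) B) powr \<alpha>)"
        using D by (simp add: ennreal_mult[symmetric] mult_ac)
      finally show "ennreal (2 powr (of_int j * s)) * distr_Lp_norm (2 / \<alpha>) (dyadic_block \<phi> j (distr_of f))
        \<le> ennreal D * ennreal (2 powr (of_int j * s) * (min (2 powr (- of_int j) * A) B) powr \<alpha>)" .
    qed
    also have "\<dots> = ennreal D * (\<integral>\<^sup>+j. ennreal (2 powr (of_int j * s) * (min (2 powr (- of_int j) * A) B) powr \<alpha>)
            \<partial>count_space UNIV)"
      by (rule nn_integral_cmult) auto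
    also have "\<dots> \<le> ennreal D * ennreal (S * (A powr s * B powr (\<alpha> - s)))"
      by (intro mult_left_mono dyadic_sum A0 B0) simp
    also have "\<dots> = ennreal (D * S) * ennreal (A powr s) * ennreal (B powr (\<alpha> - s))"
      using D S by (simp add: ennreal_mult[symmetric] mult_ac)
    also have "\<dots> = ennreal (D * S) * epow (Lp_norm 2 W) s * epow (Lp_norm 2 u) (\<alpha> - s)"
      using u W by (simp add: epow_finite in_Lp_def A_def B_def)
    finally show "besov_norm \<phi> s (2 / \<alpha>) 1 (\<lambda>x. G (u x))
        \<le> ennreal (D * S) * epow (Lp_norm 2 W) s * epow (Lp_norm 2 u) (\<alpha> - s)" .
  qed
qed

theorem proposition2p9:
  fixes \<psi> \<phi> :: "real^3 \<Rightarrow> real" and r r' :: real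
  assumes "littlewood_paley \<psi> \<phi>"
    and "1 < r" and "r < 2" and "1 / r + 1 / r' = 1"
  shows
    "(\<forall>\<alpha>\<in>{0<..<1}. \<forall>s\<in>{0<..<\<alpha>}. \<forall>K\<ge>0. \<exists>C::real.
        \<forall>G. holder_seminorm \<alpha> G = ennreal K \<longrightarrow>
        (\<forall>v \<omega> W.
            vertical_vorticity v \<omega> \<and>
            in_Lp 2 (\<lambda>x. signed_pow (r/2) (\<omega> x)) \<and>
            weak_gradient (\<lambda>x. signed_pow (r/2) (\<omega> x)) W \<and> in_Lp 2 W \<longrightarrow>
            besov_norm \<phi> s (2/\<alpha>) 1 (\<lambda>x. G (signed_pow (r/2) (\<omega> x)))
              \<le> ennreal C * epow (Lp_norm 2 W) s
                  * epow (Lp_norm 2 (\<lambda>x. signed_pow (r/2) (\<omega> x))) (\<alpha> - s)))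
     \<and>
     (\<forall>s\<in>{0<..<2/r'}. \<exists>C::real.
        \<forall>v \<omega> W.
            vertical_vorticity v \<omega> \<and>
            in_Lp 2 (\<lambda>x. signed_pow (r/2) (\<omega> x)) \<and>
            weak_gradient (\<lambda>x. signed_pow (r/2) (\<omega> x)) W \<and> in_Lp 2 W \<longrightarrow>
            besov_norm \<phi> s r' 1 (\<lambda>x. signed_pow (r - 1) (\<omega> x))
              \<le> ennreal C * epow (Lp_norm 2 W) s
                  * epow (Lp_norm 2 (\<lambda>x. signed_pow (r/2) (\<omega> x))) (2/r' - s))"
proof (intro conjI ballI allI impI)
  fix \<alpha> s K :: real
  assume "\<alpha> \<in> {0<..<1}" "s \<in> {0<..<\<alpha>}" and K: "0 \<le> K"
  then have *: "0 < \<alpha>" "\<alpha> < 1" "0 < s" "s < \<alpha>" by auto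
  from besov_norm_holder_composition_le[OF assms(1) * K] obtain C where
    C: "\<And>G u W. (\<And>x y. \<bar>G x - G y\<bar> \<le> K * \<bar>x - y\<bar> powr \<alpha>) \<Longrightarrow>
      in_Lp 2 u \<Longrightarrow> weak_gradient u W \<Longrightarrow> in_Lp 2 W \<Longrightarrow>
      besov_norm \<phi> s (2 / \<alpha>) 1 (\<lambda>x. G (u x))
        \<le> ennreal C * epow (Lp_norm 2 W) s * epow (Lp_norm 2 u) (\<alpha> - s)" by blast
  show "\<exists>C::real. \<forall>G. holder_seminorm \<alpha> G = ennreal K \<longrightarrow>
        (\<forall>v \<omega> W.
            vertical_vorticity v \<omega> \<and>
            in_Lp 2 (\<lambda>x. signed_pow (r/2) (\<omega> x)) \<and>
            weak_gradient (\<lambda>x. signed_pow (r/2) (\<omega> x)) W \<and> in_Lp 2 W \<longrightarrow>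
            besov_norm \<phi> s (2/\<alpha>) 1 (\<lambda>x. G (signed_pow (r/2) (\<omega> x)))
              \<le> ennreal C * epow (Lp_norm 2 W) s
                  * epow (Lp_norm 2 (\<lambda>x. signed_pow (r/2) (\<omega> x))) (\<alpha> - s))"
  proof (intro exI[of _ C] allI impI)
    fix G and v :: "real^3 \<Rightarrow> real^3" and \<omega> W
    assume G: "holder_seminorm \<alpha> G = ennreal K"
      and "vertical_vorticity v \<omega> \<and> in_Lp 2 (\<lambda>x. signed_pow (r/2) (\<omega> x)) \<and>
        weak_gradient (\<lambda>x. signed_pow (r/2) (\<omega> x)) W \<and> in_Lp 2 W"
    then show "besov_norm \<phi> s (2/\<alpha>) 1 (\<lambda>x. G (signed_pow (r/2) (\<omega> x)))
              \<le> ennreal C * epow (Lp_norm 2 W) s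
                  * epow (Lp_norm 2 (\<lambda>x. signed_pow (r/2) (\<omega> x))) (\<alpha> - s)"
      by (intro C holder_seminorm_bound[OF G K]) auto
  qed
next
  fix s assume s: "s \<in> {0<..<2/r'}"
  have r': "r' = r / (r - 1)"
  proof -
    have "1 / r' = (r - 1) / r" using assms by (simp add: field_simps)
    then show ?thesis by (metis inverse_divide inverse_eq_divide inverse_inverse_eq)
  qed
  define \<alpha> where "\<alpha> = 2 / r'"
  have \<alpha>_eq: "\<alpha> = 2 * (r - 1) / r" by (simp add: \<alpha>_def r')
  have *: "0 < \<alpha>" "\<alpha> < 1" "0 < s" "s < \<alpha>" using assms s by (auto simp: \<alpha>_eq \<alpha>_def[symmetric])
  have p: "2 / \<alpha> = r'" by (simp add: \<alpha>_def)
  \<comment> \<open>The exponents compose because \<open>(r/2) (2/r') = r/r' = r - 1\<close>.\<close>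
  have pow: "signed_pow \<alpha> (signed_pow (r/2) a) = signed_pow (r - 1) a" for a
  proof -
    have "r / 2 * \<alpha> = r - 1" using assms by (simp add: \<alpha>_eq)
    then show ?thesis by (simp only: signed_pow_signed_pow)
  qed
  have G: "\<bar>signed_pow \<alpha> x - signed_pow \<alpha> y\<bar> \<le> 2 * \<bar>x - y\<bar> powr \<alpha>" for x y
    using * by (intro signed_pow_holder) auto
  from besov_norm_holder_composition_le[OF assms(1) *, of 2] obtain C where
    C: "\<And>G u W. (\<And>x y. \<bar>G x - G y\<bar> \<le> 2 * \<bar>x - y\<bar> powr \<alpha>) \<Longrightarrow>
      in_Lp 2 u \<Longrightarrow> weak_gradient u W \<Longrightarrow> in_Lp 2 W \<Longrightarrow>
      besov_norm \<phi> s (2 / \<alpha>) 1 (\<lambda>x. G (u x))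
        \<le> ennreal C * epow (Lp_norm 2 W) s * epow (Lp_norm 2 u) (\<alpha> - s)" by auto
  from C[OF G] have "in_Lp 2 (\<lambda>x. signed_pow (r/2) (\<omega> x)) \<Longrightarrow>
      weak_gradient (\<lambda>x. signed_pow (r/2) (\<omega> x)) W \<Longrightarrow> in_Lp 2 W \<Longrightarrow>
      besov_norm \<phi> s r' 1 (\<lambda>x. signed_pow (r - 1) (\<omega> x))
        \<le> ennreal C * epow (Lp_norm 2 W) s * epow (Lp_norm 2 (\<lambda>x. signed_pow (r/2) (\<omega> x))) (2/r' - s)"
    for \<omega> W unfolding pow[symmetric] p[symmetric] \<alpha>_def[symmetric] by (simp add: p \<alpha>_def)
  then show "\<exists>C::real. \<forall>v \<omega> W.
            vertical_vorticity v \<omega> \<and>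
            in_Lp 2 (\<lambda>x. signed_pow (r/2) (\<omega> x)) \<and>
            weak_gradient (\<lambda>x. signed_pow (r/2) (\<omega> x)) W \<and> in_Lp 2 W \<longrightarrow>
            besov_norm \<phi> s r' 1 (\<lambda>x. signed_pow (r - 1) (\<omega> x))
              \<le> ennreal C * epow (Lp_norm 2 W) s
                  * epow (Lp_norm 2 (\<lambda>x. signed_pow (r/2) (\<omega> x))) (2/r' - s)"
    by blast
qed

end
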